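(* Let $D\subset\mathbb{R}^2$ be a bounded open simply connected domain, $x_0\in D$, and let $B$ be a planar Brownian motion started from $x_0$. The local time process $L_{x,\varepsilon}(\tau)$, indexed by $(x,\varepsilon)$ with $x\in D$ and $0<\varepsilon<\mathrm d(x,\partial D)$, possesses a jointly continuous modification $\tilde L_{x,\varepsilon}(\tau)$. In fact, this modification is $\alpha$-Hölder for all $\alpha<1/3$.
   Context: $\tau:=\inf\{t\ge0:B_t\notin D\}$. For $x\in\mathbb{R}^2$ and $\varepsilon>0$, $L_{x,\varepsilon}(t)$ is the local time at level $\varepsilon$ up to time $t$ of the process $(|B_s-x|,s\ge0)$: $$L_{x,\varepsilon}(t):=\lim_{r\downarrow0}\frac1{2r}\int_0^t\mathbf 1_{\{\varepsilon-r\le|B_s-x|\le\varepsilon+r\}}ds ,$$ where $|\cdot|$ is the Euclidean norm. $\mathrm d(x,\partial D)$ is the Euclidean distance from $x$ to $\partial D$. Hölder continuity is in the variable $(x,\varepsilon)\in\mathbb{R}^2\times\mathbb{R}$, with respect to any norm. *)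

theory Defs
  imports "HOL-Probability.Probability"
begin

text \<open>
  Increments over \<open>[s, t]\<close> have the law \<open>N(0, (t - s) I)\<close> on the plane, given by its density
  in Cartesian coordinates. No path property is required on negative times.
\<close>

locale planar_brownian_motion = prob_space M
  for M :: "'w measure" +
  fixes B :: "real \<Rightarrow> 'w \<Rightarrow> real^2" and x0 :: "real^2"
  assumes measurable_B: "\<And>t. 0 \<le> t \<Longrightarrow> B t \<in> borel_measurable M"
    and start: "AE \<omega> in M. B 0 \<omega> = x0"
    and indep_increments:
      "\<And>(t :: nat \<Rightarrow> real) n. 0 \<le> t 0 \<Longrightarrow> (\<And>i. i < n \<Longrightarrow> t i \<le> t (Suc i)) \<Longrightarrow>
         indep_vars (\<lambda>_. borel) (\<lambda>i \<omega>. B (t (Suc i)) \<omega> - B (t i) \<omega>) {..<n}"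
    and gaussian_increments:
      "\<And>s t. 0 \<le> s \<Longrightarrow> s < t \<Longrightarrow>
         distributed M lborel (\<lambda>\<omega>. B t \<omega> - B s \<omega>)
           (\<lambda>z. ennreal (normal_density 0 (sqrt (t - s)) (z $ 1) *
                         normal_density 0 (sqrt (t - s)) (z $ 2)))"
    and continuous_paths: "AE \<omega> in M. continuous_on {0..} (\<lambda>t. B t \<omega>)"

text \<open>
  The infimum is taken in the reals, so it carries no information on paths that never leave \<open>D\<close>;
  for bounded \<open>D\<close> these form a null event under Brownian motion.
\<close>

definition exit_time :: "(real \<Rightarrow> 'w \<Rightarrow> real^2) \<Rightarrow> (real^2) set \<Rightarrow> 'w \<Rightarrow> real" where
  "exit_time B D \<omega> = Inf {t. 0 \<le> t \<and> B t \<omega> \<notin> D}"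

definition annulus_occupation ::
    "(real \<Rightarrow> 'w \<Rightarrow> real^2) \<Rightarrow> real^2 \<Rightarrow> real \<Rightarrow> real \<Rightarrow> 'w \<Rightarrow> real \<Rightarrow> real" where
  "annulus_occupation B x \<epsilon> t \<omega> r =
     1 / (2 * r) *
       (LBINT s:{0..t}. indicat_real {y. \<epsilon> - r \<le> norm (y - x) \<and> norm (y - x) \<le> \<epsilon> + r} (B s \<omega>))"

text \<open>
  \<open>Lim\<close> is an unspecified real where the limit does not exist, so statements about
  \<open>local_time\<close> should come with convergence of \<open>annulus_occupation\<close>.
\<close>

definition local_time ::
    "(real \<Rightarrow> 'w \<Rightarrow> real^2) \<Rightarrow> real^2 \<Rightarrow> real \<Rightarrow> real \<Rightarrow> 'w \<Rightarrow> real" where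
  "local_time B x \<epsilon> t \<omega> = Lim (at_right 0) (annulus_occupation B x \<epsilon> t \<omega>)"

definition disc_index :: "(real^2) set \<Rightarrow> ((real^2) \<times> real) set" where
  "disc_index D = {(x, \<epsilon>). x \<in> D \<and> 0 < \<epsilon> \<and> \<epsilon> < infdist x (frontier D)}"

definition is_modification ::
    "'w measure \<Rightarrow> 'i set \<Rightarrow> ('i \<Rightarrow> 'w \<Rightarrow> real) \<Rightarrow> ('i \<Rightarrow> 'w \<Rightarrow> real) \<Rightarrow> bool" where
  "is_modification M I X Y \<longleftrightarrow>
     (\<forall>i\<in>I. Y i \<in> borel_measurable M \<and> (AE \<omega> in M. Y i \<omega> = X i \<omega>))"

definition holder_on :: "real \<Rightarrow> 'b::metric_space set \<Rightarrow> ('b \<Rightarrow> real) \<Rightarrow> bool" where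
  "holder_on \<alpha> S f \<longleftrightarrow> (\<exists>C. \<forall>p\<in>S. \<forall>q\<in>S. \<bar>f p - f q\<bar> \<le> C * dist p q powr \<alpha>)"

end

theory Submission
  imports Defs "HOL-Real_Asymp.Real_Asymp"
begin

text \<open>
  The circle of radius \<open>a\<close> about \<open>x\<close> is smoothed to the explicit profile
  \<open>f = 2 m a\<^sup>2\<^sup>m\<^sup>+\<^sup>1 R\<^sup>m\<^sup>-\<^sup>1 / (R\<^sup>m + a\<^sup>2\<^sup>m)\<^sup>2\<close> with \<open>R = |z - x|\<^sup>2\<close>, which is half the Laplacian of
  \<open>(a / m) ln (R\<^sup>m + a\<^sup>2\<^sup>m)\<close>; as \<open>m\<close> grows this potential converges, with uniform error \<open>a / m\<close>, to the
  logarithmic potential \<open>a ln (max R a\<^sup>2)\<close> of the circle. By Dynkin's formula the potential of the difference of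
  two profiles is therefore almost Lipschitz in \<open>(x, a)\<close>. If the potential of \<open>f\<close> is at most \<open>\<delta>\<close> and that of
  some \<open>g \<ge> |f|\<close> is at most \<open>A\<close>, then the Markov property bounds the moment of order \<open>2k\<close> of
  \<open>\<integral> f(B\<^sub>s) ds\<close> by a multiple of \<open>(\<delta> A)\<^sup>k\<close>, so increments of the smoothed local times are of order
  almost \<open>1/2\<close> in every \<open>L\<^sup>p\<close>. A union bound over polynomially fine nets, for \<open>m = 2\<^sup>n\<close> and \<open>p\<close> large,
  gives almost surely an exponent \<open>1/3\<close> which is uniform in \<open>n\<close> and in the time, and hence a limit field. It is
  an occupation density of \<open>|B - x|\<close>, hence equal to the local time at all times simultaneously, in particular at
  the exit time.
\<close>

section \<open>The planar Gaussian semigroup\<close>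

text \<open>The exponent 1/3 leaves room for several losses. The potential of a difference is only
  3/4-Hoelder, since the radius enters through \<open>a * ln a\<close>, which is not Lipschitz at 0.
  Moments halve this to 3/8, because a difference of profiles has a small potential while its
  absolute value does not. The margin 3/8 - 1/3 = 1/24 pays for the union bound: with moments of
  order p it is worth 2^(p n / 24), and p = 1248 = 24 * 52 makes this one factor 2^n more than the
  2^(51 n) triples of two net points and a time. No stochastic calculus is involved: Dynkin's
  formula comes from one Gaussian vector scaled by the square root of time, and the Markov property
  is applied at deterministic times only. The exit time is inserted at the very end into bounds
  valid for all times at once; these are available because at level n every functional is Lipschitz
  in time with constant of order 4^n, so that a time grid of mesh 8^(-n) suffices. Radii near 0,
  where profiles are unbounded, are truncated at 2^(-n) at level n.\<close>

definition vec2 :: "real \<times> real \<Rightarrow> real^2" where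
  "vec2 p = vector [fst p, snd p]"

lemma vec2_nth [simp]: "vec2 p $ 1 = fst p" "vec2 p $ 2 = snd p"
  by (simp_all add: vec2_def)

lemma linear_vec2: "linear vec2"
  by (rule linearI) (simp_all add: vec_eq_iff forall_2)

lemma vec2_measurable [measurable]: "vec2 \<in> borel_measurable borel"
  by (intro borel_measurable_continuous_onI linear_continuous_on linear_conv_bounded_linear[THEN iffD1] linear_vec2)

lemma norm_real2_sq: "(norm (z::real^2))\<^sup>2 = (z $ 1)\<^sup>2 + (z $ 2)\<^sup>2"
  by (simp add: norm_vec_def L2_set_def sum_2)

lemma Basis_real2: "(Basis :: (real^2) set) = {axis 1 1, axis 2 1}"
  by (auto simp: Basis_vec_def UNIV_2)

text \<open>Lebesgue measure is determined by its values on boxes, and \<open>vec2\<close> pulls a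
  box back to a product of two intervals. Through this a density in the two coordinates becomes a
  product measure.\<close>

lemma lborel_real2: "lborel = distr (lborel \<Otimes>\<^sub>M lborel) borel vec2"
proof (rule lborel_eqI)
  fix l u :: "real^2"
  assume le: "\<And>b. b \<in> Basis \<Longrightarrow> l \<bullet> b \<le> u \<bullet> b"
  have le': "l $ 1 \<le> u $ 1" "l $ 2 \<le> u $ 2"
    using le[of "axis 1 1"] le[of "axis 2 1"] by (auto simp: Basis_real2 inner_axis)
  have vm: "vec2 \<in> (lborel \<Otimes>\<^sub>M lborel) \<rightarrow>\<^sub>M borel"
    using vec2_measurable by (simp add: lborel_prod)
  have "vec2 -` box l u \<inter> space (lborel \<Otimes>\<^sub>M lborel) = {l$1<..<u$1} \<times> {l$2<..<u$2}"
    by (auto simp: mem_box Basis_real2 inner_axis space_pair_measure)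
  then have "emeasure (distr (lborel \<Otimes>\<^sub>M lborel) borel vec2) (box l u)
      = emeasure (lborel \<Otimes>\<^sub>M lborel) ({l$1<..<u$1} \<times> {l$2<..<u$2})"
    using vm by (subst emeasure_distr) auto
  also have "\<dots> = ennreal (u$1 - l$1) * ennreal (u$2 - l$2)"
    using le' by (subst lborel.emeasure_pair_measure_Times) auto
  also have "\<dots> = ennreal (\<Prod>b\<in>Basis. (u - l) \<bullet> b)"
    using le' by (simp add: Basis_real2 inner_axis ennreal_mult axis_eq_axis)
  finally show "emeasure (distr (lborel \<Otimes>\<^sub>M lborel) borel vec2) (box l u) = ennreal (\<Prod>b\<in>Basis. (u - l) \<bullet> b)" .
qed simp

section \<open>The standard Gaussian pair and its scalings\<close>

abbreviation gauss :: "real measure" where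
  "gauss \<equiv> density lborel std_normal_density"

text \<open>One noise space serves all times: the increment over a time span w is represented as
  \<open>sqrt w *\<^sub>R vec2 \<xi>\<close>, so that expectations at different times are integrals
  over the same measure and can be differentiated in the scale.\<close>

definition gauss2 :: "(real \<times> real) measure" where
  "gauss2 = gauss \<Otimes>\<^sub>M gauss"

interpretation gauss: prob_space gauss
  by (rule prob_space_normal_density) simp

interpretation gauss_pair: pair_prob_space gauss gauss ..

interpretation gauss2: prob_space gauss2
  unfolding gauss2_def by (rule gauss_pair.prob_space_axioms)

lemma sets_gauss2 [measurable_cong, simp]: "sets gauss2 = sets borel"
  unfolding gauss2_def borel_prod[symmetric] by (intro sets_pair_measure_cong) simp_all

lemma space_gauss2 [simp]: "space gauss2 = UNIV"
  by (simp add: gauss2_def space_pair_measure)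

lemma gauss_abs_integrable: "integrable gauss (\<lambda>x. \<bar>x\<bar>)"
  using integrable_std_normal_moment_abs[of 1]
  by (subst integrable_density) (auto simp: )

lemma gauss2_integrable_fst: "integrable gauss2 (\<lambda>\<xi>. \<bar>fst \<xi>\<bar>)"
  and gauss2_integrable_snd: "integrable gauss2 (\<lambda>\<xi>. \<bar>snd \<xi>\<bar>)"
proof -
  show "integrable gauss2 (\<lambda>\<xi>. \<bar>fst \<xi>\<bar>)"
    unfolding gauss2_def using gauss_abs_integrable
    by (subst gauss_pair.integrable_product_swap_iff[symmetric], intro gauss_pair.Fubini_integrable)
       (auto simp: split_beta integrable_const intro!: gauss.integrable_const)
  show "integrable gauss2 (\<lambda>\<xi>. \<bar>snd \<xi>\<bar>)"
    unfolding gauss2_def using gauss_abs_integrable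
    by (intro gauss_pair.Fubini_integrable) (auto)
qed

lemma normal_scale:
  assumes "0 < \<sigma>"
  shows "density lborel (normal_density 0 \<sigma>) = distr gauss borel (\<lambda>x. \<sigma> * x)"
proof -
  have d: "distributed gauss lborel (\<lambda>x. x) std_normal_density"
    by (auto simp: distributed_def distr_id2 sets_density)
  have "distributed gauss lborel (\<lambda>x. 0 + \<sigma> * x) (normal_density (0 + \<sigma> * 0) (\<bar>\<sigma>\<bar> * 1))"
    by (rule gauss.normal_density_affine[OF d]) (use assms in auto)
  then have "distr gauss lborel (\<lambda>x. \<sigma> * x) = density lborel (normal_density 0 \<sigma>)"
    using assms by (simp add: distributed_def)
  then show ?thesis
    by (metis distr_cong sets_lborel)
qed

text \<open>Passes from the coordinate density, by which \<open>planar_brownian_motion\<close>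
  specifies its increments, to the scaled image of the standard pair used in
  \<open>continuous_bm\<close>.\<close>

lemma gaussian_law_real2:
  assumes "0 < \<sigma>"
  shows "density lborel (\<lambda>z::real^2. ennreal (normal_density 0 \<sigma> (z $ 1) * normal_density 0 \<sigma> (z $ 2)))
     = distr gauss2 borel (\<lambda>\<xi>. \<sigma> *\<^sub>R vec2 \<xi>)"
proof -
  interpret n: prob_space "density lborel (normal_density 0 \<sigma>)"
    by (rule prob_space_normal_density[OF assms])
  have vm: "vec2 \<in> (lborel \<Otimes>\<^sub>M lborel) \<rightarrow>\<^sub>M borel"
    using vec2_measurable by (simp add: lborel_prod)
  have "density lborel (\<lambda>z::real^2. ennreal (normal_density 0 \<sigma> (z $ 1) * normal_density 0 \<sigma> (z $ 2)))
    = distr (density (lborel \<Otimes>\<^sub>M lborel) (\<lambda>p. ennreal (normal_density 0 \<sigma> (fst p) * normal_density 0 \<sigma> (snd p)))) borel vec2"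
    by (subst lborel_real2, subst density_distr) (use vm in \<open>auto\<close>)
  also have "density (lborel \<Otimes>\<^sub>M lborel) (\<lambda>p. ennreal (normal_density 0 \<sigma> (fst p) * normal_density 0 \<sigma> (snd p)))
     = density lborel (normal_density 0 \<sigma>) \<Otimes>\<^sub>M density lborel (normal_density 0 \<sigma>)"
    by (subst pair_measure_density)
       (auto simp: ennreal_mult case_prod_unfold intro!: lborel.sigma_finite_measure_axioms n.sigma_finite_measure_axioms)
  also have "\<dots> = distr gauss2 (borel \<Otimes>\<^sub>M borel) (\<lambda>(x, y). (\<sigma> * x, \<sigma> * y))"
    unfolding normal_scale[OF assms] gauss2_def
    by (subst pair_measure_distr)
       (auto simp: intro!: prob_space_imp_sigma_finite gauss.prob_space_distr)
  also have "distr \<dots> borel vec2 = distr gauss2 borel (\<lambda>\<xi>. \<sigma> *\<^sub>R vec2 \<xi>)"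
    using vec2_measurable
    by (subst distr_distr) (auto simp: gauss2_def borel_prod comp_def split_beta linear_vec2[THEN linear_scale, symmetric]
      intro!: distr_cong measurable_Pair)
  finally show ?thesis .
qed

section \<open>Gaussian integration by parts and Dynkin's formula for radial functions\<close>

lemma std_normal_has_derivative:
  "(std_normal_density has_real_derivative (- x * std_normal_density x)) (at x)"
  unfolding std_normal_density_def
  by (auto intro!: derivative_eq_intros simp: field_simps power2_eq_square)

lemma std_normal_tendsto_0:
  "(std_normal_density \<longlongrightarrow> 0) at_top" "(std_normal_density \<longlongrightarrow> 0) at_bot"
proof -
  have 1: "filterlim (\<lambda>x::real. - x\<^sup>2 / 2) at_bot at_top" by real_asymp
  have 2: "filterlim (\<lambda>x::real. - x\<^sup>2 / 2) at_bot at_bot" by real_asymp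
  show "(std_normal_density \<longlongrightarrow> 0) at_top" "(std_normal_density \<longlongrightarrow> 0) at_bot"
    unfolding std_normal_density_def
    using tendsto_mult_right[OF filterlim_compose[OF exp_at_bot 1], of "1 / sqrt (2*pi)"]
      tendsto_mult_right[OF filterlim_compose[OF exp_at_bot 2], of "1 / sqrt (2*pi)"] by auto
qed

text \<open>Stein's identity: the difference of the integrands, times the Gaussian density, is the
  derivative of F times the density. Its integral over the line vanishes because F is bounded and
  the density tends to 0 at both ends.\<close>

lemma gauss_ibp:
  fixes F F' :: "real \<Rightarrow> real"
  assumes der: "\<And>x. (F has_real_derivative F' x) (at x)"
    and cont: "continuous_on UNIV F'"
    and bd: "\<And>x. \<bar>F x\<bar> \<le> C" "\<And>x. \<bar>F' x\<bar> \<le> C"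
  shows "(LINT x|gauss. F x * x) = (LINT x|gauss. F' x)"
proof -
  let ?\<phi> = std_normal_density
  have cF: "continuous_on UNIV F"
    using der by (meson DERIV_isCont continuous_at_imp_continuous_on)
  have [measurable]: "F \<in> borel_measurable borel" "F' \<in> borel_measurable borel"
    using cF cont by (auto intro: borel_measurable_continuous_onI)
  have C: "0 \<le> C" using bd(1)[of 0] by linarith
  have i1: "integrable lborel (\<lambda>x. ?\<phi> x * F' x)"
    by (rule Bochner_Integration.integrable_bound[where f="\<lambda>x. C * ?\<phi> x"])
      (use bd C in \<open>auto simp: abs_mult mult.commute intro!: AE_I2 mult_right_mono\<close>)
  have i2: "integrable lborel (\<lambda>x. ?\<phi> x * (F x * x))"
    by (rule Bochner_Integration.integrable_bound[where f="\<lambda>x. C * (?\<phi> x * \<bar>x\<bar>)"])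
      (use bd C integrable_std_normal_moment_abs[of 1] in \<open>auto simp: abs_mult mult.left_commute intro!: AE_I2 mult_left_mono mult_right_mono\<close>)
  define h where "h x = ?\<phi> x * F' x - ?\<phi> x * (F x * x)" for x
  have dh: "((\<lambda>x. F x * ?\<phi> x) has_real_derivative h x) (at x)" for x
    unfolding h_def by (rule DERIV_cong[OF DERIV_mult[OF der std_normal_has_derivative]]) (simp add: algebra_simps)
  have ch: "isCont h x" for x
    unfolding h_def std_normal_density_def
    using cF cont by (auto simp: continuous_on_eq_continuous_at intro!: continuous_intros)
  have t: "((\<lambda>x. F x * ?\<phi> x) \<longlongrightarrow> 0) at_top" "((\<lambda>x. F x * ?\<phi> x) \<longlongrightarrow> 0) at_bot"
    by (rule Lim_null_comparison[OF _ tendsto_mult_right_zero[OF std_normal_tendsto_0(1), of C]],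
       auto simp: abs_mult intro!: always_eventually mult_right_mono bd,
       rule Lim_null_comparison[OF _ tendsto_mult_right_zero[OF std_normal_tendsto_0(2), of C]],
       auto simp: abs_mult intro!: always_eventually mult_right_mono bd)
  have "(LBINT x=-\<infinity>..\<infinity>. h x) = 0 - 0"
  proof (rule interval_integral_FTC_integrable[where F="\<lambda>x. F x * ?\<phi> x"])
    show "set_integrable lborel (einterval (- \<infinity>) \<infinity>) h"
      using i1 i2 by (auto simp: set_integrable_def h_def einterval_def)
    show "(((\<lambda>x. F x * ?\<phi> x) \<circ> real_of_ereal) \<longlongrightarrow> 0) (at_right (- \<infinity>))"
      using t(2) by (simp add: ereal_tendsto_simps)
    show "(((\<lambda>x. F x * ?\<phi> x) \<circ> real_of_ereal) \<longlongrightarrow> 0) (at_left \<infinity>)"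
      using t(1) by (simp add: ereal_tendsto_simps)
  qed (use dh ch in \<open>auto simp: has_real_derivative_iff_has_vector_derivative\<close>)
  then have "(LINT x|lborel. h x) = 0"
    by (simp add: interval_lebesgue_integral_def set_lebesgue_integral_def einterval_def)
  then have "(LINT x|lborel. ?\<phi> x * F' x) = (LINT x|lborel. ?\<phi> x * (F x * x))"
    unfolding h_def using i1 i2 by simp
  then show ?thesis
    by (simp add: integral_density)
qed

text \<open>Stein's identity in one coordinate with the other one frozen, integrated by Fubini. In
  both parts the first argument of \<open>F\<close> is the active coordinate; it is
  \<open>fst \<xi>\<close> in the first part and \<open>snd \<xi>\<close> in the second.\<close>

lemma gauss2_ibp:
  fixes F F' :: "real \<Rightarrow> real \<Rightarrow> real"
  assumes der: "\<And>x y. ((\<lambda>x. F x y) has_real_derivative F' x y) (at x)"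
    and cont: "\<And>y. continuous_on UNIV (\<lambda>x. F' x y)"
    and meas: "(\<lambda>p. F (fst p) (snd p)) \<in> borel_measurable borel" "(\<lambda>p. F' (fst p) (snd p)) \<in> borel_measurable borel"
    and bd: "\<And>x y. \<bar>F x y\<bar> \<le> C" "\<And>x y. \<bar>F' x y\<bar> \<le> C"
  shows "(LINT \<xi>|gauss2. F (fst \<xi>) (snd \<xi>) * fst \<xi>) = (LINT \<xi>|gauss2. F' (fst \<xi>) (snd \<xi>))"
    and "(LINT \<xi>|gauss2. F (snd \<xi>) (fst \<xi>) * snd \<xi>) = (LINT \<xi>|gauss2. F' (snd \<xi>) (fst \<xi>))"
proof -
  note [measurable] = meas
  have m1: "(\<lambda>\<xi>. F (snd \<xi>) (fst \<xi>)) \<in> borel_measurable borel"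
    using measurable_compose[of prod.swap borel borel, OF _ meas(1)]
    by (simp add: prod.swap_def borel_measurable_continuous_onI continuous_on_Pair continuous_on_fst continuous_on_snd)
  have m2: "(\<lambda>\<xi>. F' (snd \<xi>) (fst \<xi>)) \<in> borel_measurable borel"
    using measurable_compose[of prod.swap borel borel, OF _ meas(2)]
    by (simp add: prod.swap_def borel_measurable_continuous_onI continuous_on_Pair continuous_on_fst continuous_on_snd)
  have [measurable]: "fst \<in> borel_measurable (borel :: (real \<times> real) measure)" "snd \<in> borel_measurable (borel :: (real \<times> real) measure)"
    by (auto intro!: borel_measurable_continuous_onI continuous_intros)
  have C: "0 \<le> C" using bd(1)[of 0 0] by linarith
  have i1: "integrable gauss2 (\<lambda>\<xi>. F (fst \<xi>) (snd \<xi>) * fst \<xi>)"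
    by (rule Bochner_Integration.integrable_bound[OF integrable_mult_right[where c=C, OF gauss2_integrable_fst]])
      (use bd C in \<open>auto simp: abs_mult intro!: AE_I2 mult_right_mono\<close>)
  have i2: "integrable gauss2 (\<lambda>\<xi>. F (snd \<xi>) (fst \<xi>) * snd \<xi>)"
    by (rule Bochner_Integration.integrable_bound[OF integrable_mult_right[where c=C, OF gauss2_integrable_snd]])
      (use bd C m1 in \<open>auto simp: abs_mult intro!: AE_I2 mult_right_mono\<close>)
  have i3: "integrable gauss2 (\<lambda>\<xi>. F' (fst \<xi>) (snd \<xi>))"
    by (rule gauss2.integrable_const_bound[where B=C]) (use bd in auto)
  have i4: "integrable gauss2 (\<lambda>\<xi>. F' (snd \<xi>) (fst \<xi>))"
    by (rule gauss2.integrable_const_bound[where B=C]) (use bd m2 in auto)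
  have e: "(LINT x|gauss. F x y * x) = (LINT x|gauss. F' x y)" for y
    by (rule gauss_ibp) (use der cont bd in auto)
  show "(LINT \<xi>|gauss2. F (fst \<xi>) (snd \<xi>) * fst \<xi>) = (LINT \<xi>|gauss2. F' (fst \<xi>) (snd \<xi>))"
    using gauss_pair.integral_snd[of "\<lambda>x y. F x y * x"] gauss_pair.integral_snd[of F'] i1 i3 e
    by (simp add: gauss2_def case_prod_unfold)
  show "(LINT \<xi>|gauss2. F (snd \<xi>) (fst \<xi>) * snd \<xi>) = (LINT \<xi>|gauss2. F' (snd \<xi>) (fst \<xi>))"
    using gauss_pair.integral_fst[of "\<lambda>x y. F y x * y"] gauss_pair.integral_fst[of "\<lambda>x y. F' y x"] i2 i4 e
    by (simp add: gauss2_def case_prod_unfold)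
qed

text \<open>The parameter s is the square root of time, hence the weight \<open>2 * s\<close>.
  Differentiating in s produces the gradient paired with the noise, and Stein's identity turns the
  noise into s times second derivatives. For a function \<open>\<psi>0\<close> of the squared norm R
  the planar Laplacian is 4 (\<open>\<psi>1\<close> + R \<open>\<psi>2\<close>), so the inner
  integrand is half of it.\<close>

lemma radial_dynkin:
  fixes \<psi>0 \<psi>1 \<psi>2 :: "real \<Rightarrow> real" and u1 u2 C r :: real
  defines "R \<equiv> \<lambda>s \<xi>. (u1 + s * fst \<xi>)\<^sup>2 + (u2 + s * snd \<xi>)\<^sup>2"
  assumes d0: "\<And>R. (\<psi>0 has_real_derivative \<psi>1 R) (at R)"
    and d1: "\<And>R. (\<psi>1 has_real_derivative \<psi>2 R) (at R)"
    and c2: "continuous_on UNIV \<psi>2"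
    and b1: "\<And>R. 0 \<le> R \<Longrightarrow> \<bar>\<psi>1 R\<bar> \<le> C" "\<And>R. 0 \<le> R \<Longrightarrow> \<bar>\<psi>1 R\<bar> * sqrt R \<le> C"
    and b2: "\<And>R. 0 \<le> R \<Longrightarrow> \<bar>\<psi>2 R\<bar> * R \<le> C"
    and r: "0 \<le> r"
  shows "integrable gauss2 (\<lambda>\<xi>. \<psi>0 (R r \<xi>))"
    and "(LINT \<xi>|gauss2. \<psi>0 (R r \<xi>)) - \<psi>0 (u1\<^sup>2 + u2\<^sup>2)
       = (LBINT s:{0..r}. 2 * s * (LINT \<xi>|gauss2. 2 * \<psi>1 (R s \<xi>) + 2 * R s \<xi> * \<psi>2 (R s \<xi>)))"
proof -
  have c0: "continuous_on UNIV \<psi>0" and c1: "continuous_on UNIV \<psi>1"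
    using d0 d1 by (meson DERIV_isCont continuous_at_imp_continuous_on)+
  have [measurable]: "\<psi>0 \<in> borel_measurable borel" "\<psi>1 \<in> borel_measurable borel" "\<psi>2 \<in> borel_measurable borel"
    using c0 c1 c2 by (auto intro: borel_measurable_continuous_onI)
  have [measurable]: "fst \<in> borel_measurable (borel :: (real \<times> real) measure)" "snd \<in> borel_measurable (borel :: (real \<times> real) measure)"
    by (auto intro!: borel_measurable_continuous_onI continuous_intros)
  have C: "0 \<le> C" using b1(1)[of 0] by linarith
  have R0: "0 \<le> R s \<xi>" for s \<xi> by (simp add: R_def)
  have p1: "\<bar>\<psi>1 (R s \<xi>) * (u1 + s * fst \<xi>)\<bar> \<le> C" for s \<xi>
  proof -
    have "\<bar>u1 + s * fst \<xi>\<bar> \<le> sqrt (R s \<xi>)" unfolding R_def by (rule real_le_rsqrt) simp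
    then have "\<bar>\<psi>1 (R s \<xi>)\<bar> * \<bar>u1 + s * fst \<xi>\<bar> \<le> \<bar>\<psi>1 (R s \<xi>)\<bar> * sqrt (R s \<xi>)" by (intro mult_left_mono) auto
    then show ?thesis using b1(2)[OF R0, of s \<xi>] by (simp add: abs_mult)
  qed
  have p2: "\<bar>\<psi>1 (R s \<xi>) * (u2 + s * snd \<xi>)\<bar> \<le> C" for s \<xi>
  proof -
    have "\<bar>u2 + s * snd \<xi>\<bar> \<le> sqrt (R s \<xi>)" unfolding R_def by (rule real_le_rsqrt) simp
    then have "\<bar>\<psi>1 (R s \<xi>)\<bar> * \<bar>u2 + s * snd \<xi>\<bar> \<le> \<bar>\<psi>1 (R s \<xi>)\<bar> * sqrt (R s \<xi>)" by (intro mult_left_mono) auto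
    then show ?thesis using b1(2)[OF R0, of s \<xi>] by (simp add: abs_mult)
  qed
  have q: "\<bar>w * \<psi>2 (R s \<xi>)\<bar> \<le> C" if "0 \<le> w" "w \<le> R s \<xi>" for w s \<xi>
  proof -
    have "\<bar>\<psi>2 (R s \<xi>)\<bar> * w \<le> \<bar>\<psi>2 (R s \<xi>)\<bar> * R s \<xi>" using that by (intro mult_left_mono) auto
    then show ?thesis using b2[OF R0, of s \<xi>] that by (simp add: abs_mult mult.commute)
  qed
  have q3: "\<bar>s * (A + 2 * B)\<bar> \<le> \<bar>s\<bar> * (3 * C)" if "\<bar>A\<bar> \<le> C" "\<bar>B\<bar> \<le> C" for A B s :: real
    unfolding abs_mult[of s] using that by (intro mult_left_mono) (auto intro: order_trans[OF abs_triangle_ineq])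
  \<comment> \<open>\<open>k s \<xi>\<close> is the derivative in s of
    \<open>\<psi>0 (R s \<xi>)\<close>.\<close>
  define k where "k s \<xi> = 2 * (\<psi>1 (R s \<xi>) * (u1 + s * fst \<xi>) * fst \<xi>) + 2 * (\<psi>1 (R s \<xi>) * (u2 + s * snd \<xi>) * snd \<xi>)" for s \<xi>
  have kb: "\<bar>k s \<xi>\<bar> \<le> 2 * C * (\<bar>fst \<xi>\<bar> + \<bar>snd \<xi>\<bar>)" for s \<xi>
  proof -
    have "\<bar>2 * (A * x) + 2 * (B * y)\<bar> \<le> 2 * C * (\<bar>x\<bar> + \<bar>y\<bar>)" if "\<bar>A\<bar> \<le> C" "\<bar>B\<bar> \<le> C" for A B x y
      using mult_right_mono[OF that(1) abs_ge_zero[of x]] mult_right_mono[OF that(2) abs_ge_zero[of y]]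
        abs_mult[of A x] abs_mult[of B y] by (simp add: distrib_left) linarith
    from this[OF p1 p2] show ?thesis unfolding k_def .
  qed
  have contk: "continuous_on A (\<lambda>s. k s \<xi>)" for A \<xi>
    unfolding k_def R_def
    by (intro continuous_intros continuous_on_compose2[OF c1]) auto
  have k_int: "set_integrable lborel {0..t} (\<lambda>s. k s \<xi>)" for t \<xi>
    by (rule borel_integrable_atLeastAtMost') (rule contk)
  have ftc: "\<psi>0 (R r \<xi>) - \<psi>0 (u1\<^sup>2 + u2\<^sup>2) = (LBINT s:{0..r}. k s \<xi>)" for \<xi>
  proof -
    have "((\<lambda>s. \<psi>0 (R s \<xi>)) has_vector_derivative k s \<xi>) (at s within {0..r})" for s
      unfolding has_real_derivative_iff_has_vector_derivative[symmetric] R_def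
      by (rule has_field_derivative_at_within, rule DERIV_cong[OF DERIV_chain2[OF d0]], (rule derivative_eq_intros refl)+)
        (simp add: k_def R_def algebra_simps power2_eq_square)
    then have "(LBINT s:{0..r}. k s \<xi>) = \<psi>0 (R r \<xi>) - \<psi>0 (R 0 \<xi>)"
      unfolding set_lebesgue_integral_def real_scaleR_def
      using integral_FTC_atLeastAtMost[OF r _ contk, of "\<lambda>s. \<psi>0 (R s \<xi>)"] by (simp add: mult.commute)
    then show ?thesis by (simp add: R_def)
  qed
  have iD: "integrable gauss2 (\<lambda>\<xi>. 2 * C * (\<bar>fst \<xi>\<bar> + \<bar>snd \<xi>\<bar>))"
    using gauss2_integrable_fst gauss2_integrable_snd by auto
  interpret P: pair_sigma_finite gauss2 lborel ..
  have mk [measurable]: "(\<lambda>p. k (snd p) (fst p)) \<in> borel_measurable (gauss2 \<Otimes>\<^sub>M lborel)"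
    unfolding k_def R_def by measurable
  have ind: "integrable lborel (indicat_real {0..r})"
    by (intro integrable_real_indicator) (auto simp: emeasure_lborel_Icc_eq)
  have ij: "integrable (gauss2 \<Otimes>\<^sub>M lborel) (\<lambda>(\<xi>, s). indicator {0..r} s * k s \<xi>)"
  proof (rule Bochner_Integration.integrable_bound)
    show "integrable (gauss2 \<Otimes>\<^sub>M lborel) (\<lambda>(\<xi>, s). (2 * C * (\<bar>fst \<xi>\<bar> + \<bar>snd \<xi>\<bar>)) * indicator {0..r} s)"
      using iD ind by (intro P.Fubini_integrable) (auto simp: abs_mult C intro!: integrable_mult_left)
    show "AE p in gauss2 \<Otimes>\<^sub>M lborel. norm (case p of (\<xi>, s) \<Rightarrow> indicator {0..r} s * k s \<xi>)
       \<le> norm (case p of (\<xi>, s) \<Rightarrow> (2 * C * (\<bar>fst \<xi>\<bar> + \<bar>snd \<xi>\<bar>)) * indicator {0..r} s)"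
      using order_trans[OF kb abs_ge_self] by (auto intro!: AE_I2 simp: indicator_def)
  qed (use mk in \<open>simp add: case_prod_unfold\<close>)
  have ikr: "integrable gauss2 (\<lambda>\<xi>. \<psi>0 (R r \<xi>) - \<psi>0 (u1\<^sup>2 + u2\<^sup>2))"
    using P.integrable_fst[OF ij] by (simp add: ftc set_lebesgue_integral_def)
  then have "integrable gauss2 (\<lambda>\<xi>. (\<psi>0 (R r \<xi>) - \<psi>0 (u1\<^sup>2 + u2\<^sup>2)) + \<psi>0 (u1\<^sup>2 + u2\<^sup>2))"
    by (intro Bochner_Integration.integrable_add) auto
  then show i0: "integrable gauss2 (\<lambda>\<xi>. \<psi>0 (R r \<xi>))" by simp
  \<comment> \<open>Each coordinate contributes 2 s times (\<open>\<psi>1\<close> plus twice its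
    square times \<open>\<psi>2\<close>), and the two squares add up to R.\<close>
  have ibp: "(LINT \<xi>|gauss2. k s \<xi>) = 2 * s * (LINT \<xi>|gauss2. 2 * \<psi>1 (R s \<xi>) + 2 * R s \<xi> * \<psi>2 (R s \<xi>))" for s
  proof -
    define F where "F = (\<lambda>x y. \<psi>1 ((u1 + s * x)\<^sup>2 + (u2 + s * y)\<^sup>2) * (u1 + s * x))"
    define F' where "F' = (\<lambda>x y. s * (\<psi>1 ((u1 + s * x)\<^sup>2 + (u2 + s * y)\<^sup>2) + 2 * ((u1 + s * x)\<^sup>2 * \<psi>2 ((u1 + s * x)\<^sup>2 + (u2 + s * y)\<^sup>2))))"
    define G where "G = (\<lambda>x y. \<psi>1 ((u1 + s * y)\<^sup>2 + (u2 + s * x)\<^sup>2) * (u2 + s * x))"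
    define G' where "G' = (\<lambda>x y. s * (\<psi>1 ((u1 + s * y)\<^sup>2 + (u2 + s * x)\<^sup>2) + 2 * ((u2 + s * x)\<^sup>2 * \<psi>2 ((u1 + s * y)\<^sup>2 + (u2 + s * x)\<^sup>2))))"
    have bF': "\<bar>F' x y\<bar> \<le> \<bar>s\<bar> * (3 * C)" for x y
      using q3[OF b1(1)[OF R0, of s "(x,y)"] q[of "(u1 + s * x)\<^sup>2" s "(x,y)"], of s] by (simp add: F'_def R_def)
    have bG': "\<bar>G' x y\<bar> \<le> \<bar>s\<bar> * (3 * C)" for x y
      using q3[OF b1(1)[OF R0, of s "(y,x)"] q[of "(u2 + s * x)\<^sup>2" s "(y,x)"], of s] by (simp add: G'_def R_def)
    have eF: "(LINT \<xi>|gauss2. F (fst \<xi>) (snd \<xi>) * fst \<xi>) = (LINT \<xi>|gauss2. F' (fst \<xi>) (snd \<xi>))"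
    proof (rule gauss2_ibp(1)[where C="C + \<bar>s\<bar> * (3 * C)"])
      show "((\<lambda>x. F x y) has_real_derivative F' x y) (at x)" for x y
        unfolding F_def F'_def
        by (rule DERIV_cong[OF DERIV_mult[OF DERIV_chain2[OF d1]]], (rule derivative_eq_intros refl)+)
           (simp add: algebra_simps power2_eq_square)
      show "continuous_on UNIV (\<lambda>x. F' x y)" for y
        unfolding F'_def
        by (intro continuous_intros continuous_on_compose2[OF c1] continuous_on_compose2[OF c2]) auto
      show "\<bar>F x y\<bar> \<le> C + \<bar>s\<bar> * (3 * C)" for x y
        using p1[of s "(x,y)"] C by (simp add: F_def R_def add_increasing2)
      show "\<bar>F' x y\<bar> \<le> C + \<bar>s\<bar> * (3 * C)" for x y
        using bF'[of x y] C by linarith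
    qed (simp_all add: F_def F'_def)
    have eG: "(LINT \<xi>|gauss2. G (snd \<xi>) (fst \<xi>) * snd \<xi>) = (LINT \<xi>|gauss2. G' (snd \<xi>) (fst \<xi>))"
    proof (rule gauss2_ibp(2)[where C="C + \<bar>s\<bar> * (3 * C)"])
      show "((\<lambda>x. G x y) has_real_derivative G' x y) (at x)" for x y
        unfolding G_def G'_def
        by (rule DERIV_cong[OF DERIV_mult[OF DERIV_chain2[OF d1]]], (rule derivative_eq_intros refl)+)
           (simp add: algebra_simps power2_eq_square)
      show "continuous_on UNIV (\<lambda>x. G' x y)" for y
        unfolding G'_def
        by (intro continuous_intros continuous_on_compose2[OF c1] continuous_on_compose2[OF c2]) auto
      show "\<bar>G x y\<bar> \<le> C + \<bar>s\<bar> * (3 * C)" for x y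
        using p2[of s "(y,x)"] C by (simp add: G_def R_def add_increasing2)
      show "\<bar>G' x y\<bar> \<le> C + \<bar>s\<bar> * (3 * C)" for x y
        using bG'[of x y] C by linarith
    qed (simp_all add: G_def G'_def)
    have iF: "integrable gauss2 (\<lambda>\<xi>. F (fst \<xi>) (snd \<xi>) * fst \<xi>)"
      by (rule Bochner_Integration.integrable_bound[OF integrable_mult_right[where c=C, OF gauss2_integrable_fst]])
         (use p1[of s] C in \<open>auto simp: F_def R_def abs_mult intro!: AE_I2 mult_right_mono\<close>)
    have iG: "integrable gauss2 (\<lambda>\<xi>. G (snd \<xi>) (fst \<xi>) * snd \<xi>)"
      by (rule Bochner_Integration.integrable_bound[OF integrable_mult_right[where c=C, OF gauss2_integrable_snd]])
         (use p2[of s] C in \<open>auto simp: G_def R_def abs_mult intro!: AE_I2 mult_right_mono\<close>)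
    have iF': "integrable gauss2 (\<lambda>\<xi>. F' (fst \<xi>) (snd \<xi>))"
      by (rule gauss2.integrable_const_bound[where B="\<bar>s\<bar> * (3 * C)"])
        (use bF' in auto, simp add: F'_def)
    have iG': "integrable gauss2 (\<lambda>\<xi>. G' (snd \<xi>) (fst \<xi>))"
      by (rule gauss2.integrable_const_bound[where B="\<bar>s\<bar> * (3 * C)"])
        (use bG' in auto, simp add: G'_def)
    have "(LINT \<xi>|gauss2. k s \<xi>) = (LINT \<xi>|gauss2. 2 * (F (fst \<xi>) (snd \<xi>) * fst \<xi>) + 2 * (G (snd \<xi>) (fst \<xi>) * snd \<xi>))"
      by (simp add: k_def F_def G_def R_def)
    also have "\<dots> = (LINT \<xi>|gauss2. 2 * F' (fst \<xi>) (snd \<xi>) + 2 * G' (snd \<xi>) (fst \<xi>))"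
      using iF iG iF' iG' eF eG by simp
    also have "\<dots> = (LINT \<xi>|gauss2. (2 * s) * (2 * \<psi>1 (R s \<xi>) + 2 * R s \<xi> * \<psi>2 (R s \<xi>)))"
      by (rule Bochner_Integration.integral_cong) (simp_all add: F'_def G'_def R_def algebra_simps)
    finally show ?thesis by simp
  qed
  have "(LINT \<xi>|gauss2. \<psi>0 (R r \<xi>)) - \<psi>0 (u1\<^sup>2 + u2\<^sup>2) = (LINT \<xi>|gauss2. \<psi>0 (R r \<xi>) - \<psi>0 (u1\<^sup>2 + u2\<^sup>2))"
    using i0 gauss2.prob_space by simp
  also have "\<dots> = (LINT \<xi>|gauss2. (LINT s|lborel. indicator {0..r} s * k s \<xi>))"
    by (simp add: ftc set_lebesgue_integral_def)
  also have "\<dots> = (LINT s|lborel. (LINT \<xi>|gauss2. indicator {0..r} s * k s \<xi>))"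
    using P.Fubini_integral[OF ij] by simp
  also have "\<dots> = (LINT s|lborel. indicator {0..r} s * (2 * s * (LINT \<xi>|gauss2. 2 * \<psi>1 (R s \<xi>) + 2 * R s \<xi> * \<psi>2 (R s \<xi>))))"
    by (simp add: ibp)
  finally show "(LINT \<xi>|gauss2. \<psi>0 (R r \<xi>)) - \<psi>0 (u1\<^sup>2 + u2\<^sup>2)
       = (LBINT s:{0..r}. 2 * s * (LINT \<xi>|gauss2. 2 * \<psi>1 (R s \<xi>) + 2 * R s \<xi> * \<psi>2 (R s \<xi>)))"
    by (simp add: set_lebesgue_integral_def)
qed

section \<open>Smoothed circle profiles and their logarithmic potentials\<close>

definition heat :: "real \<Rightarrow> (real^2 \<Rightarrow> real) \<Rightarrow> real^2 \<Rightarrow> real" where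
  "heat w f y = (LINT \<xi>|gauss2. f (y + sqrt w *\<^sub>R vec2 \<xi>))"

text \<open>In the variable t = (r / a)^(2m), with r the distance to x, the radial measure
  \<open>circ\<close> dr becomes (a / r) dt / (1 + t)^2. For large m it is concentrated near r = a
  with mass close to 1, so integrals of the profile along the path approximate the local time of the
  distance at level a.\<close>

definition circ :: "nat \<Rightarrow> real^2 \<Rightarrow> real \<Rightarrow> real^2 \<Rightarrow> real" where
  "circ m x a z = 2 * real m * a ^ (2*m+1) * ((norm (z - x))\<^sup>2) ^ (m - 1)
      / (((norm (z - x))\<^sup>2) ^ m + a ^ (2*m))\<^sup>2"

definition circ_pot :: "nat \<Rightarrow> real^2 \<Rightarrow> real \<Rightarrow> real^2 \<Rightarrow> real" where
  "circ_pot m x a z = a / real m * ln (((norm (z - x))\<^sup>2) ^ m + a ^ (2*m))"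

lemma integrable_indicator_Icc: "integrable lborel (indicat_real {a..b::real})"
  by (intro integrable_real_indicator) (auto simp: emeasure_lborel_Icc_eq less_top[symmetric])

text \<open>After division by R^m + b these bound the first derivative of the potential, alone and
  times the root of R, as \<open>radial_dynkin\<close> demands; b stands for a^(2m).\<close>

lemma power_pred_bounds:
  fixes R b :: real
  assumes R: "0 \<le> R" and b: "0 < b" and m: "2 \<le> m"
  shows "R ^ (m - 1) \<le> (1 + 1 / b) * (R ^ m + b)" "R ^ (m - 1) * sqrt R \<le> (1 + 1 / b) * (R ^ m + b)"
proof -
  have 1: "1 + R ^ m \<le> (1 + 1 / b) * (R ^ m + b)"
    using b R by (simp add: field_simps add_increasing)
  have "R ^ (m - 1) \<le> 1 + R ^ m \<and> R ^ (m - 1) * sqrt R \<le> 1 + R ^ m"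
  proof (cases "R \<le> 1")
    case True
    have a: "R ^ (m - 1) \<le> 1" using True R by (simp add: power_le_one)
    then have b: "R ^ (m - 1) * sqrt R \<le> 1 * 1" using True R by (intro mult_mono) auto
    have "0 \<le> R ^ m" using R by simp
    then show ?thesis using a b by auto
  next
    case False
    then have "sqrt R \<le> R" by (intro real_le_lsqrt) (auto simp: power2_eq_square)
    then have "R ^ (m - 1) * sqrt R \<le> R ^ (m - 1) * R" using R by (intro mult_left_mono) auto
    also have "\<dots> = R ^ m" using m by (metis One_nat_def Suc_1 Suc_le_D diff_Suc_1 mult.commute power_Suc)
    finally have a: "R ^ (m - 1) * sqrt R \<le> R ^ m" .
    have "R ^ (m - 1) \<le> R ^ m" using False by (intro power_increasing) auto
    then show ?thesis using a by auto
  qed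
  then show "R ^ (m - 1) \<le> (1 + 1 / b) * (R ^ m + b)" "R ^ (m - 1) * sqrt R \<le> (1 + 1 / b) * (R ^ m + b)"
    using 1 by auto
qed

text \<open>Radius 0 serves as the zero function in estimates for two profiles, so that bounds on
  differences also yield bounds on a single profile.\<close>

lemma circ_zero [simp]: "circ m x 0 z = 0"
  by (simp add: circ_def)

lemma circ_pot_zero [simp]: "circ_pot m x 0 z = 0"
  by (simp add: circ_pot_def)

lemma circ_denom_pos: "0 < a \<Longrightarrow> 0 < ((norm (z - x))\<^sup>2) ^ m + a ^ (2*m)"
  by (intro add_nonneg_pos) auto

lemma circ_nonneg: "0 \<le> a \<Longrightarrow> 0 \<le> circ m x a z"
  by (auto simp: circ_def intro!: divide_nonneg_nonneg mult_nonneg_nonneg)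

lemma circ_continuous: "0 \<le> a \<Longrightarrow> continuous_on UNIV (circ m x a)"
proof (cases "a = 0")
  case False
  moreover assume "0 \<le> a"
  ultimately have "0 < a" by simp
  then show ?thesis unfolding circ_def
    using circ_denom_pos[of a _ x m] by (intro continuous_intros) (auto simp: less_le)
qed (simp add: circ_def)

text \<open>By scaling, the profile is 2 m / a times a function of v = |z - x|^2 / a^2 alone; size
  and Lipschitz bounds reduce to that function of one variable.\<close>

lemma circ_scaled:
  assumes a: "0 < a" and m: "2 \<le> m"
  shows "circ m x a z = 2 * real m / a * (((norm (z - x))\<^sup>2 / a\<^sup>2) ^ (m - 1) / (1 + ((norm (z - x))\<^sup>2 / a\<^sup>2) ^ m)\<^sup>2)"
proof -
  define v where "v = (norm (z - x))\<^sup>2 / a\<^sup>2"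
  have v: "0 \<le> v" by (simp add: v_def)
  have R: "(norm (z - x))\<^sup>2 = v * a\<^sup>2" using a by (simp add: v_def)
  have p: "a ^ (2*m+1) * (a\<^sup>2) ^ (m - 1) * a = (a ^ (2 * m))\<^sup>2"
  proof -
    have "(a\<^sup>2) ^ (m - 1) * a * a = (a\<^sup>2)^m"
      using m by (cases m) (auto simp: power2_eq_square)
    then show ?thesis by (simp add: power_mult power2_eq_square mult_ac del: power_mult_distrib) (simp add: power_mult_distrib)
  qed
  have den: "((norm (z - x))\<^sup>2) ^ m + a ^ (2*m) = a ^ (2*m) * (1 + v ^ m)"
    unfolding R power_mult_distrib power_mult[symmetric] by (simp add: algebra_simps)
  have "circ m x a z = 2 * real m * (a ^ (2*m+1) * (a\<^sup>2) ^ (m - 1)) * v ^ (m - 1) / ((a ^ (2*m))\<^sup>2 * (1 + v ^ m)\<^sup>2)"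
    unfolding circ_def den unfolding R power_mult_distrib by (simp only: mult_ac)
  also have "a ^ (2*m+1) * (a\<^sup>2) ^ (m - 1) = (a ^ (2 * m))\<^sup>2 / a" using p a by (simp add: field_simps)
  also have "2 * real m * ((a ^ (2 * m))\<^sup>2 / a) * v ^ (m - 1) / ((a ^ (2*m))\<^sup>2 * (1 + v ^ m)\<^sup>2)
     = 2 * real m / a * (v ^ (m - 1) / (1 + v ^ m)\<^sup>2)" using a by (simp add: field_simps)
  finally have eq: "circ m x a z = 2 * real m / a * (v ^ (m - 1) / (1 + v ^ m)\<^sup>2)" .
  then show ?thesis by (simp add: v_def)
qed

lemma circ_bound:
  assumes a: "0 < a" and m: "2 \<le> m"
  shows "circ m x a z \<le> 2 * real m / a"
proof -
  define v where "v = (norm (z - x))\<^sup>2 / a\<^sup>2"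
  have v: "0 \<le> v" by (simp add: v_def)
  have vm: "v ^ (m - 1) \<le> 1 + v ^ m"
    using power_pred_bounds(1)[OF v, of 1 m] m v
    by (cases "v \<le> 1") (auto simp: power_le_one add_increasing2 add_increasing power_increasing)
  have eq: "circ m x a z = 2 * real m / a * (v ^ (m - 1) / (1 + v ^ m)\<^sup>2)"
    unfolding v_def by (rule circ_scaled[OF a m])
  have "v ^ (m - 1) / (1 + v ^ m)\<^sup>2 \<le> 1"
  proof -
    have "1 + v ^ m \<le> (1 + v ^ m)\<^sup>2" using v mult_right_mono[of 1 "1 + v ^ m" "1 + v ^ m"] by (simp add: power2_eq_square)
    then show ?thesis using vm v by (auto simp: divide_le_eq_1 intro: order_trans)
  qed
  then show ?thesis unfolding eq using a
    by (metis divide_nonneg_pos mult.right_neutral mult_left_mono mult_nonneg_nonneg of_nat_0_le_iff zero_le_numeral)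
qed

lemma heat_radial:
  "(norm (y + s *\<^sub>R vec2 \<xi> - x))\<^sup>2 = (y $ 1 - x $ 1 + s * fst \<xi>)\<^sup>2 + (y $ 2 - x $ 2 + s * snd \<xi>)\<^sup>2"
  by (simp add: norm_real2_sq algebra_simps)

text \<open>Matches two time scales: \<open>radial_dynkin\<close> integrates over s = sqrt w,
  potentials integrate over w.\<close>

lemma LBINT_sqrt_substitution:
  fixes h :: "real \<Rightarrow> real"
  assumes u: "0 \<le> u" and h: "h \<in> borel_measurable borel" and b: "\<And>s. 0 \<le> s \<Longrightarrow> \<bar>h s\<bar> \<le> C"
  shows "(LBINT w:{0..u}. h (sqrt w)) = (LBINT s:{0..sqrt u}. 2 * s * h s)"
proof -
  note [measurable] = h
  have C: "0 \<le> C" using b[of 0] by auto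
  have i: "set_integrable lborel {0..u} (\<lambda>w. h (sqrt w))"
    unfolding set_integrable_def
    by (rule Bochner_Integration.integrable_bound[where f="\<lambda>w. C * indicator {0..u} w"],
        use integrable_indicator_Icc in force)
       (use u b C in \<open>auto simp: indicator_def intro!: AE_I2\<close>)
  have "(LBINT x. h (sqrt x) * indicator {0\<^sup>2..(sqrt u)\<^sup>2} x) = (LBINT x. h (sqrt (x\<^sup>2)) * (2 * x) * indicator {0..sqrt u} x)"
    by (rule integral_substitution(2)) (use i u in \<open>auto intro!: derivative_eq_intros continuous_intros\<close>)
  also have "\<dots> = (LBINT x. indicator {0..sqrt u} x * (2 * x * h x))"
    by (rule Bochner_Integration.integral_cong) (auto simp: indicator_def)
  finally show ?thesis using u by (simp add: set_lebesgue_integral_def mult.commute)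
qed

text \<open>Half the Laplacian of the potential is exactly the profile, so Dynkin's formula has no
  remainder. Parity of m enters because \<open>radial_dynkin\<close> differentiates along the whole
  line: R^m + a^(2m) has to stay positive for negative R as well.\<close>

lemma circ_dynkin:
  assumes a: "0 \<le> a" and m: "2 \<le> m" "even m" and u: "0 \<le> u"
  shows "integrable gauss2 (\<lambda>\<xi>. circ_pot m x a (y + sqrt u *\<^sub>R vec2 \<xi>))"
    and "(LBINT w:{0..u}. heat w (circ m x a) y) = heat u (circ_pot m x a) y - circ_pot m x a y"
proof -
  have "integrable gauss2 (\<lambda>\<xi>. circ_pot m x a (y + sqrt u *\<^sub>R vec2 \<xi>)) \<and>
    (LBINT w:{0..u}. heat w (circ m x a) y) = heat u (circ_pot m x a) y - circ_pot m x a y"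
  proof (cases "a = 0")
    case True
    then show ?thesis by (simp add: heat_def set_lebesgue_integral_def)
  next
    case False
    with a have a: "0 < a" by simp
    define b where "b = a ^ (2*m)"
    have b: "0 < b" using a by (simp add: b_def)
    define j where "j = m - 2"
    have j: "m = Suc (Suc j)" using m by (simp add: j_def)
    have pos: "0 < R ^ m + b" for R :: real using zero_le_even_power[OF m(2), of R] b by linarith
    define \<psi>0 where "\<psi>0 R = a / real m * ln (R ^ m + b)" for R :: real
    define \<psi>1 where "\<psi>1 R = a * R ^ (m - 1) / (R ^ m + b)" for R :: real
    define \<psi>2 where "\<psi>2 R = a * (real (m - 1) * R ^ (m - 2) * (R ^ m + b) - real m * (R ^ (m - 1) * R ^ (m - 1))) / (R ^ m + b)\<^sup>2" for R :: real
    define C where "C = 2 * real m * a * (1 + 1 / b)"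
    have C0': "0 \<le> a * (1 + 1 / b)" using a b by simp
    have "1 * (a * (1 + 1 / b)) \<le> (2 * real m) * (a * (1 + 1 / b))" using C0' m by (intro mult_right_mono) auto
    then have C0: "a * (1 + 1 / b) \<le> C" by (simp add: C_def mult.assoc)
    have dpow: "((\<lambda>R::real. R ^ n) has_real_derivative real n * R ^ (n - 1)) (at R)" for n R
      using DERIV_pow[of n R] by simp
    have "(\<psi>0 has_real_derivative \<psi>1 R) (at R)" for R
      unfolding \<psi>0_def
      by (rule DERIV_cong[OF DERIV_cmult[OF DERIV_chain2[OF DERIV_ln_divide[OF pos] DERIV_add[OF dpow DERIV_const]]]])
         (use m in \<open>simp add: \<psi>1_def\<close>)
    moreover have "(\<psi>1 has_real_derivative \<psi>2 R) (at R)" for R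
    proof -
      have D: "R ^ m + b \<noteq> 0" using pos[of R] by simp
      show ?thesis
        unfolding \<psi>1_def
        by (rule DERIV_cong[OF DERIV_divide[OF DERIV_cmult[OF dpow] DERIV_add[OF dpow DERIV_const] D]])
           (simp add: \<psi>2_def power2_eq_square algebra_simps diff_diff_left numeral_2_eq_2)
    qed
    moreover have "continuous_on UNIV \<psi>2"
      unfolding \<psi>2_def using pos by (intro continuous_intros) (auto simp: less_le)
    moreover have B1: "\<bar>\<psi>1 R\<bar> \<le> a * (1 + 1 / b)" if "0 \<le> R" for R
      using power_pred_bounds(1)[OF that b m(1)] pos[of R] that a
      by (simp add: \<psi>1_def pos_divide_le_eq mult.assoc)
    then have "\<bar>\<psi>1 R\<bar> \<le> C" if "0 \<le> R" for R using that C0 by (meson order_trans)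
    moreover have "\<bar>\<psi>1 R\<bar> * sqrt R \<le> C" if "0 \<le> R" for R
    proof -
      have "\<bar>\<psi>1 R\<bar> * sqrt R = a * (R ^ (m - 1) * sqrt R) / (R ^ m + b)" using that a pos[of R] by (simp add: \<psi>1_def)
      also have "\<dots> \<le> a * (1 + 1 / b)" using power_pred_bounds(2)[OF that b m(1)] pos[of R] a
        by (simp add: pos_divide_le_eq mult.assoc)
      finally show ?thesis using C0 by linarith
    qed
    \<comment> \<open>R \<open>\<psi>2\<close> is a combination of multiples of
      \<open>\<psi>1\<close> with coefficients at most m, since R^m / (R^m + b) lies between 0 and
      1.\<close>
    moreover have "\<bar>\<psi>2 R\<bar> * R \<le> C" if R: "0 \<le> R" for R
    proof -
      let ?D = "R ^ m + b"
      have e: "\<psi>2 R * R = real (m - 1) * \<psi>1 R - real m * (R ^ m / ?D * \<psi>1 R)"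
      proof -
        have pw: "R ^ (m - 1) = R * R ^ j" "R ^ m = R * R * R ^ j" "R ^ (m - 2) = R ^ j" by (simp_all add: j)
        have gen: "a * (c * p * D - d * ((R * p) * (R * p))) / D\<^sup>2 * R
           = c * (a * (R * p) / D) - d * ((R * R * p) / D * (a * (R * p) / D))" if "D \<noteq> 0" for c d p D
          using that by (simp add: divide_simps power2_eq_square) (simp add: algebra_simps)
        have "?D \<noteq> 0" using pos[of R] by simp
        from gen[OF this, of "real (m - 1)" "R ^ j" "real m"] show ?thesis
          unfolding \<psi>2_def \<psi>1_def pw .
      qed
      have "\<bar>R ^ m / ?D * \<psi>1 R\<bar> \<le> 1 * \<bar>\<psi>1 R\<bar>"
        unfolding abs_mult using pos[of R] b R by (intro mult_right_mono) auto
      then have "real m * \<bar>R ^ m / ?D * \<psi>1 R\<bar> \<le> real m * \<bar>\<psi>1 R\<bar>" by (intro mult_left_mono) auto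
      then have "\<bar>\<psi>2 R * R\<bar> \<le> real (m - 1) * \<bar>\<psi>1 R\<bar> + real m * \<bar>\<psi>1 R\<bar>"
        unfolding e by (intro order_trans[OF abs_triangle_ineq4] add_mono) (auto simp: abs_mult)
      also have "\<dots> \<le> 2 * real m * \<bar>\<psi>1 R\<bar>"
        using mult_right_mono[of "real (m - 1)" "real m" "\<bar>\<psi>1 R\<bar>"] by auto
      also have "\<dots> \<le> 2 * real m * (a * (1 + 1 / b))" using B1[OF R] by (intro mult_left_mono) auto
      finally show ?thesis using R by (simp add: C_def abs_mult mult.assoc)
    qed
    ultimately have dyn:
      "integrable gauss2 (\<lambda>\<xi>. \<psi>0 ((u1 + r * fst \<xi>)\<^sup>2 + (u2 + r * snd \<xi>)\<^sup>2))"
      "(LINT \<xi>|gauss2. \<psi>0 ((u1 + r * fst \<xi>)\<^sup>2 + (u2 + r * snd \<xi>)\<^sup>2)) - \<psi>0 (u1\<^sup>2 + u2\<^sup>2)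
        = (LBINT s:{0..r}. 2 * s * (LINT \<xi>|gauss2. 2 * \<psi>1 ((u1 + s * fst \<xi>)\<^sup>2 + (u2 + s * snd \<xi>)\<^sup>2)
           + 2 * ((u1 + s * fst \<xi>)\<^sup>2 + (u2 + s * snd \<xi>)\<^sup>2) * \<psi>2 ((u1 + s * fst \<xi>)\<^sup>2 + (u2 + s * snd \<xi>)\<^sup>2)))"
      if "0 \<le> r" for u1 u2 r
      using radial_dynkin[of \<psi>0 \<psi>1 \<psi>2 C r u1 u2] that by blast+
    \<comment> \<open>With D = R^m + b the numerator collapses to a multiple of D - R^m = b, and
      \<open>a * b\<close> is the power a^(2m+1) of the profile.\<close>
    have f0: "2 * \<psi>1 R + 2 * R * \<psi>2 R = 2 * real m * a ^ (2*m+1) * R ^ (m - 1) / (R ^ m + a ^ (2*m))\<^sup>2" for R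
    proof -
      have pw: "R ^ (m - 1) = R * R ^ j" "R ^ m = R * R * R ^ j" "R ^ (m - 2) = R ^ j" by (simp_all add: j)
      have gen: "2 * (a * (R * p) / D) + 2 * R * (a * ((c - 1) * p * D - c * ((R * p) * (R * p))) / D\<^sup>2)
         = 2 * c * (a * b) * (R * p) / D\<^sup>2" if "D \<noteq> 0" "D = R * R * p + b" for c p D
      proof -
        have "2 * (a * (R * p) / D) = 2 * a * (R * p) * D / D\<^sup>2"
          using that(1) by (simp add: power2_eq_square)
        then have "2 * (a * (R * p) / D) + 2 * R * (a * ((c - 1) * p * D - c * ((R * p) * (R * p))) / D\<^sup>2)
          = (2 * a * (R * p) * D + 2 * R * (a * ((c - 1) * p * D - c * ((R * p) * (R * p))))) / D\<^sup>2"
          by (simp add: add_divide_distrib)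
        also have "2 * a * (R * p) * D + 2 * R * (a * ((c - 1) * p * D - c * ((R * p) * (R * p)))) = 2 * c * (a * b) * (R * p)"
          unfolding that(2) by (simp add: algebra_simps)
        finally show ?thesis .
      qed
      have D: "R * R * R ^ j + b \<noteq> 0" using pos[of R] by (simp add: pw)
      have mm: "real (m - 1) = real m - 1" using m by (simp add: of_nat_diff)
      have "2 * \<psi>1 R + 2 * R * \<psi>2 R = 2 * real m * (a * b) * R ^ (m - 1) / (R ^ m + b)\<^sup>2"
        using gen[OF D refl, of "real m"] unfolding \<psi>1_def \<psi>2_def pw mm .
      then show ?thesis by (simp add: b_def)
    qed
    have circ_eq: "circ m x a (y + s *\<^sub>R vec2 \<xi>) =
       2 * \<psi>1 ((y $ 1 - x $ 1 + s * fst \<xi>)\<^sup>2 + (y $ 2 - x $ 2 + s * snd \<xi>)\<^sup>2)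
       + 2 * ((y $ 1 - x $ 1 + s * fst \<xi>)\<^sup>2 + (y $ 2 - x $ 2 + s * snd \<xi>)\<^sup>2) * \<psi>2 ((y $ 1 - x $ 1 + s * fst \<xi>)\<^sup>2 + (y $ 2 - x $ 2 + s * snd \<xi>)\<^sup>2)" for s \<xi>
      unfolding f0 circ_def heat_radial ..
    have pot_eq: "circ_pot m x a (y + s *\<^sub>R vec2 \<xi>) = \<psi>0 ((y $ 1 - x $ 1 + s * fst \<xi>)\<^sup>2 + (y $ 2 - x $ 2 + s * snd \<xi>)\<^sup>2)" for s \<xi>
      unfolding \<psi>0_def circ_pot_def heat_radial b_def ..
    have pot0: "circ_pot m x a y = \<psi>0 ((y $ 1 - x $ 1)\<^sup>2 + (y $ 2 - x $ 2)\<^sup>2)"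
      using pot_eq[of 0] by simp
    define h where "h s = (LINT \<xi>|gauss2. circ m x a (y + s *\<^sub>R vec2 \<xi>))" for s
    have cm[measurable]: "circ m x a \<in> borel_measurable borel"
      using circ_continuous[of a m x] a by (intro borel_measurable_continuous_onI) auto
    have "(\<lambda>p. circ m x a (y + fst p *\<^sub>R vec2 (snd p))) \<in> borel_measurable (lborel \<Otimes>\<^sub>M gauss2)"
      by measurable
    then have hm: "h \<in> borel_measurable borel"
      unfolding h_def using gauss2.borel_measurable_lebesgue_integral[of "\<lambda>s \<xi>. circ m x a (y + s *\<^sub>R vec2 \<xi>)" lborel]
      by (simp add: case_prod_unfold)
    have hb: "\<bar>h s\<bar> \<le> 2 * real m / a" for s
    proof -
      have "h s \<le> (LINT \<xi>|gauss2. 2 * real m / a)" unfolding h_def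
        by (intro integral_mono gauss2.integrable_const_bound[where B="2 * real m / a"])
           (use circ_bound[OF a m(1)] circ_nonneg a in \<open>auto simp: less_imp_le\<close>)
      moreover have "0 \<le> h s" unfolding h_def using circ_nonneg a by (intro integral_nonneg_AE) (auto simp: less_imp_le)
      ultimately show ?thesis using gauss2.prob_space by simp
    qed
    have "(LBINT w:{0..u}. heat w (circ m x a) y) = (LBINT w:{0..u}. h (sqrt w))"
      by (simp add: heat_def h_def)
    also have "\<dots> = (LBINT s:{0..sqrt u}. 2 * s * h s)"
      by (rule LBINT_sqrt_substitution[OF u hm hb])
    also have "\<dots> = (LINT \<xi>|gauss2. circ_pot m x a (y + sqrt u *\<^sub>R vec2 \<xi>)) - circ_pot m x a y"
      unfolding pot_eq pot0 h_def circ_eq by (rule dyn(2)[symmetric]) (use u in simp)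
    finally show ?thesis
      using dyn(1)[of "sqrt u"] u by (simp add: heat_def pot_eq)
  qed
  then show "integrable gauss2 (\<lambda>\<xi>. circ_pot m x a (y + sqrt u *\<^sub>R vec2 \<xi>))"
    "(LBINT w:{0..u}. heat w (circ m x a) y) = heat u (circ_pot m x a) y - circ_pot m x a y" by blast+
qed

text \<open>The logarithm of R^m + a^(2m) exceeds m times the logarithm of the maximum by at most ln
  2 < 1, and the prefactor a / m turns this into the error.\<close>

lemma circ_pot_approx:
  assumes a: "0 \<le> a" and m: "0 < m"
  shows "\<bar>circ_pot m x a z - a * ln (max ((norm (z - x))\<^sup>2) (a\<^sup>2))\<bar> \<le> a / real m"
proof (cases "a = 0")
  case False
  with a have a: "0 < a" by simp
  define R where "R = (norm (z - x))\<^sup>2"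
  define X where "X = max R (a\<^sup>2)"
  have X: "0 < X" using a by (auto simp: X_def less_max_iff_disj)
  have R: "0 \<le> R" by (simp add: R_def)
  have le: "R ^ m \<le> X ^ m" "(a\<^sup>2) ^ m \<le> X ^ m" using R by (auto simp: X_def intro!: power_mono)
  have "X ^ m \<le> R ^ m + (a\<^sup>2) ^ m" using R by (auto simp: X_def max_def)
  moreover have "R ^ m + (a\<^sup>2) ^ m \<le> 2 * X ^ m" using le by simp
  moreover have "0 < X ^ m" using X by simp
  ultimately have l: "ln (X ^ m) \<le> ln (R ^ m + (a\<^sup>2) ^ m)" "ln (R ^ m + (a\<^sup>2) ^ m) \<le> ln (2 * X ^ m)"
    by (auto simp: ln_le_cancel_iff)
  have "ln (X ^ m) = real m * ln X" "ln (2 * X ^ m) = ln 2 + real m * ln X"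
    using X by (simp_all add: ln_realpow ln_mult)
  then have "\<bar>ln (R ^ m + (a\<^sup>2) ^ m) - real m * ln X\<bar> \<le> 1"
    using l ln_2_less_1 by linarith
  then have "a / real m * \<bar>ln (R ^ m + (a\<^sup>2) ^ m) - real m * ln X\<bar> \<le> a / real m * 1"
    using a by (intro mult_left_mono) auto
  moreover have "circ_pot m x a z - a * ln X = a / real m * (ln (R ^ m + (a\<^sup>2) ^ m) - real m * ln X)"
    using m by (simp add: circ_pot_def R_def power_mult right_diff_distrib)
  ultimately show ?thesis using a by (simp add: abs_mult X_def R_def)
qed simp

section \<open>Logarithmic potentials: growth at infinity and dependence on centre and
  radius\<close>

lemma ln_one_plus_norm_lipschitz:
  fixes y z :: "'a::real_normed_vector"
  shows "\<bar>ln (1 + (norm z)\<^sup>2) - ln (1 + (norm y)\<^sup>2)\<bar> \<le> norm (z - y)"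
proof -
  have d: "((\<lambda>t::real. ln (1 + t\<^sup>2)) has_real_derivative 2 * t / (1 + t\<^sup>2)) (at t)" for t
    by (auto intro!: derivative_eq_intros simp: add_pos_nonneg)
  have b: "norm (2 * t / (1 + t\<^sup>2)) \<le> 1" for t :: real
  proof -
    have "0 \<le> (\<bar>t\<bar> - 1)\<^sup>2" by simp
    then have "2 * \<bar>t\<bar> \<le> 1 + t\<^sup>2" by (simp add: power2_eq_square algebra_simps)
    moreover have "0 < 1 + t\<^sup>2" by (simp add: add_pos_nonneg)
    ultimately show ?thesis by (simp add: abs_mult)
  qed
  have "norm (ln (1 + (norm z)\<^sup>2) - ln (1 + (norm y)\<^sup>2)) \<le> 1 * norm (norm z - norm y)"
    by (rule field_differentiable_bound[of UNIV "\<lambda>t. ln (1 + t\<^sup>2)"]) (use d b in \<open>auto intro: has_field_derivative_at_within\<close>)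
  also have "\<dots> \<le> norm (z - y)" by (simp add: norm_triangle_ineq3)
  finally show ?thesis by simp
qed

lemma norm_vec2_le: "norm (vec2 \<xi>) \<le> \<bar>fst \<xi>\<bar> + \<bar>snd \<xi>\<bar>"
  using norm_le_l1_cart[of "vec2 \<xi>"] by (simp add: sum_2)

text \<open>Potentials of circles of different radii differ at infinity by a multiple of
  \<open>l\<close>; this bounds what that multiple contributes to a heat increment. As
  \<open>l\<close> has Lipschitz constant 1, the increment is at most the mean displacement.\<close>

lemma heat_ln_bound:
  defines "l \<equiv> \<lambda>z::real^2. ln (1 + (norm z)\<^sup>2)"
  shows "integrable gauss2 (\<lambda>\<xi>. l (y + s *\<^sub>R vec2 \<xi>))"
    and "\<exists>c\<ge>0. \<forall>y u. 0 \<le> u \<longrightarrow> \<bar>heat u l y - l y\<bar> \<le> c * sqrt u"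
proof -
  have [measurable]: "l \<in> borel_measurable borel" unfolding l_def by measurable
  have b: "\<bar>l (y + s *\<^sub>R vec2 \<xi>) - l y\<bar> \<le> \<bar>s\<bar> * (\<bar>fst \<xi>\<bar> + \<bar>snd \<xi>\<bar>)" for y s \<xi>
  proof -
    have "\<bar>l (y + s *\<^sub>R vec2 \<xi>) - l y\<bar> \<le> norm (s *\<^sub>R vec2 \<xi>)"
      unfolding l_def using ln_one_plus_norm_lipschitz[of "y + s *\<^sub>R vec2 \<xi>" y] by simp
    also have "\<dots> \<le> \<bar>s\<bar> * (\<bar>fst \<xi>\<bar> + \<bar>snd \<xi>\<bar>)" using norm_vec2_le[of \<xi>] by (simp add: mult_left_mono)
    finally show ?thesis .
  qed
  have i: "integrable gauss2 (\<lambda>\<xi>. \<bar>s\<bar> * (\<bar>fst \<xi>\<bar> + \<bar>snd \<xi>\<bar>))" for s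
    using gauss2_integrable_fst gauss2_integrable_snd by auto
  have i2: "integrable gauss2 (\<lambda>\<xi>. l (y + s *\<^sub>R vec2 \<xi>) - l y)" for y s
    by (rule Bochner_Integration.integrable_bound[OF i[of s]]) (use order_trans[OF b abs_ge_self] in \<open>auto\<close>)
  have i3: "integrable gauss2 (\<lambda>\<xi>. l (y + s *\<^sub>R vec2 \<xi>))" for y s
    using Bochner_Integration.integrable_add[OF i2[of y s] gauss2.integrable_const[of "l y"]] by simp
  then show "integrable gauss2 (\<lambda>\<xi>. l (y + s *\<^sub>R vec2 \<xi>))" .
  define c where "c = (LINT \<xi>|gauss2. \<bar>fst \<xi>\<bar> + \<bar>snd \<xi>\<bar>)"
  have "\<bar>heat u l y - l y\<bar> \<le> c * sqrt u" if "0 \<le> u" for y u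
  proof -
    have "\<bar>heat u l y - l y\<bar> = \<bar>LINT \<xi>|gauss2. l (y + sqrt u *\<^sub>R vec2 \<xi>) - l y\<bar>"
      unfolding heat_def using i3[of y "sqrt u"] gauss2.prob_space by simp
    also have "\<dots> \<le> (LINT \<xi>|gauss2. \<bar>sqrt u\<bar> * (\<bar>fst \<xi>\<bar> + \<bar>snd \<xi>\<bar>))"
      by (intro order_trans[OF integral_abs_bound] integral_mono integrable_abs i2 i b)
    finally show ?thesis using that by (simp add: c_def mult.commute)
  qed
  moreover have "0 \<le> c" unfolding c_def by (intro integral_nonneg_AE) auto
  ultimately show "\<exists>c\<ge>0. \<forall>y u. 0 \<le> u \<longrightarrow> \<bar>heat u l y - l y\<bar> \<le> c * sqrt u" by blast
qed

text \<open>The logarithmic potential of the circle of radius \<open>a\<close> about \<open>x\<close>, renormalised so that it stays bounded at infinity.\<close>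

definition log_pot :: "real^2 \<Rightarrow> real \<Rightarrow> real^2 \<Rightarrow> real" where
  "log_pot x a z = a * (ln (max ((norm (z - x))\<^sup>2) (a\<^sup>2)) - ln (1 + (norm z)\<^sup>2))"

text \<open>The quotient of the two arguments of the logarithm lies between a^2 / (2 + 4 K^2) and 2
  + 4 K^2, because |z - x| and |z| differ by at most K. The bound is singular only in a, and only
  logarithmically.\<close>

lemma log_ratio_bound:
  fixes x z :: "real^2"
  assumes x: "norm x \<le> K" and a: "0 < a" "a \<le> K"
  shows "\<bar>ln (max ((norm (z - x))\<^sup>2) (a\<^sup>2)) - ln (1 + (norm z)\<^sup>2)\<bar> \<le> ln (2 + 4 * K\<^sup>2) + 2 * \<bar>ln a\<bar>"
proof -
  define R where "R = (norm (z - x))\<^sup>2"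
  define N where "N = (norm z)\<^sup>2"
  define X where "X = max R (a\<^sup>2)"
  have K: "(norm x)\<^sup>2 \<le> K\<^sup>2" "a\<^sup>2 \<le> K\<^sup>2" using x a by (auto intro: power_mono)
  have sq: "(p + q)\<^sup>2 \<le> 2 * p\<^sup>2 + 2 * q\<^sup>2" for p q :: real
  proof -
    have "0 \<le> (p - q)\<^sup>2" by simp
    then show ?thesis by (simp add: power2_eq_square algebra_simps)
  qed
  have "R \<le> (norm z + norm x)\<^sup>2" unfolding R_def by (intro power_mono norm_triangle_ineq4) auto
  then have R: "R \<le> 2 * N + 2 * K\<^sup>2" using sq[of "norm z" "norm x"] K by (simp add: N_def)
  have "norm z \<le> norm (z - x) + norm x" using norm_triangle_ineq[of "z - x" x] by simp
  then have "N \<le> (norm (z - x) + norm x)\<^sup>2" unfolding N_def by (intro power_mono) auto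
  then have N: "N \<le> 2 * R + 2 * K\<^sup>2" using sq[of "norm (z - x)" "norm x"] K by (simp add: R_def)
  have pos: "0 \<le> R" "0 \<le> N" "0 < X" "0 < 1 + N" "0 \<le> K\<^sup>2"
    using a by (auto simp: R_def N_def X_def less_max_iff_disj add_pos_nonneg)
  have up: "X \<le> (2 + 4 * K\<^sup>2) * (1 + N)"
  proof -
    have "X \<le> 2 * N + 2 * K\<^sup>2" using R K pos by (auto simp: X_def)
    moreover have "0 \<le> K\<^sup>2 * N" using pos by simp
    moreover have "(2 + 4 * K\<^sup>2) * (1 + N) = 2 + 2 * N + 4 * K\<^sup>2 + 4 * (K\<^sup>2 * N)" by (simp add: algebra_simps)
    ultimately show ?thesis using pos by linarith
  qed
  have lo: "a\<^sup>2 * (1 + N) \<le> (2 + 4 * K\<^sup>2) * X"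
  proof -
    have "a\<^sup>2 * (1 + N) \<le> a\<^sup>2 * (2 * R + (1 + 2 * K\<^sup>2))" using N by (intro mult_left_mono) auto
    also have "\<dots> = 2 * (a\<^sup>2 * R) + a\<^sup>2 * (1 + 2 * K\<^sup>2)" by (simp add: algebra_simps)
    also have "\<dots> \<le> 2 * (K\<^sup>2 * X) + X * (1 + 2 * K\<^sup>2)"
      using K pos by (intro add_mono mult_left_mono mult_mono mult_right_mono) (auto simp: X_def)
    also have "\<dots> \<le> (2 + 4 * K\<^sup>2) * X" using pos by (simp add: algebra_simps)
    finally show ?thesis .
  qed
  have "ln X \<le> ln ((2 + 4 * K\<^sup>2) * (1 + N))" using up pos by (subst ln_le_cancel_iff) (auto simp: add_pos_nonneg)
  then have 1: "ln X - ln (1 + N) \<le> ln (2 + 4 * K\<^sup>2)" using pos by (subst (asm) ln_mult) (auto simp: add_pos_nonneg)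
  have "ln (a\<^sup>2 * (1 + N)) \<le> ln ((2 + 4 * K\<^sup>2) * X)" using lo pos a by (subst ln_le_cancel_iff) (auto simp: add_pos_nonneg)
  then have 2: "2 * ln a + ln (1 + N) \<le> ln (2 + 4 * K\<^sup>2) + ln X"
    using pos a by (simp add: ln_mult add_pos_nonneg ln_realpow)
  show ?thesis using 1 2 unfolding R_def[symmetric] N_def[symmetric] X_def[symmetric] by linarith
qed

lemma ln_diff_le: "0 < t \<Longrightarrow> t \<le> s \<Longrightarrow> ln s - ln t \<le> (s - t) / (t::real)"
  using ln_le_minus_one[of "s / t"] by (simp add: ln_div field_simps)

text \<open>Once the square is taken out, ln max(s, a) has slope at most 1 / a in s, which the
  factor a compensates.\<close>

lemma ln_max_lipschitz:
  fixes a s t :: real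
  assumes "0 < a" "0 \<le> s" "0 \<le> t"
  shows "a * \<bar>ln (max (s\<^sup>2) (a\<^sup>2)) - ln (max (t\<^sup>2) (a\<^sup>2))\<bar> \<le> 2 * \<bar>s - t\<bar>"
proof -
  have e: "ln (max (s\<^sup>2) (a\<^sup>2)) = 2 * ln (max s a)" if "0 \<le> s" for s
  proof -
    have "max (s\<^sup>2) (a\<^sup>2) = (max s a)\<^sup>2" using assms(1) that by (auto simp: max_def power2_le_iff_abs_le abs_le_square_iff[symmetric] power_mono_iff)
    then show ?thesis using assms(1) that by (simp add: ln_realpow less_max_iff_disj)
  qed
  have main: "a * (ln (max s a) - ln (max t a)) \<le> \<bar>s - t\<bar>" if "max t a \<le> max s a" for s t
  proof -
    have "ln (max s a) - ln (max t a) \<le> (max s a - max t a) / max t a" using assms(1) that by (intro ln_diff_le) auto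
    also have "\<dots> \<le> \<bar>s - t\<bar> / a" using assms(1) that by (intro frac_le) auto
    finally show ?thesis using assms(1) by (simp add: field_simps)
  qed
  show ?thesis
  proof (cases "max t a \<le> max s a")
    case True
    then have "ln (max t a) \<le> ln (max s a)" using assms(1) by auto
    then show ?thesis using main[OF True] by (simp add: e assms right_diff_distrib)
  next
    case False
    then have l: "max s a \<le> max t a" by linarith
    then have "ln (max s a) \<le> ln (max t a)" using assms(1) by auto
    then show ?thesis using main[OF l] by (simp add: e assms right_diff_distrib abs_minus_commute)
  qed
qed

text \<open>Moving the centre is a Lipschitz change. Changing the radius by h = a - a' costs h |ln
  a|; for a < 1 this is at most h |ln h| because h <= a, which is why the exponent drops below 1.
  The value 3/4 is a choice above 2/3, so that its half exceeds 1/3.\<close>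

lemma log_pot_holder_aux:
  assumes K: "1 \<le> K"
  shows "\<exists>C\<ge>0. \<forall>x x' a a' z. norm x \<le> K \<longrightarrow> norm x' \<le> K \<longrightarrow> 0 \<le> a' \<longrightarrow> a' \<le> a \<longrightarrow> a \<le> K \<longrightarrow>
     \<bar>log_pot x a z - log_pot x' a' z\<bar> \<le> C * dist (x, a) (x', a') powr (3/4)"
proof -
  define L where "L = ln (2 + 4 * K\<^sup>2)"
  have L: "0 \<le> L" unfolding L_def using K by (intro ln_ge_zero) (simp add: add_increasing2)
  define C where "C = (2 + (L + 2 * ln K + 2)) * (4 * K) powr (1/4) + 8"
  have lk: "0 \<le> ln K" using K by simp
  have C: "0 \<le> C" unfolding C_def using L lk by simp
  have "\<bar>log_pot x a z - log_pot x' a' z\<bar> \<le> C * dist (x, a) (x', a') powr (3/4)"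
    if x: "norm x \<le> K" "norm x' \<le> K" and a: "0 \<le> a'" "a' \<le> a" "a \<le> K" for x x' a a' z
  proof (cases "a = 0")
    case True
    then show ?thesis using that C by (simp add: log_pot_def)
  next
    case False
    with a have a0: "0 < a" by simp
    define d where "d = dist (x, a) (x', a')"
    define h where "h = a - a'"
    have h: "0 \<le> h" "h \<le> a" "h \<le> d"
      using a dist_snd_le[of "(x,a)" "(x',a')"] by (auto simp: h_def d_def dist_real_def)
    have xd: "norm (x - x') \<le> d" using dist_fst_le[of "(x,a)" "(x',a')"] by (simp add: d_def dist_norm)
    have "d \<le> dist x x' + dist a a'" unfolding d_def by (simp add: dist_Pair_Pair sqrt_sum_squares_le_sum)
    then have dK: "d \<le> 4 * K" using norm_triangle_ineq4[of x x'] x a K by (simp add: dist_norm dist_real_def)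
    have d0: "0 \<le> d" by (simp add: d_def)
    have dp: "d \<le> (4 * K) powr (1/4) * d powr (3/4)"
    proof -
      have "d = d powr (1/4) * d powr (3/4)" using d0 by (simp add: powr_add[symmetric])
      also have "\<dots> \<le> (4 * K) powr (1/4) * d powr (3/4)"
        using dK d0 by (intro mult_right_mono powr_mono2) auto
      finally show ?thesis .
    qed
    let ?Q = "\<lambda>x a. ln (max ((norm (z - x))\<^sup>2) (a\<^sup>2))"
    let ?l = "ln (1 + (norm z)\<^sup>2)"
    have s1: "\<bar>log_pot x a z - log_pot x' a z\<bar> \<le> 2 * d"
    proof -
      have "log_pot x a z - log_pot x' a z = a * (?Q x a - ?Q x' a)" by (simp add: log_pot_def algebra_simps)
      also have "\<bar>\<dots>\<bar> \<le> 2 * \<bar>norm (z - x) - norm (z - x')\<bar>"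
        unfolding abs_mult using ln_max_lipschitz[OF a0 norm_ge_zero norm_ge_zero, of "z - x" "z - x'"] a0 by simp
      also have "\<bar>norm (z - x) - norm (z - x')\<bar> \<le> norm (x - x')"
        using norm_triangle_ineq3[of "z - x" "z - x'"] by (simp add: norm_minus_commute)
      finally show ?thesis using xd by simp
    qed
    have s2: "\<bar>log_pot x' a z - log_pot x' a' z\<bar> \<le> h * (L + 2 * \<bar>ln a\<bar>) + 2 * h"
    proof -
      \<comment> \<open>One term carries the change of the prefactor, whose cofactor is bounded up
        to |ln a|. The other carries the change of the truncation level, worth at most 2 (ln a - ln
        a') <= 2 h / a', and the factor a' cancels the denominator.\<close>
      have e: "log_pot x' a z - log_pot x' a' z = h * (?Q x' a - ?l) + a' * (?Q x' a - ?Q x' a')"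
        by (simp add: log_pot_def h_def algebra_simps)
      have "\<bar>h * (?Q x' a - ?l)\<bar> \<le> h * (L + 2 * \<bar>ln a\<bar>)"
        unfolding abs_mult L_def using h log_ratio_bound[OF x(2) a0 a(3), of z] by (simp add: mult_left_mono)
      moreover have "\<bar>a' * (?Q x' a - ?Q x' a')\<bar> \<le> 2 * h"
      proof (cases "a' = 0")
        case False
        with a have a'0: "0 < a'" by simp
        define \<rho> where "\<rho> = norm (z - x')"
        have \<rho>: "0 \<le> \<rho>" by (simp add: \<rho>_def)
        have q: "(a')\<^sup>2 \<le> a\<^sup>2" using a by (intro power_mono) auto
        then have mm: "max (\<rho>\<^sup>2) ((a')\<^sup>2) \<le> max (\<rho>\<^sup>2) (a\<^sup>2)" by auto
        then have mono: "ln (max (\<rho>\<^sup>2) ((a')\<^sup>2)) \<le> ln (max (\<rho>\<^sup>2) (a\<^sup>2))"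
          using a'0 by (subst ln_le_cancel_iff) (auto simp: less_max_iff_disj)
        have "ln (max (\<rho>\<^sup>2) (a\<^sup>2)) \<le> ln (max (\<rho>\<^sup>2) ((a')\<^sup>2)) + (2 * ln a - 2 * ln a')"
        proof (cases "a\<^sup>2 \<le> \<rho>\<^sup>2")
          case True
          then have "max (\<rho>\<^sup>2) (a\<^sup>2) = \<rho>\<^sup>2" "max (\<rho>\<^sup>2) ((a')\<^sup>2) = \<rho>\<^sup>2" using q by auto
          then show ?thesis using a a'0 a0 by simp
        next
          case False
          then have "max (\<rho>\<^sup>2) (a\<^sup>2) = a\<^sup>2" by auto
          moreover have "ln ((a')\<^sup>2) \<le> ln (max (\<rho>\<^sup>2) ((a')\<^sup>2))" using a'0 by (subst ln_le_cancel_iff) (auto simp: less_max_iff_disj)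
          ultimately show ?thesis using a0 a'0 by (simp add: ln_realpow)
        qed
        moreover have "ln a - ln a' \<le> h / a'" unfolding h_def using a a'0 by (intro ln_diff_le) auto
        ultimately have "\<bar>ln (max (\<rho>\<^sup>2) (a\<^sup>2)) - ln (max (\<rho>\<^sup>2) ((a')\<^sup>2))\<bar> \<le> 2 * h / a'" using mono by auto
        then show ?thesis unfolding abs_mult \<rho>_def[symmetric] using a'0 by (simp add: field_simps)
      qed (use h in simp)
      ultimately show ?thesis unfolding e by (intro order_trans[OF abs_triangle_ineq]) linarith
    qed
    have s3: "h * \<bar>ln a\<bar> \<le> h * ln K + 4 * d powr (3/4)"
    proof (cases "1 \<le> a \<or> h = 0")
      case True
      then have "h * \<bar>ln a\<bar> \<le> h * ln K" using a a0 h K by (cases "h = 0") (auto intro!: mult_left_mono)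
      then show ?thesis by (simp add: add_increasing2)
    next
      case False
      then have hp: "0 < h" "a < 1" using h by auto
      have "\<bar>ln a\<bar> = - ln a" using hp a0 by simp
      also have "\<dots> \<le> - ln h" using h hp a0 by simp
      \<comment> \<open>The quarter power is split off so that h * h^(-1/4) gives the exponent
        3/4.\<close>
      also have "\<dots> = 4 * ln (h powr (-1/4))" using hp by (simp add: ln_powr)
      also have "\<dots> \<le> 4 * h powr (-1/4)" using hp ln_le_minus_one[of "h powr (-1/4)"] by simp
      finally have "h * \<bar>ln a\<bar> \<le> h * (4 * h powr (-1/4))" using hp by (intro mult_left_mono) auto
      also have "\<dots> = 4 * h powr (3/4)" using hp by (simp add: powr_mult_base)
      also have "\<dots> \<le> 4 * d powr (3/4)" using h hp by (simp add: powr_mono2)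
      moreover have "0 \<le> h * ln K" using h lk by simp
      ultimately show ?thesis by linarith
    qed
    have "\<bar>log_pot x a z - log_pot x' a' z\<bar> \<le> 2 * d + (h * (L + 2 * \<bar>ln a\<bar>) + 2 * h)"
      using s1 s2 by linarith
    also have "\<dots> = 2 * d + h * (L + 2) + 2 * (h * \<bar>ln a\<bar>)" by (simp add: algebra_simps)
    also have "\<dots> \<le> 2 * d + h * (L + 2) + 2 * (h * ln K + 4 * d powr (3/4))" using s3 by simp
    also have "\<dots> = 2 * d + h * (L + 2 * ln K + 2) + 8 * d powr (3/4)" by (simp add: algebra_simps)
    also have "\<dots> \<le> 2 * d + d * (L + 2 * ln K + 2) + 8 * d powr (3/4)" using h L lk by (intro add_mono mult_right_mono) auto
    also have "\<dots> = d * (2 + (L + 2 * ln K + 2)) + 8 * d powr (3/4)" by (simp add: algebra_simps)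
    also have "\<dots> \<le> ((4 * K) powr (1/4) * d powr (3/4)) * (2 + (L + 2 * ln K + 2)) + 8 * d powr (3/4)"
      using dp L lk by (intro add_mono mult_right_mono) auto
    also have "\<dots> = C * d powr (3/4)" by (simp add: C_def algebra_simps)
    finally show ?thesis by (simp add: d_def)
  qed
  then show ?thesis using C by blast
qed

lemma log_pot_holder:
  assumes K: "1 \<le> K"
  obtains C where "C \<ge> 0" "\<And>(x::real^2) x' a a' z. norm x \<le> K \<Longrightarrow> norm x' \<le> K \<Longrightarrow> 0 \<le> a \<Longrightarrow> a \<le> K \<Longrightarrow> 0 \<le> a' \<Longrightarrow> a' \<le> K \<Longrightarrow>
     \<bar>log_pot x a z - log_pot x' a' z\<bar> \<le> C * dist (x, a) (x', a') powr (3/4)"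
proof -
  obtain C where C: "C \<ge> 0" "\<And>x x' a a' z. norm x \<le> K \<Longrightarrow> norm x' \<le> K \<Longrightarrow> 0 \<le> a' \<Longrightarrow> a' \<le> a \<Longrightarrow> a \<le> K \<Longrightarrow>
     \<bar>log_pot x a z - log_pot x' a' z\<bar> \<le> C * dist (x, a) (x', a') powr (3/4)"
    using log_pot_holder_aux[OF K] by metis
  show ?thesis
  proof (rule that[OF C(1)])
    fix x x' z :: "real^2" and a a' :: real
    assume *: "norm x \<le> K" "norm x' \<le> K" "0 \<le> a" "a \<le> K" "0 \<le> a'" "a' \<le> K"
    show "\<bar>log_pot x a z - log_pot x' a' z\<bar> \<le> C * dist (x, a) (x', a') powr (3/4)"
      using C(2)[of x x' a' a z] C(2)[of x' x a a' z] * by (cases "a' \<le> a") (auto simp: abs_minus_commute dist_commute)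
  qed
qed

section \<open>The potential of a difference of two profiles\<close>

lemma heat_measurable [measurable]:
  assumes [measurable]: "f \<in> borel_measurable borel" "g \<in> borel_measurable N" "h \<in> N \<rightarrow>\<^sub>M borel"
  shows "(\<lambda>\<omega>. heat (g \<omega>) f (h \<omega>)) \<in> borel_measurable N"
  unfolding heat_def by measurable

lemma heat_bound:
  assumes "f \<in> borel_measurable borel" "\<And>z. \<bar>f z\<bar> \<le> F"
  shows "\<bar>heat w f y\<bar> \<le> F" "integrable gauss2 (\<lambda>\<xi>. f (y + s *\<^sub>R vec2 \<xi>))"
proof -
  note [measurable] = assms(1)
  show i: "integrable gauss2 (\<lambda>\<xi>. f (y + s *\<^sub>R vec2 \<xi>))" for s
    by (rule gauss2.integrable_const_bound[where B=F]) (use assms in auto)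
  have "\<bar>heat w f y\<bar> \<le> (LINT \<xi>|gauss2. F)" unfolding heat_def
    by (intro order_trans[OF integral_abs_bound] integral_mono integrable_abs i assms) auto
  then show "\<bar>heat w f y\<bar> \<le> F" using gauss2.prob_space by simp
qed

lemma set_integrable_bounded:
  fixes f :: "real \<Rightarrow> real"
  assumes "f \<in> borel_measurable borel" "\<And>s. s \<in> {a..b} \<Longrightarrow> \<bar>f s\<bar> \<le> C"
  shows "set_integrable lborel {a..b} f"
proof -
  note [measurable] = assms(1)
  show ?thesis unfolding set_integrable_def
    by (rule Bochner_Integration.integrable_bound[where f="\<lambda>w. C * indicator {a..b} w"],
        use integrable_indicator_Icc in force)
       (use assms(2) in \<open>fastforce simp: indicator_def intro!: AE_I2\<close>)+
qed

lemma heat_set_integrable: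
  assumes "f \<in> borel_measurable borel" "\<And>z. \<bar>f z\<bar> \<le> F"
  shows "set_integrable lborel {a..b} (\<lambda>w. heat w f y)"
  by (rule set_integrable_bounded[where C=F]) (use assms heat_bound(1)[OF assms] in auto)

lemma circ_measurable [measurable]: "0 \<le> a \<Longrightarrow> circ m x a \<in> borel_measurable borel"
  by (intro borel_measurable_continuous_onI circ_continuous)

text \<open>Radius 0 is covered: the profile is 0 there, and so is the quotient by 0.\<close>

lemma circ_abs_bound: "0 \<le> a \<Longrightarrow> 2 \<le> m \<Longrightarrow> \<bar>circ m x a z\<bar> \<le> 2 * real m / a"
  using circ_bound[of a m x z] circ_nonneg[of a m x z] by (cases "a = 0") auto

text \<open>By \<open>circ_dynkin\<close> the potential is a heat increment of a difference of
  explicit potentials. Replacing each by its logarithmic limit costs a / m, the renormalised limits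
  differ by a 3/4-Hoelder amount, and the renormalisation leaves (a - a') times a heat increment of
  \<open>l\<close>.\<close>

lemma circ_potential_bound:
  assumes K: "1 \<le> K" and T: "0 \<le> T"
  obtains C where "C \<ge> 0"
    "\<And>(x::real^2) x' a a' m m' y u. norm x \<le> K \<Longrightarrow> norm x' \<le> K \<Longrightarrow> 0 \<le> a \<Longrightarrow> a \<le> K \<Longrightarrow> 0 \<le> a' \<Longrightarrow> a' \<le> K \<Longrightarrow>
      2 \<le> m \<Longrightarrow> even m \<Longrightarrow> 2 \<le> m' \<Longrightarrow> even m' \<Longrightarrow> 0 \<le> u \<Longrightarrow> u \<le> T \<Longrightarrow>
      \<bar>LBINT w:{0..u}. heat w (\<lambda>z. circ m x a z - circ m' x' a' z) y\<bar>
        \<le> C * (dist (x, a) (x', a') powr (3/4) + 1 / real m + 1 / real m')"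
proof -
  obtain C1 where C1: "C1 \<ge> 0" "\<And>(x::real^2) x' a a' z. norm x \<le> K \<Longrightarrow> norm x' \<le> K \<Longrightarrow> 0 \<le> a \<Longrightarrow> a \<le> K \<Longrightarrow> 0 \<le> a' \<Longrightarrow> a' \<le> K \<Longrightarrow>
     \<bar>log_pot x a z - log_pot x' a' z\<bar> \<le> C1 * dist (x, a) (x', a') powr (3/4)"
    using log_pot_holder[OF K] by blast
  define l where "l = (\<lambda>z::real^2. ln (1 + (norm z)\<^sup>2))"
  obtain c where c: "c \<ge> 0" "\<And>y u. 0 \<le> u \<Longrightarrow> \<bar>heat u l y - l y\<bar> \<le> c * sqrt u"
    using heat_ln_bound(2) unfolding l_def by blast
  have il: "integrable gauss2 (\<lambda>\<xi>. l (y + s *\<^sub>R vec2 \<xi>))" for y s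
    unfolding l_def by (rule heat_ln_bound(1))
  define C where "C = 2 * C1 + 2 * K + (4 * K) powr (1/4) * (c * sqrt T)"
  have "\<bar>LBINT w:{0..u}. heat w (\<lambda>z. circ m x a z - circ m' x' a' z) y\<bar>
        \<le> C * (dist (x, a) (x', a') powr (3/4) + 1 / real m + 1 / real m')"
    if x: "norm x \<le> K" "norm x' \<le> K" and a: "0 \<le> a" "a \<le> K" "0 \<le> a'" "a' \<le> K"
      and m: "2 \<le> m" "even m" "2 \<le> m'" "even m'" and u: "0 \<le> u" "u \<le> T" for x x' a a' m m' y u
  proof -
    define d where "d = dist (x, a) (x', a')"
    define E where "E = C1 * d powr (3/4) + K / real m + K / real m'"
    \<comment> \<open>Each potential is unbounded in z; with the multiples of \<open>l\<close>
      subtracted the difference is bounded uniformly in z.\<close>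
    define e where "e z = (circ_pot m x a z - a * l z) - (circ_pot m' x' a' z - a' * l z)" for z
    have eb: "\<bar>e z\<bar> \<le> E" for z
    proof -
      have "e z = (circ_pot m x a z - a * ln (max ((norm (z - x))\<^sup>2) (a\<^sup>2)))
         - (circ_pot m' x' a' z - a' * ln (max ((norm (z - x'))\<^sup>2) (a'\<^sup>2))) + (log_pot x a z - log_pot x' a' z)"
        by (simp add: e_def log_pot_def l_def algebra_simps)
      then have "\<bar>e z\<bar> \<le> a / real m + a' / real m' + C1 * d powr (3/4)"
        using circ_pot_approx[OF a(1), of m x z] circ_pot_approx[OF a(3), of m' x' z] m
          C1(2)[OF x a, of z] unfolding d_def by linarith
      also have "\<dots> \<le> K / real m + K / real m' + C1 * d powr (3/4)"
        using a by (intro add_mono divide_right_mono) auto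
      finally show ?thesis by (simp add: E_def)
    qed
    have ip: "integrable gauss2 (\<lambda>\<xi>. circ_pot m x a (y + sqrt u *\<^sub>R vec2 \<xi>))"
      "integrable gauss2 (\<lambda>\<xi>. circ_pot m' x' a' (y + sqrt u *\<^sub>R vec2 \<xi>))"
      using circ_dynkin(1) a m u by auto
    have ie: "integrable gauss2 (\<lambda>\<xi>. e (y + sqrt u *\<^sub>R vec2 \<xi>))"
      unfolding e_def using ip il by auto
    have he: "\<bar>heat u e y\<bar> \<le> E"
    proof -
      have "\<bar>heat u e y\<bar> \<le> (LINT \<xi>|gauss2. E)" unfolding heat_def
        by (intro order_trans[OF integral_abs_bound] integral_mono integrable_abs ie eb) auto
      then show ?thesis using gauss2.prob_space by simp
    qed
    have split: "heat w (\<lambda>z. circ m x a z - circ m' x' a' z) y = heat w (circ m x a) y - heat w (circ m' x' a') y" for w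
      unfolding heat_def
      by (intro Bochner_Integration.integral_diff heat_bound(2)[OF circ_measurable circ_abs_bound]) (use a m in auto)
    have "(LBINT w:{0..u}. heat w (\<lambda>z. circ m x a z - circ m' x' a' z) y)
      = (LBINT w:{0..u}. heat w (circ m x a) y) - (LBINT w:{0..u}. heat w (circ m' x' a') y)"
      unfolding split
      by (intro set_integral_diff heat_set_integrable[OF circ_measurable circ_abs_bound]) (use a m in auto)
    also have "\<dots> = heat u (circ_pot m x a) y - circ_pot m x a y - (heat u (circ_pot m' x' a') y - circ_pot m' x' a' y)"
      using circ_dynkin(2) a m u by auto
    also have "\<dots> = heat u e y - e y + (a - a') * (heat u l y - l y)"
    proof -
      have "heat u e y = heat u (circ_pot m x a) y - a * heat u l y - (heat u (circ_pot m' x' a') y - a' * heat u l y)"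
        unfolding heat_def e_def using ip il by simp
      then show ?thesis by (simp add: e_def algebra_simps)
    qed
    also have "\<bar>\<dots>\<bar> \<le> \<bar>heat u e y - e y\<bar> + \<bar>(a - a') * (heat u l y - l y)\<bar>" by (rule abs_triangle_ineq)
    also have "\<dots> \<le> 2 * E + d * (c * sqrt T)"
    proof (intro add_mono)
      show "\<bar>heat u e y - e y\<bar> \<le> 2 * E" using he eb[of y] by linarith
      have "\<bar>a - a'\<bar> \<le> d" using dist_snd_le[of "(x,a)" "(x',a')"] by (simp add: d_def dist_real_def)
      moreover have "\<bar>heat u l y - l y\<bar> \<le> c * sqrt T"
        using c(2)[OF u(1), of y] c(1) u by (meson mult_left_mono order_trans real_sqrt_le_mono)
      ultimately show "\<bar>(a - a') * (heat u l y - l y)\<bar> \<le> d * (c * sqrt T)"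
        unfolding abs_mult by (intro mult_mono) (auto simp: d_def)
    qed
    also have "\<dots> \<le> C * (d powr (3/4) + 1 / real m + 1 / real m')"
    proof -
      have "d \<le> dist x x' + dist a a'" unfolding d_def by (simp add: dist_Pair_Pair sqrt_sum_squares_le_sum)
      then have dK: "d \<le> 4 * K" using norm_triangle_ineq4[of x x'] x a K by (simp add: dist_norm dist_real_def)
      have d0: "0 \<le> d" by (simp add: d_def)
      have "d = d powr (1/4) * d powr (3/4)" using d0 by (simp add: powr_add[symmetric])
      also have "\<dots> \<le> (4 * K) powr (1/4) * d powr (3/4)"
        using dK d0 by (intro mult_right_mono powr_mono2) auto
      finally have "d * (c * sqrt T) \<le> ((4 * K) powr (1/4) * d powr (3/4)) * (c * sqrt T)"
        using c T by (intro mult_right_mono) auto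
      also have "\<dots> = ((4 * K) powr (1/4) * (c * sqrt T)) * d powr (3/4)" by simp
      also have "\<dots> \<le> ((4 * K) powr (1/4) * (c * sqrt T)) * (d powr (3/4) + 1 / real m + 1 / real m')"
        using c T by (intro mult_left_mono) auto
      finally have 1: "d * (c * sqrt T) \<le> ((4 * K) powr (1/4) * (c * sqrt T)) * (d powr (3/4) + 1 / real m + 1 / real m')" .
      have "E \<le> (C1 + K) * (d powr (3/4) + 1 / real m + 1 / real m')"
      proof -
        have "C1 * d powr (3/4) \<le> (C1 + K) * d powr (3/4)" "K * (1 / real m) \<le> (C1 + K) * (1 / real m)"
          "K * (1 / real m') \<le> (C1 + K) * (1 / real m')"
          using C1(1) K by (intro mult_right_mono; simp)+
        then show ?thesis unfolding E_def by (simp add: distrib_left)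
      qed
      moreover have "C * W = 2 * ((C1 + K) * W) + (4 * K) powr (1/4) * (c * sqrt T) * W" for W
        by (simp add: C_def algebra_simps)
      ultimately show ?thesis using 1 by (smt (verit))
    qed
    finally show ?thesis by (simp add: d_def)
  qed
  moreover have "0 \<le> C" unfolding C_def using C1 K c T by simp
  ultimately show ?thesis using that by blast
qed

section \<open>Moments of additive functionals of Brownian motion\<close>

text \<open>Riemann sums see only finitely many values of the path; in \<open>markov\<close> they
  carry the independence of increments over to path integrals.\<close>

lemma Riemann_sums_tendsto:
  fixes h :: "real \<Rightarrow> real"
  assumes h: "continuous_on {0..s} h" and s: "0 \<le> s"
  shows "(\<lambda>N. \<Sum>i<Suc N. s / real (Suc N) * h (real i * (s / real (Suc N)))) \<longlonglongrightarrow> (LBINT u:{0..s}. h u)"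
proof (rule LIMSEQ_I)
  fix r :: real assume r: "0 < r"
  define e where "e = r / (s + 1)"
  have e: "0 < e" using r s by (simp add: e_def)
  have "uniformly_continuous_on {0..s} h" by (rule compact_uniformly_continuous[OF h]) simp
  then obtain \<eta> where \<eta>: "0 < \<eta>" "\<And>x y. x \<in> {0..s} \<Longrightarrow> y \<in> {0..s} \<Longrightarrow> dist y x < \<eta> \<Longrightarrow> dist (h y) (h x) < e"
    using e unfolding uniformly_continuous_on_def by metis
  obtain N0 :: nat where N0: "s / \<eta> < real N0" using reals_Archimedean2 by blast
  show "\<exists>no. \<forall>N\<ge>no. norm ((\<Sum>i<Suc N. s / real (Suc N) * h (real i * (s / real (Suc N)))) - (LBINT u:{0..s}. h u)) < r"
  proof (intro exI allI impI)
    fix N assume N: "N0 \<le> N"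
    define d where "d = s / real (Suc N)"
    have d0: "0 \<le> d" using s by (simp add: d_def)
    have ds: "real (Suc N) * d = s" by (simp add: d_def)
    have d\<eta>: "d < \<eta>"
    proof -
      have "s / \<eta> < real (Suc N)" using N N0 by linarith
      then show ?thesis using \<eta>(1) by (simp add: d_def field_simps)
    qed
    have sub: "{a..b} \<subseteq> {0..s}" if "0 \<le> a" "b \<le> s" for a b using that by auto
    have est: "k \<le> Suc N \<Longrightarrow> \<bar>(\<Sum>i<k. d * h (real i * d)) - integral {0..real k * d} h\<bar> \<le> real k * (d * e)" for k
    proof (induction k)
      case (Suc k)
      have kd: "0 \<le> real k * d" "real k * d \<le> real (Suc k) * d" using d0 by (auto intro: mult_right_mono)
      have kds: "real (Suc k) * d \<le> s" using Suc.prems d0 ds by (metis mult_right_mono of_nat_le_iff)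
      have int: "h integrable_on {a..b}" if "0 \<le> a" "b \<le> s" for a b
        by (rule integrable_continuous_interval[OF continuous_on_subset[OF h sub[OF that]]])
      have comb: "integral {0..real (Suc k) * d} h = integral {0..real k * d} h + integral {real k * d..real (Suc k) * d} h"
        using Henstock_Kurzweil_Integration.integral_combine[OF kd int] kds by simp
      have "norm (integral {real k * d..real (Suc k) * d} (\<lambda>u. h u - h (real k * d))) \<le> e * (real (Suc k) * d - real k * d)"
      proof (rule integral_bound)
        show "continuous_on {real k * d..real (Suc k) * d} (\<lambda>u. h u - h (real k * d))"
          using kd kds by (intro continuous_intros continuous_on_subset[OF h]) auto
        fix u assume u: "u \<in> {real k * d..real (Suc k) * d}"
        have "dist u (real k * d) < \<eta>" using u d\<eta> by (auto simp: dist_real_def algebra_simps)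
        then have "dist (h u) (h (real k * d)) < e" using u kd kds by (intro \<eta>(2)) auto
        then show "norm (h u - h (real k * d)) \<le> e" by (simp add: dist_norm)
      qed (use kd in auto)
      moreover have "integral {real k * d..real (Suc k) * d} (\<lambda>u. h u - h (real k * d))
         = integral {real k * d..real (Suc k) * d} h - d * h (real k * d)"
        using kd kds int[OF kd(1) kds] by (subst Henstock_Kurzweil_Integration.integral_diff) (auto simp: algebra_simps)
      ultimately have "\<bar>integral {real k * d..real (Suc k) * d} h - d * h (real k * d)\<bar> \<le> d * e"
        by (simp add: algebra_simps)
      then show ?case using Suc comb by (simp add: algebra_simps)
    qed simp
    have "(LBINT u:{0..s}. h u) = integral {0..s} h"
      by (rule set_borel_integral_eq_integral(2)) (rule borel_integrable_atLeastAtMost'[OF h])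
    then have "norm ((\<Sum>i<Suc N. d * h (real i * d)) - (LBINT u:{0..s}. h u)) \<le> s * e"
      using est[of "Suc N"] ds by (simp add: mult.assoc[symmetric])
    also have "\<dots> < r" using s r by (simp add: e_def field_simps)
    finally show "norm ((\<Sum>i<Suc N. s / real (Suc N) * h (real i * (s / real (Suc N)))) - (LBINT u:{0..s}. h u)) < r"
      by (simp add: d_def)
  qed
qed

lemma running_integral_derivative:
  fixes h :: "real \<Rightarrow> real"
  assumes h: "continuous_on {0..t} h" and s: "s \<in> {0..t}"
  shows "((\<lambda>s. LBINT u:{0..s}. h u) has_real_derivative h s) (at s within {0..t})"
proof -
  have "((\<lambda>s. integral {0..s} h) has_vector_derivative h s) (at s within {0..t})"
    by (rule integral_has_vector_derivative[OF h s])
  moreover have "(LBINT u:{0..s}. h u) = integral {0..s} h" if "s \<in> {0..t}" for s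
    by (rule set_borel_integral_eq_integral(2), rule borel_integrable_atLeastAtMost', rule continuous_on_subset[OF h])
       (use that in auto)
  ultimately show ?thesis
    unfolding has_real_derivative_iff_has_vector_derivative
    using s by (auto intro: has_vector_derivative_transform)
qed

text \<open>The fundamental theorem of calculus replaces iterated integrals over a simplex. In the
  second identity the factor \<open>Z t - Z s\<close> belongs to the future of s, where the Markov
  property acts.\<close>

lemma running_integral_powers:
  fixes h :: "real \<Rightarrow> real"
  defines "Z \<equiv> \<lambda>s. LBINT u:{0..s}. h u"
  assumes h: "continuous_on {0..t} h" and t: "0 \<le> t"
  shows "Z t ^ Suc n = (LBINT s:{0..t}. real (Suc n) * (Z s ^ n * h s))"
    and "Z t ^ (n + 2) = (LBINT s:{0..t}. real ((n + 2) * (n + 1)) * (Z s ^ n * h s * (Z t - Z s)))"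
proof -
  have d: "(Z has_real_derivative h s) (at s within {0..t})" if "s \<in> {0..t}" for s
    unfolding Z_def by (rule running_integral_derivative[OF h that])
  have cZ: "continuous_on {0..t} Z"
    using d by (meson DERIV_continuous continuous_on_eq_continuous_within)
  have Z0: "Z 0 = 0" unfolding Z_def set_lebesgue_integral_def
    by (rule integral_eq_zero_AE, rule AE_mp[OF AE_lborel_singleton[of 0]]) (auto simp: indicator_def)
  have ftc: "(LBINT s:{0..t}. g s) = G t - G 0"
    if "\<And>s. s \<in> {0..t} \<Longrightarrow> (G has_real_derivative g s) (at s within {0..t})" "continuous_on {0..t} g" for g G :: "real \<Rightarrow> real"
    unfolding set_lebesgue_integral_def
    using integral_FTC_atLeastAtMost[OF t, of G g] that by (auto simp: has_real_derivative_iff_has_vector_derivative)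
  show "Z t ^ Suc n = (LBINT s:{0..t}. real (Suc n) * (Z s ^ n * h s))"
  proof (subst ftc[where G="\<lambda>s. Z s ^ Suc n"])
    show "((\<lambda>s. Z s ^ Suc n) has_real_derivative real (Suc n) * (Z s ^ n * h s)) (at s within {0..t})" if "s \<in> {0..t}" for s
      by (rule DERIV_cong[OF DERIV_power[OF d[OF that]]]) simp
    show "continuous_on {0..t} (\<lambda>s. real (Suc n) * (Z s ^ n * h s))" using cZ h by (intro continuous_intros)
  qed (simp add: Z0)
  show "Z t ^ (n + 2) = (LBINT s:{0..t}. real ((n + 2) * (n + 1)) * (Z s ^ n * h s * (Z t - Z s)))"
  \<comment> \<open>This antiderivative vanishes at 0 and equals the power of order n + 2 at t, as
    (n + 2) - (n + 1) = 1.\<close>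
  proof (subst ftc[where G="\<lambda>s. real (n + 2) * Z t * Z s ^ Suc n - real (n + 1) * Z s ^ Suc (Suc n)"])
    show "((\<lambda>s. real (n + 2) * Z t * Z s ^ Suc n - real (n + 1) * Z s ^ Suc (Suc n)) has_real_derivative
       real ((n + 2) * (n + 1)) * (Z s ^ n * h s * (Z t - Z s))) (at s within {0..t})" if "s \<in> {0..t}" for s
      by (rule DERIV_cong[OF DERIV_diff[OF DERIV_cmult[OF DERIV_power[OF d[OF that]]] DERIV_cmult[OF DERIV_power[OF d[OF that]]]]])
         (simp add: algebra_simps)
    show "continuous_on {0..t} (\<lambda>s. real ((n + 2) * (n + 1)) * (Z s ^ n * h s * (Z t - Z s)))"
      using cZ h by (intro continuous_intros)
  qed (simp add: Z0 algebra_simps)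
qed

context prob_space
begin

lemma integrable_bounded:
  fixes X :: "'a \<Rightarrow> real"
  assumes "X \<in> borel_measurable M" "\<And>\<omega>. \<omega> \<in> space M \<Longrightarrow> \<bar>X \<omega>\<bar> \<le> C"
  shows "integrable M X"
  by (rule integrable_const_bound[where B=C]) (use assms in auto)

lemma expectation_LBINT_swap:
  fixes q :: "real \<Rightarrow> 'a \<Rightarrow> real"
  assumes q: "(\<lambda>p. q (snd p) (fst p)) \<in> borel_measurable (M \<Otimes>\<^sub>M borel)"
    and b: "\<And>s \<omega>. s \<in> {a..b} \<Longrightarrow> \<omega> \<in> space M \<Longrightarrow> \<bar>q s \<omega>\<bar> \<le> C"
  shows "expectation (\<lambda>\<omega>. LBINT s:{a..b}. q s \<omega>) = (LBINT s:{a..b}. expectation (q s))"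
    and "integrable M (\<lambda>\<omega>. LBINT s:{a..b}. q s \<omega>)"
    and "set_integrable lborel {a..b} (\<lambda>s. expectation (q s))"
proof -
  interpret P: pair_sigma_finite M lborel ..
  have q'[measurable]: "(\<lambda>p. q (snd p) (fst p)) \<in> borel_measurable (M \<Otimes>\<^sub>M lborel)"
    using q by (simp cong: measurable_cong_sets sets_pair_measure_cong)
  have int: "integrable (M \<Otimes>\<^sub>M lborel) (\<lambda>(\<omega>, s). indicator {a..b} s * q s \<omega>)"
  proof (rule Bochner_Integration.integrable_bound)
    show "integrable (M \<Otimes>\<^sub>M lborel) (\<lambda>(\<omega>, s). C * indicator {a..b} s)"
      using integrable_indicator_Icc[of a b] by (intro P.Fubini_integrable) auto
    show "AE p in M \<Otimes>\<^sub>M lborel. norm (case p of (\<omega>, s) \<Rightarrow> indicator {a..b} s * q s \<omega>)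
       \<le> norm (case p of (\<omega>, s) \<Rightarrow> C * indicator {a..b} s)"
      using b by (fastforce intro!: AE_I2 simp: indicator_def space_pair_measure)
  qed (simp add: case_prod_unfold)
  show "expectation (\<lambda>\<omega>. LBINT s:{a..b}. q s \<omega>) = (LBINT s:{a..b}. expectation (q s))"
    unfolding set_lebesgue_integral_def using P.Fubini_integral[OF int] by simp
  show "integrable M (\<lambda>\<omega>. LBINT s:{a..b}. q s \<omega>)"
    unfolding set_lebesgue_integral_def using P.integrable_fst[OF int] by simp
  show "set_integrable lborel {a..b} (\<lambda>s. expectation (q s))"
    unfolding set_integrable_def using P.integrable_snd[OF int] by simp
qed

end

text \<open>Continuity and the starting point hold for every outcome, and continuity also at
  negative times, so that path integrals need no exceptional sets. \<open>continuous_version\<close>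
  brings the given Brownian motion into this form.\<close>

locale continuous_bm = prob_space M for M :: "'w measure" +
  fixes B :: "real \<Rightarrow> 'w \<Rightarrow> real^2" and x0 :: "real^2"
  assumes B_meas: "\<And>t. B t \<in> borel_measurable M"
    and B_cont: "\<And>\<omega>. continuous_on UNIV (\<lambda>t. B t \<omega>)"
    and B_start: "\<And>\<omega>. B 0 \<omega> = x0"
    and B_indep: "\<And>(t :: nat \<Rightarrow> real) n. 0 \<le> t 0 \<Longrightarrow> (\<And>i. i < n \<Longrightarrow> t i \<le> t (Suc i)) \<Longrightarrow>
         indep_vars (\<lambda>_. borel) (\<lambda>i \<omega>. B (t (Suc i)) \<omega> - B (t i) \<omega>) {..<n}"
    and B_law: "\<And>s t. 0 \<le> s \<Longrightarrow> s < t \<Longrightarrow>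
         distr M borel (\<lambda>\<omega>. B t \<omega> - B s \<omega>) = distr gauss2 borel (\<lambda>\<xi>. sqrt (t - s) *\<^sub>R vec2 \<xi>)"
begin

text \<open>The path is evaluated at the times floor((n + 1) g) / (n + 1), which take countably many
  values, and continuity gives the limit.\<close>

lemma B_joint_measurable [measurable (raw)]:
  assumes [measurable]: "g \<in> borel_measurable N" "h \<in> N \<rightarrow>\<^sub>M M"
  shows "(\<lambda>z. B (g z) (h z)) \<in> borel_measurable N"
proof (rule borel_measurable_LIMSEQ_metric)
  fix n :: nat
  have "(\<lambda>z. (\<lambda>(k::int) z. B (real_of_int k / real (Suc n)) (h z)) \<lfloor>real (Suc n) * g z\<rfloor> z) \<in> borel_measurable N"
    by (rule measurable_compose_countable) (use B_meas in \<open>auto intro: measurable_compose[OF assms(2)]\<close>)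
  then show "(\<lambda>z. B (real_of_int \<lfloor>real (Suc n) * g z\<rfloor> / real (Suc n)) (h z)) \<in> borel_measurable N" by simp
next
  fix z assume "z \<in> space N"
  have "(\<lambda>n. real_of_int \<lfloor>real (Suc n) * g z\<rfloor> / real (Suc n)) \<longlonglongrightarrow> g z"
  proof (rule LIMSEQ_I)
    fix r :: real assume "0 < r"
    then obtain N0 where N0: "1 / r < real N0" using reals_Archimedean2 by blast
    show "\<exists>no. \<forall>n\<ge>no. norm (real_of_int \<lfloor>real (Suc n) * g z\<rfloor> / real (Suc n) - g z) < r"
    proof (intro exI allI impI)
      fix n assume "N0 \<le> n"
      then have n: "1 / r < real (Suc n)" using N0 by linarith
      have "real_of_int \<lfloor>real (Suc n) * g z\<rfloor> / real (Suc n) - g z = (real_of_int \<lfloor>real (Suc n) * g z\<rfloor> - real (Suc n) * g z) / real (Suc n)"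
        by (simp add: field_simps)
      also have "norm \<dots> \<le> 1 / real (Suc n)"
      proof -
        have "\<bar>real_of_int \<lfloor>real (Suc n) * g z\<rfloor> - real (Suc n) * g z\<bar> \<le> 1" by linarith
        then show ?thesis unfolding norm_divide by (intro frac_le) auto
      qed
      also have "\<dots> < r" using n \<open>0 < r\<close> by (simp add: field_simps)
      finally show "norm (real_of_int \<lfloor>real (Suc n) * g z\<rfloor> / real (Suc n) - g z) < r" .
    qed
  qed
  moreover have "isCont (\<lambda>t. B t (h z)) (g z)"
    using B_cont by (simp add: continuous_on_eq_continuous_at)
  ultimately show "(\<lambda>n. B (real_of_int \<lfloor>real (Suc n) * g z\<rfloor> / real (Suc n)) (h z)) \<longlonglongrightarrow> B (g z) (h z)"
    by (rule isCont_tendsto_compose[rotated])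
qed

section \<open>Additive functionals and the Markov property at deterministic times\<close>

definition Z :: "(real^2 \<Rightarrow> real) \<Rightarrow> real \<Rightarrow> 'w \<Rightarrow> real" where
  "Z f t \<omega> = (LBINT s:{0..t}. f (B s \<omega>))"

lemma Z_measurable [measurable (raw)]:
  assumes [measurable]: "f \<in> borel_measurable borel" "g \<in> borel_measurable N" "h \<in> N \<rightarrow>\<^sub>M M"
  shows "(\<lambda>z. Z f (g z) (h z)) \<in> borel_measurable N"
proof -
  have eq: "Z f t \<omega> = (LINT s|lborel. (if 0 \<le> s \<and> s \<le> t then f (B s \<omega>) else 0))" for t \<omega>
    unfolding Z_def set_lebesgue_integral_def by (rule Bochner_Integration.integral_cong) (auto simp: indicator_def)
  show ?thesis unfolding eq by measurable
qed

lemma f_B_continuous: "continuous_on UNIV f \<Longrightarrow> continuous_on A (\<lambda>s. f (B s \<omega>))"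
  using continuous_on_compose2[OF _ continuous_on_subset[OF B_cont, of A \<omega>], of UNIV f] by auto

lemma Z_bound:
  assumes "continuous_on UNIV f" "\<And>z. \<bar>f z\<bar> \<le> F" "0 \<le> t"
  shows "\<bar>Z f t \<omega>\<bar> \<le> F * t"
proof -
  have "Z f t \<omega> = integral {0..t} (\<lambda>s. f (B s \<omega>))"
    unfolding Z_def by (rule set_borel_integral_eq_integral(2), rule borel_integrable_atLeastAtMost', rule f_B_continuous[OF assms(1)])
  moreover have "norm (integral {0..t} (\<lambda>s. f (B s \<omega>))) \<le> F * (t - 0)"
    by (rule integral_bound) (use assms f_B_continuous[OF assms(1)] in auto)
  ultimately show ?thesis by simp
qed

lemma Z_diff:
  assumes "continuous_on UNIV f" "0 \<le> s" "s \<le> t"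
  shows "Z f t \<omega> - Z f s \<omega> = (LBINT v:{s..t}. f (B v \<omega>))"
proof -
  have e: "(LBINT u:{a..b}. f (B u \<omega>)) = integral {a..b} (\<lambda>s. f (B s \<omega>))" for a b
    by (rule set_borel_integral_eq_integral(2), rule borel_integrable_atLeastAtMost', rule f_B_continuous[OF assms(1)])
  have "integral {0..s} (\<lambda>s. f (B s \<omega>)) + integral {s..t} (\<lambda>s. f (B s \<omega>)) = integral {0..t} (\<lambda>s. f (B s \<omega>))"
    by (rule Henstock_Kurzweil_Integration.integral_combine) (use assms in \<open>auto intro!: integrable_continuous_interval f_B_continuous\<close>)
  then show ?thesis by (simp add: Z_def e)
qed

text \<open>On a grid of [0, s] extended by the point v, the Riemann sum and \<open>B s\<close>
  depend on the first N + 1 increments only, and \<open>B v - B s\<close> is the last one. The zero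
  component gives both variables the same type.\<close>

lemma independent_increment:
  assumes f: "f \<in> borel_measurable borel" and s: "0 \<le> s" "s \<le> v"
  shows "indep_var (borel \<Otimes>\<^sub>M borel)
     (\<lambda>\<omega>. (\<Sum>i<Suc N. s / real (Suc N) * f (B (real i * (s / real (Suc N))) \<omega>), B s \<omega>))
     (borel \<Otimes>\<^sub>M borel) (\<lambda>\<omega>. (0::real, B v \<omega> - B s \<omega>))"
proof -
  note [measurable] = f
  define d where "d = s / real (Suc N)"
  have d: "0 \<le> d" "real (Suc N) * d = s" using s by (auto simp: d_def)
  \<comment> \<open>\<open>t (Suc N)\<close> is s, so the increment with index \<open>Suc N\<close>
    runs from s to v.\<close>
  define t where "t i = (if i \<le> Suc N then real i * d else v)" for i
  define X where "X i \<omega> = B (t (Suc i)) \<omega> - B (t i) \<omega>" for i \<omega>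
  have iv: "indep_vars (\<lambda>_. borel) X {..<Suc (Suc N)}"
    unfolding X_def
  proof (rule B_indep)
    show "t i \<le> t (Suc i)" if "i < Suc (Suc N)" for i
    proof (cases "i = Suc N")
      case True
      then show ?thesis using d s by (simp add: t_def)
    next
      case False
      then show ?thesis using d that by (simp add: t_def mult_right_mono)
    qed
  qed (simp add: t_def)
  have r: "indep_var (Pi\<^sub>M {..<Suc N} (\<lambda>_. borel)) (\<lambda>\<omega>. restrict (\<lambda>i. X i \<omega>) {..<Suc N})
      (Pi\<^sub>M {Suc N} (\<lambda>_. borel)) (\<lambda>\<omega>. restrict (\<lambda>i. X i \<omega>) {Suc N})"
    by (rule indep_var_restrict[OF iv]) auto
  define Y where "Y e = (\<Sum>i<Suc N. d * f (x0 + (\<Sum>j<i. e j)), x0 + (\<Sum>j<Suc N. e j))" for e :: "nat \<Rightarrow> real^2"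
  have m1: "(\<lambda>e. x0 + (\<Sum>j<i. e j)) \<in> borel_measurable (Pi\<^sub>M {..<Suc N} (\<lambda>_. borel))" if "i \<le> Suc N" for i
    using that by (intro borel_measurable_add borel_measurable_sum borel_measurable_const measurable_component_singleton) auto
  have "Y \<in> Pi\<^sub>M {..<Suc N} (\<lambda>_. borel) \<rightarrow>\<^sub>M borel \<Otimes>\<^sub>M borel"
    unfolding Y_def
    by (intro measurable_Pair borel_measurable_sum borel_measurable_times borel_measurable_const measurable_compose[OF m1 f] m1) auto
  moreover have "(\<lambda>e. (0::real, e (Suc N))) \<in> Pi\<^sub>M {Suc N} (\<lambda>_. borel) \<rightarrow>\<^sub>M borel \<Otimes>\<^sub>M borel"
    by (intro measurable_Pair measurable_const measurable_component_singleton) auto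
  ultimately have "indep_var (borel \<Otimes>\<^sub>M borel) (Y \<circ> (\<lambda>\<omega>. restrict (\<lambda>i. X i \<omega>) {..<Suc N}))
     (borel \<Otimes>\<^sub>M borel) ((\<lambda>e. (0::real, e (Suc N))) \<circ> (\<lambda>\<omega>. restrict (\<lambda>i. X i \<omega>) {Suc N}))"
    by (rule indep_var_compose[OF r])
  moreover have "x0 + (\<Sum>j<i. restrict (\<lambda>i. X i \<omega>) {..<Suc N} j) = B (real i * d) \<omega>" if "i \<le> Suc N" for i \<omega>
  proof -
    have "(\<Sum>j<i. restrict (\<lambda>i. X i \<omega>) {..<Suc N} j) = (\<Sum>j<i. B (t (Suc j)) \<omega> - B (t j) \<omega>)"
      using that by (intro sum.cong) (auto simp: X_def)
    also have "\<dots> = B (t i) \<omega> - B (t 0) \<omega>" by (rule sum_lessThan_telescope)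
    finally show ?thesis using that by (simp add: t_def B_start)
  qed
  then have "Y \<circ> (\<lambda>\<omega>. restrict (\<lambda>i. X i \<omega>) {..<Suc N}) = (\<lambda>\<omega>. (\<Sum>i<Suc N. d * f (B (real i * d) \<omega>), B s \<omega>))"
    using d by (auto simp: fun_eq_iff Y_def simp del: sum.lessThan_Suc of_nat_Suc intro!: sum.cong)
  moreover have "((\<lambda>e. (0::real, e (Suc N))) \<circ> (\<lambda>\<omega>. restrict (\<lambda>i. X i \<omega>) {Suc N})) = (\<lambda>\<omega>. (0::real, B v \<omega> - B s \<omega>))"
    using d by (auto simp: fun_eq_iff X_def t_def)
  ultimately show ?thesis by (simp add: d_def)
qed

text \<open>The joint law is a product by \<open>independent_increment\<close>. Integrating out the
  increment first turns \<open>g (B v)\<close> into the heat semigroup at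
  \<open>B s\<close>.\<close>

lemma markov_discrete:
  fixes N :: nat
  assumes f: "f \<in> borel_measurable borel" and s: "0 \<le> s" "s < v"
    and \<psi>: "(\<lambda>p. \<psi> (fst p) (snd p)) \<in> borel_measurable (borel \<Otimes>\<^sub>M borel)"
    and g: "g \<in> borel_measurable borel" "\<And>z. \<bar>g z\<bar> \<le> G"
  defines "R \<equiv> \<lambda>\<omega>. \<Sum>i<Suc N. s / real (Suc N) * f (B (real i * (s / real (Suc N))) \<omega>)"
  assumes b: "\<And>\<omega>. \<omega> \<in> space M \<Longrightarrow> \<bar>\<psi> (R \<omega>) (B s \<omega>)\<bar> \<le> C"
  shows "expectation (\<lambda>\<omega>. \<psi> (R \<omega>) (B s \<omega>) * g (B v \<omega>)) = expectation (\<lambda>\<omega>. \<psi> (R \<omega>) (B s \<omega>) * heat (v - s) g (B s \<omega>))"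
proof -
  note [measurable] = f g(1)
  have \<psi>'[measurable]: "(\<lambda>\<omega>. \<psi> (k \<omega>) (h \<omega>)) \<in> borel_measurable N'"
    if [measurable]: "k \<in> borel_measurable N'" "h \<in> borel_measurable N'" for k h and N' :: "'z measure"
    using measurable_compose[OF measurable_Pair[OF that] \<psi>] by simp
  have Bm[measurable]: "B t \<in> borel_measurable M" for t by (rule B_meas)
  have ind: "indep_var (borel \<Otimes>\<^sub>M borel) (\<lambda>\<omega>. (R \<omega>, B s \<omega>)) (borel \<Otimes>\<^sub>M borel) (\<lambda>\<omega>. (0::real, B v \<omega> - B s \<omega>))"
    unfolding R_def by (rule independent_increment) (use f s in auto)
  have Rm[measurable]: "R \<in> borel_measurable M" unfolding R_def by measurable
  define \<mu> where "\<mu> = distr M (borel \<Otimes>\<^sub>M borel) (\<lambda>\<omega>. (R \<omega>, B s \<omega>))"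
  define \<nu> where "\<nu> = distr M (borel \<Otimes>\<^sub>M borel) (\<lambda>\<omega>. (0::real, B v \<omega> - B s \<omega>))"
  interpret \<mu>: prob_space \<mu> unfolding \<mu>_def by (rule prob_space_distr) measurable
  interpret \<nu>: prob_space \<nu> unfolding \<nu>_def by (rule prob_space_distr) measurable
  interpret P: pair_sigma_finite \<mu> \<nu> ..
  have sets_\<mu>[measurable_cong]: "sets \<mu> = sets (borel \<Otimes>\<^sub>M borel)" by (simp add: \<mu>_def)
  have sets_\<nu>[measurable_cong]: "sets \<nu> = sets (borel \<Otimes>\<^sub>M borel)" by (simp add: \<nu>_def)
  have prod: "\<mu> \<Otimes>\<^sub>M \<nu> = distr M ((borel \<Otimes>\<^sub>M borel) \<Otimes>\<^sub>M (borel \<Otimes>\<^sub>M borel)) (\<lambda>\<omega>. ((R \<omega>, B s \<omega>), (0::real, B v \<omega> - B s \<omega>)))"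
    using ind unfolding indep_var_distribution_eq \<mu>_def \<nu>_def by simp
  define \<Phi> where "\<Phi> p = \<psi> (fst (fst p)) (snd (fst p)) * g (snd (fst p) + snd (snd p))" for p :: "(real \<times> (real^2)) \<times> (real \<times> (real^2))"
  have \<Phi>m[measurable]: "\<Phi> \<in> borel_measurable ((borel \<Otimes>\<^sub>M borel) \<Otimes>\<^sub>M (borel \<Otimes>\<^sub>M borel))"
    unfolding \<Phi>_def by measurable
  have Gn: "0 \<le> G" using g(2)[of 0] by linarith
  have ib: "integrable M (\<lambda>\<omega>. \<psi> (R \<omega>) (B s \<omega>) * g (B v \<omega>))"
    by (rule integrable_bounded[where C="C * G"]) (use b g Gn in \<open>auto simp: abs_mult intro!: mult_mono intro: order_trans[OF abs_ge_zero]\<close>)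
  have e1: "expectation (\<lambda>\<omega>. \<psi> (R \<omega>) (B s \<omega>) * g (B v \<omega>)) = integral\<^sup>L (\<mu> \<Otimes>\<^sub>M \<nu>) \<Phi>"
    unfolding prod by (subst integral_distr) (auto simp: \<Phi>_def)
  have i\<Phi>: "integrable (\<mu> \<Otimes>\<^sub>M \<nu>) \<Phi>"
    unfolding prod by (subst integrable_distr_eq) (use ib in \<open>auto simp: \<Phi>_def\<close>)
  have inner: "(LINT w|\<nu>. \<Phi> (p, w)) = \<psi> (fst p) (snd p) * heat (v - s) g (snd p)" for p
  proof -
    have "(LINT w|\<nu>. g (snd p + snd w)) = (LINT w|distr M borel (\<lambda>\<omega>. B v \<omega> - B s \<omega>). g (snd p + w))"
      unfolding \<nu>_def by (simp add: integral_distr)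
    also have "\<dots> = heat (v - s) g (snd p)"
      unfolding B_law[OF s] heat_def by (subst integral_distr) auto
    finally have "(LINT w|\<nu>. g (snd p + snd w)) = heat (v - s) g (snd p)" .
    then show ?thesis by (simp add: \<Phi>_def)
  qed
  have "integral\<^sup>L (\<mu> \<Otimes>\<^sub>M \<nu>) \<Phi> = (LINT p|\<mu>. (LINT w|\<nu>. \<Phi> (p, w)))"
    using P.integral_fst'[OF i\<Phi>] by simp
  also have "\<dots> = (LINT p|\<mu>. \<psi> (fst p) (snd p) * heat (v - s) g (snd p))" by (simp add: inner)
  also have "\<dots> = expectation (\<lambda>\<omega>. \<psi> (R \<omega>) (B s \<omega>) * heat (v - s) g (B s \<omega>))"
    unfolding \<mu>_def by (subst integral_distr) auto
  finally show ?thesis using e1 by simp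
qed

text \<open>Dominated convergence along Riemann sums. These sums and \<open>Z f s\<close> all stay
  within distance F s of 0, so a bound on \<psi> on that interval suffices. For s = v the Gaussian
  law degenerates, and the claim holds because the heat flow over time 0 is the identity.\<close>

lemma markov:
  assumes f: "continuous_on UNIV f" "\<And>z. \<bar>f z\<bar> \<le> F" and s: "0 \<le> s" "s \<le> v"
    and \<psi>: "(\<lambda>p. \<psi> (fst p) (snd p)) \<in> borel_measurable (borel \<Otimes>\<^sub>M borel)"
    and \<psi>c: "\<And>y. continuous_on UNIV (\<lambda>z. \<psi> z y)"
    and \<psi>b: "\<And>z y. \<bar>z\<bar> \<le> F * s \<Longrightarrow> \<bar>\<psi> z y\<bar> \<le> C"
    and g: "g \<in> borel_measurable borel" "\<And>z. \<bar>g z\<bar> \<le> G"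
  shows "expectation (\<lambda>\<omega>. \<psi> (Z f s \<omega>) (B s \<omega>) * g (B v \<omega>)) = expectation (\<lambda>\<omega>. \<psi> (Z f s \<omega>) (B s \<omega>) * heat (v - s) g (B s \<omega>))"
proof (cases "s = v")
  case True
  have "heat 0 g y = g y" for y
    using gauss2.prob_space by (simp add: heat_def)
  then show ?thesis using True by simp
next
  case False
  with s have sv: "s < v" by simp
  have fm[measurable]: "f \<in> borel_measurable borel" using f by (intro borel_measurable_continuous_onI)
  note [measurable] = g(1)
  have \<psi>'[measurable]: "(\<lambda>\<omega>. \<psi> (k \<omega>) (h \<omega>)) \<in> borel_measurable N'"
    if [measurable]: "k \<in> borel_measurable N'" "h \<in> borel_measurable N'" for k h and N' :: "'z measure"
    using measurable_compose[OF measurable_Pair[OF that] \<psi>] by simp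
  have Bm[measurable]: "B t \<in> borel_measurable M" for t by (rule B_meas)
  define R where "R N \<omega> = (\<Sum>i<Suc N. s / real (Suc N) * f (B (real i * (s / real (Suc N))) \<omega>))" for N \<omega>
  have Rm[measurable]: "R N \<in> borel_measurable M" for N unfolding R_def by measurable
  have Fn: "0 \<le> F" using f(2)[of 0] by linarith
  have Gn: "0 \<le> G" using g(2)[of 0] by linarith
  have Rb: "\<bar>R N \<omega>\<bar> \<le> F * s" for N \<omega>
  proof -
    have "\<bar>R N \<omega>\<bar> \<le> (\<Sum>i<Suc N. \<bar>s / real (Suc N) * f (B (real i * (s / real (Suc N))) \<omega>)\<bar>)"
      unfolding R_def by (rule sum_abs)
    also have "\<dots> \<le> (\<Sum>i<Suc N. s / real (Suc N) * F)"
      using s f by (intro sum_mono) (auto simp: abs_mult intro!: mult_left_mono divide_right_mono)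
    also have "\<dots> = F * s" by simp
    finally show ?thesis .
  qed
  have Rlim: "(\<lambda>N. R N \<omega>) \<longlonglongrightarrow> Z f s \<omega>" for \<omega>
    unfolding R_def Z_def by (rule Riemann_sums_tendsto[OF f_B_continuous[OF f(1)] s(1)])
  have \<psi>lim: "(\<lambda>N. \<psi> (R N \<omega>) (B s \<omega>)) \<longlonglongrightarrow> \<psi> (Z f s \<omega>) (B s \<omega>)" for \<omega>
    using isCont_tendsto_compose[OF _ Rlim, of \<omega> "\<lambda>z. \<psi> z (B s \<omega>)"] \<psi>c by (simp add: continuous_on_eq_continuous_at)
  have lim: "(\<lambda>N. expectation (\<lambda>\<omega>. \<psi> (R N \<omega>) (B s \<omega>) * q \<omega>)) \<longlonglongrightarrow> expectation (\<lambda>\<omega>. \<psi> (Z f s \<omega>) (B s \<omega>) * q \<omega>)"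
    if [measurable]: "q \<in> borel_measurable M" and q: "\<And>\<omega>. \<bar>q \<omega>\<bar> \<le> G" for q
  proof (rule integral_dominated_convergence[where w="\<lambda>_. C * G"])
    show "AE \<omega> in M. (\<lambda>N. \<psi> (R N \<omega>) (B s \<omega>) * q \<omega>) \<longlonglongrightarrow> \<psi> (Z f s \<omega>) (B s \<omega>) * q \<omega>"
      by (intro AE_I2 tendsto_mult \<psi>lim tendsto_const)
    show "AE \<omega> in M. norm (\<psi> (R N \<omega>) (B s \<omega>) * q \<omega>) \<le> C * G" for N
      using \<psi>b[OF Rb] q Gn by (auto simp: abs_mult intro!: AE_I2 mult_mono intro: order_trans[OF abs_ge_zero])
  qed (auto)
  have hb: "\<bar>heat (v - s) g y\<bar> \<le> G" for y by (rule heat_bound(1)[OF g])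
  have l1: "(\<lambda>N. expectation (\<lambda>\<omega>. \<psi> (R N \<omega>) (B s \<omega>) * g (B v \<omega>))) \<longlonglongrightarrow> expectation (\<lambda>\<omega>. \<psi> (Z f s \<omega>) (B s \<omega>) * g (B v \<omega>))"
    by (rule lim) (use g in auto)
  have l2: "(\<lambda>N. expectation (\<lambda>\<omega>. \<psi> (R N \<omega>) (B s \<omega>) * heat (v - s) g (B s \<omega>))) \<longlonglongrightarrow> expectation (\<lambda>\<omega>. \<psi> (Z f s \<omega>) (B s \<omega>) * heat (v - s) g (B s \<omega>))"
    by (rule lim) (use hb in auto)
  have eq: "expectation (\<lambda>\<omega>. \<psi> (R N \<omega>) (B s \<omega>) * g (B v \<omega>)) = expectation (\<lambda>\<omega>. \<psi> (R N \<omega>) (B s \<omega>) * heat (v - s) g (B s \<omega>))" for N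
    unfolding R_def
    by (rule markov_discrete[OF fm s(1) sv \<psi> g]) (use \<psi>b[OF Rb] in \<open>simp add: R_def\<close>)
  show ?thesis using LIMSEQ_unique[OF l1[unfolded eq] l2] .
qed

text \<open>The potential of \<open>g\<close> up to time u: the mean of the integral of
  \<open>g\<close> along a Brownian motion started at y and run for time u.\<close>

definition H :: "(real^2 \<Rightarrow> real) \<Rightarrow> real \<Rightarrow> real^2 \<Rightarrow> real" where
  "H g u y = (LBINT w:{0..u}. heat w g y)"

lemma H_measurable [measurable (raw)]:
  assumes [measurable]: "g \<in> borel_measurable borel" "u \<in> borel_measurable N" "y \<in> borel_measurable N"
  shows "(\<lambda>z. H g (u z) (y z)) \<in> borel_measurable N"
proof -
  have eq: "H g u y = (LINT w|lborel. (if 0 \<le> w \<and> w \<le> u then heat w g y else 0))" for u y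
    unfolding H_def set_lebesgue_integral_def by (rule Bochner_Integration.integral_cong) (auto simp: indicator_def)
  show ?thesis unfolding eq by measurable
qed

text \<open>The Markov property at each v in [s, t], integrated over v with Fubini on both
  sides.\<close>

lemma markov_increment:
  assumes f: "continuous_on UNIV f" "\<And>z. \<bar>f z\<bar> \<le> F" and s: "0 \<le> s" "s \<le> t"
    and \<psi>: "(\<lambda>p. \<psi> (fst p) (snd p)) \<in> borel_measurable (borel \<Otimes>\<^sub>M borel)"
    and \<psi>c: "\<And>y. continuous_on UNIV (\<lambda>z. \<psi> z y)"
    and \<psi>b: "\<And>z y. \<bar>z\<bar> \<le> F * s \<Longrightarrow> \<bar>\<psi> z y\<bar> \<le> C"
    and g: "continuous_on UNIV g" "\<And>z. \<bar>g z\<bar> \<le> G"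
  shows "expectation (\<lambda>\<omega>. \<psi> (Z f s \<omega>) (B s \<omega>) * (Z g t \<omega> - Z g s \<omega>)) = expectation (\<lambda>\<omega>. \<psi> (Z f s \<omega>) (B s \<omega>) * H g (t - s) (B s \<omega>))"
proof -
  have fm[measurable]: "f \<in> borel_measurable borel" "g \<in> borel_measurable borel"
    using f g by (auto intro: borel_measurable_continuous_onI)
  have \<psi>'[measurable]: "(\<lambda>\<omega>. \<psi> (k \<omega>) (h \<omega>)) \<in> borel_measurable N'"
    if [measurable]: "k \<in> borel_measurable N'" "h \<in> borel_measurable N'" for k h and N' :: "'z measure"
    using measurable_compose[OF measurable_Pair[OF that] \<psi>] by simp
  have Gn: "0 \<le> G" using g(2)[of 0] by linarith
  let ?\<Psi> = "\<lambda>\<omega>. \<psi> (Z f s \<omega>) (B s \<omega>)"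
  have \<Psi>b: "\<bar>?\<Psi> \<omega>\<bar> \<le> C" for \<omega> by (rule \<psi>b[OF Z_bound[OF f s(1)]])
  have b1: "\<bar>?\<Psi> \<omega> * g y\<bar> \<le> C * G" "\<bar>?\<Psi> \<omega> * heat w g y\<bar> \<le> C * G" for \<omega> y w
    using \<Psi>b[of \<omega>] g heat_bound(1)[OF fm(2) g(2)] Gn by (auto simp: abs_mult intro!: mult_mono intro: order_trans[OF abs_ge_zero])
  have shift: "(LBINT v:{s..t}. ?\<Psi> \<omega> * heat (v - s) g (B s \<omega>)) = ?\<Psi> \<omega> * H g (t - s) (B s \<omega>)" for \<omega>
  proof -
    have "(LBINT v:{s..t}. heat (v - s) g (B s \<omega>)) = (LINT v|lborel. indicator {0..t - s} (-s + 1 * v) * heat (-s + 1 * v) g (B s \<omega>))"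
      unfolding set_lebesgue_integral_def by (rule Bochner_Integration.integral_cong) (auto simp: indicator_def)
    also have "\<dots> = H g (t - s) (B s \<omega>)"
      unfolding H_def set_lebesgue_integral_def
      using lborel_integral_real_affine[where c=1 and t="-s" and f="\<lambda>w. indicator {0..t - s} w * heat w g (B s \<omega>)"] by simp
    finally show ?thesis by simp
  qed
  have "expectation (\<lambda>\<omega>. ?\<Psi> \<omega> * (Z g t \<omega> - Z g s \<omega>)) = expectation (\<lambda>\<omega>. LBINT v:{s..t}. ?\<Psi> \<omega> * g (B v \<omega>))"
    by (simp add: Z_diff[OF g(1) s])
  also have "\<dots> = (LBINT v:{s..t}. expectation (\<lambda>\<omega>. ?\<Psi> \<omega> * g (B v \<omega>)))"
    by (rule expectation_LBINT_swap(1)[where C="C * G"]) (use b1 in auto)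
  also have "\<dots> = (LBINT v:{s..t}. expectation (\<lambda>\<omega>. ?\<Psi> \<omega> * heat (v - s) g (B s \<omega>)))"
    by (rule set_lebesgue_integral_cong) (auto intro!: markov[OF f s(1) _ \<psi> \<psi>c \<psi>b fm(2) g(2)])
  also have "\<dots> = expectation (\<lambda>\<omega>. LBINT v:{s..t}. ?\<Psi> \<omega> * heat (v - s) g (B s \<omega>))"
    by (rule expectation_LBINT_swap(1)[symmetric, where C="C * G"]) (use b1 in auto)
  also have "\<dots> = expectation (\<lambda>\<omega>. ?\<Psi> \<omega> * H g (t - s) (B s \<omega>))" by (simp only: shift)
  finally show ?thesis .
qed

section \<open>Moment bounds for additive functionals\<close>

lemma Z_nonneg: "(\<And>z. 0 \<le> f z) \<Longrightarrow> 0 \<le> Z f t \<omega>"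
  unfolding Z_def set_lebesgue_integral_def by (intro integral_nonneg_AE) (auto simp: indicator_def)

lemma Z_moment_identity:
  assumes f: "continuous_on UNIV f" "\<And>z. \<bar>f z\<bar> \<le> F" and t: "0 \<le> t"
  shows "expectation (\<lambda>\<omega>. Z f t \<omega> ^ (n + 2))
      = (LBINT s:{0..t}. real ((n + 2) * (n + 1)) * expectation (\<lambda>\<omega>. Z f s \<omega> ^ n * f (B s \<omega>) * H f (t - s) (B s \<omega>)))"
    and "expectation (\<lambda>\<omega>. Z f t \<omega> ^ Suc n) = (LBINT s:{0..t}. real (Suc n) * expectation (\<lambda>\<omega>. Z f s \<omega> ^ n * f (B s \<omega>)))"
proof -
  have fm[measurable]: "f \<in> borel_measurable borel"
    using f by (auto intro: borel_measurable_continuous_onI)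
  have Fn: "0 \<le> F" using f(2)[of 0] by linarith
  have zb: "\<bar>Z f s \<omega>\<bar> \<le> F * t" if "s \<in> {0..t}" for s \<omega>
    using Z_bound[OF f, of s \<omega>] that Fn by (auto intro: order_trans mult_left_mono)
  have zn: "\<bar>Z f s \<omega>\<bar> ^ n \<le> (F * t) ^ n" if "s \<in> {0..t}" for s \<omega> n
    using zb[OF that] by (intro power_mono) auto
  have Ft: "0 \<le> F * t" using Fn t by simp
  have b0: "\<bar>Z f s \<omega> ^ n * f (B s \<omega>)\<bar> \<le> (F * t) ^ n * F" if "s \<in> {0..t}" for s \<omega>
    unfolding abs_mult power_abs using zn[OF that] f Ft by (intro mult_mono) auto
  have b1: "\<bar>Z f s \<omega> ^ n * f (B s \<omega>) * (Z f t \<omega> - Z f s \<omega>)\<bar> \<le> (F * t) ^ n * F * (2 * (F * t))" if "s \<in> {0..t}" for s \<omega>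
  proof -
    have "\<bar>Z f t \<omega> - Z f s \<omega>\<bar> \<le> 2 * (F * t)" using zb[OF that, of \<omega>] zb[of t \<omega>] t by auto
    then show ?thesis unfolding abs_mult[of "Z f s \<omega> ^ n * f (B s \<omega>)"]
      using b0[OF that] Ft Fn by (intro mult_mono) auto
  qed
  have "expectation (\<lambda>\<omega>. Z f t \<omega> ^ (n + 2)) = expectation (\<lambda>\<omega>. LBINT s:{0..t}. real ((n + 2) * (n + 1)) * (Z f s \<omega> ^ n * f (B s \<omega>) * (Z f t \<omega> - Z f s \<omega>)))"
    unfolding Z_def using running_integral_powers(2)[OF f_B_continuous[OF f(1)] t] by simp
  also have "\<dots> = (LBINT s:{0..t}. expectation (\<lambda>\<omega>. real ((n + 2) * (n + 1)) * (Z f s \<omega> ^ n * f (B s \<omega>) * (Z f t \<omega> - Z f s \<omega>))))"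
    by (rule expectation_LBINT_swap(1)[where C="real ((n + 2) * (n + 1)) * ((F * t) ^ n * F * (2 * (F * t)))"])
       (use b1 in \<open>auto simp: abs_mult intro!: mult_left_mono\<close>)
  also have "\<dots> = (LBINT s:{0..t}. real ((n + 2) * (n + 1)) * expectation (\<lambda>\<omega>. Z f s \<omega> ^ n * f (B s \<omega>) * H f (t - s) (B s \<omega>)))"
  proof (rule set_lebesgue_integral_cong)
    show "\<forall>s. s \<in> {0..t} \<longrightarrow> expectation (\<lambda>\<omega>. real ((n + 2) * (n + 1)) * (Z f s \<omega> ^ n * f (B s \<omega>) * (Z f t \<omega> - Z f s \<omega>)))
       = real ((n + 2) * (n + 1)) * expectation (\<lambda>\<omega>. Z f s \<omega> ^ n * f (B s \<omega>) * H f (t - s) (B s \<omega>))"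
    proof (intro allI impI)
      fix s assume s: "s \<in> {0..t}"
      have "expectation (\<lambda>\<omega>. Z f s \<omega> ^ n * f (B s \<omega>) * (Z f t \<omega> - Z f s \<omega>)) = expectation (\<lambda>\<omega>. Z f s \<omega> ^ n * f (B s \<omega>) * H f (t - s) (B s \<omega>))"
      proof (rule markov_increment[OF f, where \<psi>="\<lambda>z y. z ^ n * f y" and C="(F * s) ^ n * F" and G=F])
        show "\<bar>z ^ n * f y\<bar> \<le> (F * s) ^ n * F" if "\<bar>z\<bar> \<le> F * s" for z y
          unfolding abs_mult power_abs using that f(2)[of y] Fn s by (intro mult_mono power_mono) auto
      qed (use s f in \<open>auto intro!: continuous_intros\<close>)
      then show "expectation (\<lambda>\<omega>. real ((n + 2) * (n + 1)) * (Z f s \<omega> ^ n * f (B s \<omega>) * (Z f t \<omega> - Z f s \<omega>)))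
       = real ((n + 2) * (n + 1)) * expectation (\<lambda>\<omega>. Z f s \<omega> ^ n * f (B s \<omega>) * H f (t - s) (B s \<omega>))" by simp
    qed
  qed simp
  finally show "expectation (\<lambda>\<omega>. Z f t \<omega> ^ (n + 2))
      = (LBINT s:{0..t}. real ((n + 2) * (n + 1)) * expectation (\<lambda>\<omega>. Z f s \<omega> ^ n * f (B s \<omega>) * H f (t - s) (B s \<omega>)))" .
  have "expectation (\<lambda>\<omega>. Z f t \<omega> ^ Suc n) = expectation (\<lambda>\<omega>. LBINT s:{0..t}. real (Suc n) * (Z f s \<omega> ^ n * f (B s \<omega>)))"
    unfolding Z_def using running_integral_powers(1)[OF f_B_continuous[OF f(1)] t] by simp
  also have "\<dots> = (LBINT s:{0..t}. expectation (\<lambda>\<omega>. real (Suc n) * (Z f s \<omega> ^ n * f (B s \<omega>))))"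
    by (rule expectation_LBINT_swap(1)[where C="real (Suc n) * ((F * t) ^ n * F)"])
       (use b0 in \<open>auto simp: abs_mult intro!: mult_left_mono\<close>)
  finally show "expectation (\<lambda>\<omega>. Z f t \<omega> ^ Suc n) = (LBINT s:{0..t}. real (Suc n) * expectation (\<lambda>\<omega>. Z f s \<omega> ^ n * f (B s \<omega>)))"
    by simp
qed

lemma Z_power_bound:
  assumes f: "continuous_on UNIV f" "\<And>z. \<bar>f z\<bar> \<le> F" and s: "s \<in> {0..t}"
  shows "\<bar>Z f s \<omega> ^ n\<bar> \<le> (F * t) ^ n"
proof -
  have Fn: "0 \<le> F" using f(2)[of 0] by linarith
  have "\<bar>Z f s \<omega>\<bar> \<le> F * t"
    using Z_bound[OF f, of s \<omega>] s Fn by (auto intro: order_trans mult_left_mono)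
  then show ?thesis unfolding power_abs by (intro power_mono) auto
qed

text \<open>Khasminskii's argument: bounding the potential by A in the second-order moment identity
  leaves the integral of the first-order one, so passing from order n - 1 to order n costs a factor
  n A.\<close>

lemma positive_moment_bound:
  assumes g: "continuous_on UNIV g" "\<And>z. 0 \<le> g z" "\<And>z. g z \<le> F"
    and A: "0 \<le> A" "\<And>u y. 0 \<le> u \<Longrightarrow> u \<le> T \<Longrightarrow> H g u y \<le> A"
    and t: "0 \<le> t" "t \<le> T"
  shows "expectation (\<lambda>\<omega>. Z g t \<omega> ^ n) \<le> fact n * A ^ n"
proof (induction n rule: less_induct)
  case (less n)
  have gm[measurable]: "g \<in> borel_measurable borel"
    using g by (auto intro: borel_measurable_continuous_onI)
  have gF: "\<bar>g z\<bar> \<le> F" for z using g(2,3)[of z] by auto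
  have Fn: "0 \<le> F" using gF[of 0] by linarith
  have Hint: "integrable M (\<lambda>\<omega>. H g u (B s \<omega>))" "\<bar>H g u y\<bar> \<le> A" if "0 \<le> u" "u \<le> T" for u s y
  proof -
    have h: "\<bar>H g u y\<bar> \<le> A" for y
    proof -
      have "0 \<le> H g u y" unfolding H_def heat_def set_lebesgue_integral_def
        using g by (intro integral_nonneg_AE) (auto simp: indicator_def intro!: integral_nonneg_AE)
      then show ?thesis using A(2)[OF that, of y] by simp
    qed
    then show "integrable M (\<lambda>\<omega>. H g u (B s \<omega>))" "\<bar>H g u y\<bar> \<le> A"
      by (auto intro!: integrable_bounded[where C=A])
  qed
  consider "n = 0" | "n = 1" | k where "n = k + 2"
    by (metis One_nat_def add_2_eq_Suc' not0_implies_Suc)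
  then show ?case
  proof cases
    case 1
    then show ?thesis using prob_space by simp
  next
    case 2
    have Z0: "Z g 0 \<omega> = 0" for \<omega> using Z_bound[OF g(1) gF, of 0 \<omega>] by simp
    have "expectation (\<lambda>\<omega>. Z g t \<omega>) = expectation (\<lambda>\<omega>. H g t (B 0 \<omega>))"
      using markov_increment[OF g(1) gF, of 0 t "\<lambda>_ _. 1" 1 g F] t g gF by (simp add: Z0)
    also have "\<dots> \<le> expectation (\<lambda>\<omega>. A)"
      by (intro integral_mono Hint) (use t A in auto)
    finally show ?thesis using 2 prob_space by simp
  next
    case (3 k)
    have b: "\<bar>Z g s \<omega> ^ k * g (B s \<omega>)\<bar> \<le> (F * t) ^ k * F" if "s \<in> {0..t}" for s \<omega>
      unfolding abs_mult using Z_power_bound[OF g(1) gF that] gF Fn t by (intro mult_mono) auto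
    have bH: "\<bar>Z g s \<omega> ^ k * g (B s \<omega>) * H g (t - s) (B s \<omega>)\<bar> \<le> (F * t) ^ k * F * A" if "s \<in> {0..t}" for s \<omega>
      unfolding abs_mult[of "Z g s \<omega> ^ k * g (B s \<omega>)"] using b[OF that] Hint(2)[of "t - s"] that t Fn by (intro mult_mono) auto
    have "expectation (\<lambda>\<omega>. Z g t \<omega> ^ n) = (LBINT s:{0..t}. real ((k + 2) * (k + 1)) * expectation (\<lambda>\<omega>. Z g s \<omega> ^ k * g (B s \<omega>) * H g (t - s) (B s \<omega>)))"
      unfolding 3 by (rule Z_moment_identity(1)[OF g(1) gF t(1)])
    also have "\<dots> \<le> (LBINT s:{0..t}. real (k + 2) * A * (real (Suc k) * expectation (\<lambda>\<omega>. Z g s \<omega> ^ k * g (B s \<omega>))))"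
    proof (rule set_integral_mono)
      show "set_integrable lborel {0..t} (\<lambda>s. real ((k + 2) * (k + 1)) * expectation (\<lambda>\<omega>. Z g s \<omega> ^ k * g (B s \<omega>) * H g (t - s) (B s \<omega>)))"
        by (intro set_integrable_mult_right impI expectation_LBINT_swap(3)[where C="(F * t) ^ k * F * A"]) (use bH in auto)
      show "set_integrable lborel {0..t} (\<lambda>s. real (k + 2) * A * (real (Suc k) * expectation (\<lambda>\<omega>. Z g s \<omega> ^ k * g (B s \<omega>))))"
        by (intro set_integrable_mult_right impI expectation_LBINT_swap(3)[where C="(F * t) ^ k * F"]) (use b in auto)
      fix s assume s: "s \<in> {0..t}"
      have "expectation (\<lambda>\<omega>. Z g s \<omega> ^ k * g (B s \<omega>) * H g (t - s) (B s \<omega>)) \<le> expectation (\<lambda>\<omega>. Z g s \<omega> ^ k * g (B s \<omega>) * A)"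
      proof (rule integral_mono)
        show "integrable M (\<lambda>\<omega>. Z g s \<omega> ^ k * g (B s \<omega>) * H g (t - s) (B s \<omega>))"
          by (rule integrable_bounded[where C="(F * t) ^ k * F * A"]) (use bH[OF s] in auto)
        show "integrable M (\<lambda>\<omega>. Z g s \<omega> ^ k * g (B s \<omega>) * A)"
          by (intro integrable_mult_left impI integrable_bounded[where C="(F * t) ^ k * F"]) (use b[OF s] in auto)
        show "Z g s \<omega> ^ k * g (B s \<omega>) * H g (t - s) (B s \<omega>) \<le> Z g s \<omega> ^ k * g (B s \<omega>) * A" for \<omega>
          using s t A Z_nonneg[OF g(2)] g(2) by (intro mult_left_mono) auto
      qed
      then have "real ((k + 2) * (k + 1)) * expectation (\<lambda>\<omega>. Z g s \<omega> ^ k * g (B s \<omega>) * H g (t - s) (B s \<omega>))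
         \<le> real ((k + 2) * (k + 1)) * expectation (\<lambda>\<omega>. Z g s \<omega> ^ k * g (B s \<omega>) * A)" by (intro mult_left_mono) auto
      then show "real ((k + 2) * (k + 1)) * expectation (\<lambda>\<omega>. Z g s \<omega> ^ k * g (B s \<omega>) * H g (t - s) (B s \<omega>))
         \<le> real (k + 2) * A * (real (Suc k) * expectation (\<lambda>\<omega>. Z g s \<omega> ^ k * g (B s \<omega>)))"
        by (simp add: algebra_simps)
    qed
    also have "\<dots> = real (k + 2) * A * expectation (\<lambda>\<omega>. Z g t \<omega> ^ Suc k)"
      unfolding Z_moment_identity(2)[OF g(1) gF t(1)] by simp
    also have "\<dots> \<le> real (k + 2) * A * (fact (Suc k) * A ^ Suc k)"
      using less[of "Suc k"] 3 A by (intro mult_left_mono) auto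
    also have "\<dots> = fact n * A ^ n" unfolding 3 by (simp add: algebra_simps)
    finally show ?thesis .
  qed
qed

text \<open>Young's inequality by cases: if z^2 >= 2 c b, the left side is at most half of the top
  power; otherwise z^(2k) is at most (2 c b)^k. The coefficient 1/2 allows the top moment to be
  absorbed.\<close>

lemma young_even_power:
  fixes z b c :: real
  assumes "0 \<le> b" "0 \<le> c"
  shows "c * (z ^ (2 * k) * b) \<le> 1/2 * z ^ (2 * k + 2) + (2 * c * b) ^ Suc k"
proof -
  define w where "w = z\<^sup>2"
  have w: "0 \<le> w" by (simp add: w_def)
  have z: "z ^ (2 * k) = w ^ k" "z ^ (2 * k + 2) = w * w ^ k" by (simp_all add: w_def power_mult power2_eq_square)
  have cb: "0 \<le> c * b" using assms by simp
  show ?thesis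
  proof (cases "2 * (c * b) \<le> w")
    case True
    then have "c * b * w ^ k \<le> 1/2 * w * w ^ k" using w by (intro mult_right_mono) auto
    moreover have "0 \<le> (2 * c * b) ^ Suc k" by (intro zero_le_power) (use assms in simp)
    ultimately show ?thesis unfolding z by (simp add: mult_ac)
  next
    case False
    then have wk: "w ^ k \<le> (2 * (c * b)) ^ k" using w by (intro power_mono) auto
    have "c * b * w ^ k \<le> (2 * (c * b)) * (2 * (c * b)) ^ k"
      by (rule mult_mono[OF _ wk]) (use assms w in auto)
    moreover have "0 \<le> w * w ^ k" using w by simp
    ultimately show ?thesis unfolding z by (simp add: mult_ac)
  qed
qed

lemma even_power_tangent:
  fixes x y :: real
  assumes "even n"
  shows "y ^ n + real n * y ^ (n - 1) * (x - y) \<le> x ^ n"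
proof -
  have "((\<lambda>x::real. x ^ n) has_real_derivative real n * y ^ (n - 1)) (at y)" using DERIV_pow[of n y] by simp
  then have "real n * y ^ (n - 1) * (x - y) \<le> x ^ n - y ^ n"
    by (intro convex_on_imp_above_tangent[OF convex_power_even[OF assms]]) auto
  then show ?thesis by simp
qed

text \<open>
  \<open>Z f s + H f (t - s) (B s)\<close> is the conditional expectation of \<open>Z f t\<close> given the past of \<open>s\<close>; the tangent
  inequality for the even power replaces conditional Jensen.
\<close>

lemma conditional_moment_comparison:
  assumes f: "continuous_on UNIV f" "\<And>z. \<bar>f z\<bar> \<le> F"
    and g: "continuous_on UNIV g" "\<And>z. 0 \<le> g z" "\<And>z. g z \<le> F"
    and \<delta>: "0 \<le> \<delta>" "\<And>y. \<bar>H f (t - s) y\<bar> \<le> \<delta>"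
    and s: "0 \<le> s" "s \<le> t" and n: "even n"
  shows "expectation (\<lambda>\<omega>. Z f s \<omega> ^ n * g (B s \<omega>)) \<le> 2 ^ n * (expectation (\<lambda>\<omega>. Z f t \<omega> ^ n * g (B s \<omega>)) + \<delta> ^ n * expectation (\<lambda>\<omega>. g (B s \<omega>)))"
proof -
  have [measurable]: "g \<in> borel_measurable borel" "f \<in> borel_measurable borel"
    using f g by (auto intro: borel_measurable_continuous_onI)
  have gF: "\<bar>g z\<bar> \<le> F" for z using g(2,3)[of z] by auto
  have Fn: "0 \<le> F" using gF[of 0] by linarith
  have t: "0 \<le> t" using s by simp
  have st: "s \<in> {0..t}" "t \<in> {0..t}" using s by auto
  define Y where "Y \<omega> = Z f s \<omega> + H f (t - s) (B s \<omega>)" for \<omega>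
  have [measurable]: "Y \<in> borel_measurable M" unfolding Y_def by measurable
  define S where "S = F * t + \<delta>"
  have S: "0 \<le> S" using Fn t \<delta> by (simp add: S_def)
  have Zb: "\<bar>Z f s \<omega>\<bar> \<le> F * t" "\<bar>Z f t \<omega>\<bar> \<le> F * t" for \<omega>
    using Z_power_bound[OF f st(1), of \<omega> 1] Z_power_bound[OF f st(2), of \<omega> 1] by simp_all
  have Yb: "\<bar>Y \<omega>\<bar> \<le> S" for \<omega> unfolding Y_def S_def using Zb(1)[of \<omega>] \<delta>(2)[of "B s \<omega>"] by linarith
  have Ybn: "\<bar>Y \<omega>\<bar> ^ k \<le> S ^ k" for \<omega> k using Yb by (intro power_mono) auto
  have I1: "integrable M (\<lambda>\<omega>. Z f s \<omega> ^ n * g (B s \<omega>))" "integrable M (\<lambda>\<omega>. Z f t \<omega> ^ n * g (B s \<omega>))"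
    by (rule integrable_bounded[where C="(F * t) ^ n * F"],
        auto simp: abs_mult intro!: mult_mono Z_power_bound[OF f] gF,
        use st Fn t Z_power_bound[OF f] gF in \<open>auto intro!: integrable_bounded[where C="(F * t) ^ n * F"] mult_mono simp: abs_mult\<close>)
  have I2: "integrable M (\<lambda>\<omega>. Y \<omega> ^ n * g (B s \<omega>))"
    by (rule integrable_bounded[where C="S ^ n * F"]) (use Ybn gF S in \<open>auto simp: abs_mult power_abs intro!: mult_mono\<close>)
  have I3: "integrable M (\<lambda>\<omega>. g (B s \<omega>))"
    by (rule integrable_bounded[where C=F]) (use gF in auto)
  have yb: "\<bar>Y \<omega> ^ (n - 1) * g (B s \<omega>)\<bar> \<le> S ^ (n - 1) * F" for \<omega>
    using Ybn[of \<omega> "n - 1"] gF[of "B s \<omega>"] S by (auto simp: abs_mult power_abs intro!: mult_mono)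
  have I4: "integrable M (\<lambda>\<omega>. Y \<omega> ^ (n - 1) * g (B s \<omega>) * (Z f t \<omega> - Z f s \<omega>))"
  proof (rule integrable_bounded[where C="S ^ (n - 1) * F * (2 * (F * t))"])
    fix \<omega>
    have "\<bar>Z f t \<omega> - Z f s \<omega>\<bar> \<le> 2 * (F * t)" using Zb[of \<omega>] by linarith
    then show "\<bar>Y \<omega> ^ (n - 1) * g (B s \<omega>) * (Z f t \<omega> - Z f s \<omega>)\<bar> \<le> S ^ (n - 1) * F * (2 * (F * t))"
      unfolding abs_mult[of "Y \<omega> ^ (n - 1) * g (B s \<omega>)"] using yb S Fn t by (intro mult_mono) auto
  qed measurable
  have I5: "integrable M (\<lambda>\<omega>. Y \<omega> ^ (n - 1) * g (B s \<omega>) * H f (t - s) (B s \<omega>))"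
  proof (rule integrable_bounded[where C="S ^ (n - 1) * F * \<delta>"])
    fix \<omega>
    show "\<bar>Y \<omega> ^ (n - 1) * g (B s \<omega>) * H f (t - s) (B s \<omega>)\<bar> \<le> S ^ (n - 1) * F * \<delta>"
      unfolding abs_mult[of "Y \<omega> ^ (n - 1) * g (B s \<omega>)"] using yb S Fn \<delta> by (intro mult_mono) auto
  qed measurable
  \<comment> \<open>The tangent term has mean zero: given the past of s, the difference of
    \<open>Z f t\<close> and \<open>Y\<close> is centred, and its weight is a function of
    \<open>Z f s\<close> and \<open>B s\<close>.\<close>
  have mk: "expectation (\<lambda>\<omega>. Y \<omega> ^ (n - 1) * g (B s \<omega>) * (Z f t \<omega> - Z f s \<omega>)) = expectation (\<lambda>\<omega>. Y \<omega> ^ (n - 1) * g (B s \<omega>) * H f (t - s) (B s \<omega>))"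
    unfolding Y_def
  proof (rule markov_increment[OF f s, where \<psi>="\<lambda>z y. (z + H f (t - s) y) ^ (n - 1) * g y" and C="S ^ (n - 1) * F" and G=F])
    fix z :: real and y
    assume "\<bar>z\<bar> \<le> F * s"
    moreover have "F * s \<le> F * t" using s Fn by (intro mult_left_mono) auto
    ultimately have "\<bar>z + H f (t - s) y\<bar> \<le> S" unfolding S_def using \<delta>(2)[of y] by linarith
    then show "\<bar>(z + H f (t - s) y) ^ (n - 1) * g y\<bar> \<le> S ^ (n - 1) * F"
      unfolding abs_mult power_abs using gF S by (intro mult_mono power_mono) auto
  qed (use f in \<open>auto intro!: continuous_intros\<close>)
  have "expectation (\<lambda>\<omega>. Y \<omega> ^ n * g (B s \<omega>)) \<le> expectation (\<lambda>\<omega>. Z f t \<omega> ^ n * g (B s \<omega>)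
      - real n * (Y \<omega> ^ (n - 1) * g (B s \<omega>) * (Z f t \<omega> - Z f s \<omega>) - Y \<omega> ^ (n - 1) * g (B s \<omega>) * H f (t - s) (B s \<omega>)))"
  proof (rule integral_mono)
    fix \<omega>
    have "(Y \<omega> ^ n + real n * Y \<omega> ^ (n - 1) * (Z f t \<omega> - Y \<omega>)) * g (B s \<omega>) \<le> Z f t \<omega> ^ n * g (B s \<omega>)"
      by (intro mult_right_mono even_power_tangent n g)
    then show "Y \<omega> ^ n * g (B s \<omega>) \<le> Z f t \<omega> ^ n * g (B s \<omega>)
      - real n * (Y \<omega> ^ (n - 1) * g (B s \<omega>) * (Z f t \<omega> - Z f s \<omega>) - Y \<omega> ^ (n - 1) * g (B s \<omega>) * H f (t - s) (B s \<omega>))"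
      by (simp add: Y_def algebra_simps)
  qed (use I1 I2 I4 I5 in auto)
  also have "\<dots> = expectation (\<lambda>\<omega>. Z f t \<omega> ^ n * g (B s \<omega>))"
    using I1 I4 I5 mk by simp
  finally have cmp: "expectation (\<lambda>\<omega>. Y \<omega> ^ n * g (B s \<omega>)) \<le> expectation (\<lambda>\<omega>. Z f t \<omega> ^ n * g (B s \<omega>))" .
  \<comment> \<open>Back from \<open>Y\<close> to \<open>Z f s\<close>, which differ by at most
    \<delta>, using (p + q)^n <= 2^n (p^n + q^n) for nonnegative p and q.\<close>
  have "expectation (\<lambda>\<omega>. Z f s \<omega> ^ n * g (B s \<omega>)) \<le> expectation (\<lambda>\<omega>. 2 ^ n * (Y \<omega> ^ n * g (B s \<omega>) + \<delta> ^ n * g (B s \<omega>)))"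
  proof (rule integral_mono)
    fix \<omega>
    have "\<bar>Z f s \<omega>\<bar> \<le> \<bar>Y \<omega>\<bar> + \<delta>" unfolding Y_def using \<delta>(2)[of "B s \<omega>"] by linarith
    also have "\<dots> \<le> 2 * max \<bar>Y \<omega>\<bar> \<delta>" by auto
    finally have "\<bar>Z f s \<omega>\<bar> ^ n \<le> (2 * max \<bar>Y \<omega>\<bar> \<delta>) ^ n" by (intro power_mono) auto
    also have "\<dots> = 2 ^ n * max \<bar>Y \<omega>\<bar> \<delta> ^ n" by (simp add: power_mult_distrib)
    also have "max \<bar>Y \<omega>\<bar> \<delta> ^ n \<le> \<bar>Y \<omega>\<bar> ^ n + \<delta> ^ n" using \<delta> by (auto simp: max_def)
    finally have "Z f s \<omega> ^ n \<le> 2 ^ n * (Y \<omega> ^ n + \<delta> ^ n)" using n by (simp add: power_even_abs)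
    then have "Z f s \<omega> ^ n * g (B s \<omega>) \<le> 2 ^ n * (Y \<omega> ^ n + \<delta> ^ n) * g (B s \<omega>)" using g by (intro mult_right_mono) auto
    then show "Z f s \<omega> ^ n * g (B s \<omega>) \<le> 2 ^ n * (Y \<omega> ^ n * g (B s \<omega>) + \<delta> ^ n * g (B s \<omega>))" by (simp add: algebra_simps)
  qed (use I1 I2 I3 in auto)
  also have "\<dots> = 2 ^ n * (expectation (\<lambda>\<omega>. Y \<omega> ^ n * g (B s \<omega>)) + \<delta> ^ n * expectation (\<lambda>\<omega>. g (B s \<omega>)))"
    using I2 I3 by simp
  also have "\<dots> \<le> 2 ^ n * (expectation (\<lambda>\<omega>. Z f t \<omega> ^ n * g (B s \<omega>)) + \<delta> ^ n * expectation (\<lambda>\<omega>. g (B s \<omega>)))"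
    using cmp by simp
  finally show ?thesis .
qed

text \<open>The moment identity offers one small factor, the potential of \<open>f\<close>, and the
  remaining |f| is replaced by \<open>g\<close>. In the integral over s of Z_s^n g(B_s) the
  functional Z_s is then exchanged for Z_t, so that the integral of g(B_s) separates as
  \<open>Z g t\<close>. Young's inequality absorbs half of the top moment and leaves \<delta>^(k+1)
  times the moment of order k + 1 of \<open>Z g t\<close>. Thus two powers of \<open>Z f t\<close>
  yield one factor \<delta> and one factor A.\<close>

lemma even_moment_bound:
  fixes k :: nat
  assumes f: "continuous_on UNIV f" and fg: "\<And>z. \<bar>f z\<bar> \<le> g z"
    and g: "continuous_on UNIV g" "\<And>z. g z \<le> F"
    and \<delta>: "0 \<le> \<delta>" "\<And>u y. 0 \<le> u \<Longrightarrow> u \<le> T \<Longrightarrow> \<bar>H f u y\<bar> \<le> \<delta>"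
    and A: "\<delta> \<le> A" "\<And>u y. 0 \<le> u \<Longrightarrow> u \<le> T \<Longrightarrow> H g u y \<le> A"
    and t: "0 \<le> t" "t \<le> T"
  defines "K \<equiv> real ((2 * k + 2) * (2 * k + 1)) * 2 ^ (2 * k)"
  shows "expectation (\<lambda>\<omega>. Z f t \<omega> ^ (2 * k + 2)) \<le> 2 * ((2 * K) ^ Suc k * fact (Suc k) + K) * (\<delta> * A) ^ Suc k"
proof -
  define n where "n = 2 * k"
  have n: "even n" by (simp add: n_def)
  have [measurable]: "g \<in> borel_measurable borel" "f \<in> borel_measurable borel"
    using f g by (auto intro: borel_measurable_continuous_onI)
  have g0: "0 \<le> g z" for z using fg[of z] by linarith
  have gF: "\<bar>g z\<bar> \<le> F" for z using g(2)[of z] g0[of z] by auto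
  have fF: "\<bar>f z\<bar> \<le> F" for z using fg[of z] g(2)[of z] by linarith
  have Fn: "0 \<le> F" using gF[of 0] by linarith
  have A0: "0 \<le> A" using \<delta> A by linarith
  have K0: "0 \<le> K" by (simp add: K_def)
  have tt: "t \<in> {0..t}" using t by simp
  let ?c = "real ((n + 2) * (n + 1))"
  have pg: "\<bar>Z f s \<omega> ^ n * g (B r \<omega>)\<bar> \<le> (F * t) ^ n * F" if "s \<in> {0..t}" for s r \<omega>
    unfolding abs_mult using Z_power_bound[OF f fF that] gF Fn t by (intro mult_mono) auto
  have pf: "\<bar>Z f s \<omega> ^ n * f (B s \<omega>) * H f (t - s) (B s \<omega>)\<bar> \<le> (F * t) ^ n * F * \<delta>" if "s \<in> {0..t}" for s \<omega>
    unfolding abs_mult using Z_power_bound[OF f fF that] fF Fn t \<delta> that by (intro mult_mono) auto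
  have sg: "set_integrable lborel {0..t} (\<lambda>s. expectation (\<lambda>\<omega>. Z f s \<omega> ^ n * g (B s \<omega>)))"
    "set_integrable lborel {0..t} (\<lambda>s. expectation (\<lambda>\<omega>. Z f t \<omega> ^ n * g (B s \<omega>)))"
    "set_integrable lborel {0..t} (\<lambda>s. expectation (\<lambda>\<omega>. g (B s \<omega>)))"
    by (rule expectation_LBINT_swap(3)[where C="(F * t) ^ n * F"]; use pg tt in simp)
       (rule expectation_LBINT_swap(3)[where C="(F * t) ^ n * F"], use pg[OF tt] in simp_all,
        rule expectation_LBINT_swap(3)[where C=F], use gF in simp_all)
  have "expectation (\<lambda>\<omega>. Z f t \<omega> ^ (n + 2))
      = (LBINT s:{0..t}. ?c * expectation (\<lambda>\<omega>. Z f s \<omega> ^ n * f (B s \<omega>) * H f (t - s) (B s \<omega>)))"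
    by (rule Z_moment_identity(1)[OF f fF t(1)])
  also have "\<dots> \<le> (LBINT s:{0..t}. ?c * (\<delta> * (2 ^ n * (expectation (\<lambda>\<omega>. Z f t \<omega> ^ n * g (B s \<omega>)) + \<delta> ^ n * expectation (\<lambda>\<omega>. g (B s \<omega>))))))"
  proof (rule set_integral_mono)
    show "set_integrable lborel {0..t} (\<lambda>s. ?c * expectation (\<lambda>\<omega>. Z f s \<omega> ^ n * f (B s \<omega>) * H f (t - s) (B s \<omega>)))"
      by (intro set_integrable_mult_right impI expectation_LBINT_swap(3)[where C="(F * t) ^ n * F * \<delta>"]) (use pf in auto)
    show "set_integrable lborel {0..t} (\<lambda>s. ?c * (\<delta> * (2 ^ n * (expectation (\<lambda>\<omega>. Z f t \<omega> ^ n * g (B s \<omega>)) + \<delta> ^ n * expectation (\<lambda>\<omega>. g (B s \<omega>))))))"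
      by (intro set_integrable_mult_right impI set_integral_add(1) sg)
    fix s assume s: "s \<in> {0..t}"
    have "expectation (\<lambda>\<omega>. Z f s \<omega> ^ n * f (B s \<omega>) * H f (t - s) (B s \<omega>)) \<le> expectation (\<lambda>\<omega>. \<delta> * (Z f s \<omega> ^ n * g (B s \<omega>)))"
    proof (rule integral_mono)
      show "integrable M (\<lambda>\<omega>. Z f s \<omega> ^ n * f (B s \<omega>) * H f (t - s) (B s \<omega>))"
        by (rule integrable_bounded[where C="(F * t) ^ n * F * \<delta>"]) (use pf[OF s] in auto)
      show "integrable M (\<lambda>\<omega>. \<delta> * (Z f s \<omega> ^ n * g (B s \<omega>)))"
        by (intro integrable_mult_right impI integrable_bounded[where C="(F * t) ^ n * F"]) (use pg[OF s] in auto)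
      fix \<omega>
      have z: "0 \<le> Z f s \<omega> ^ n" using n by (simp add: zero_le_even_power)
      have "f (B s \<omega>) * H f (t - s) (B s \<omega>) \<le> \<bar>f (B s \<omega>)\<bar> * \<bar>H f (t - s) (B s \<omega>)\<bar>" by (metis abs_ge_self abs_mult)
      also have "\<dots> \<le> g (B s \<omega>) * \<delta>" using fg \<delta> s t g0 by (intro mult_mono) auto
      finally have "Z f s \<omega> ^ n * (f (B s \<omega>) * H f (t - s) (B s \<omega>)) \<le> Z f s \<omega> ^ n * (g (B s \<omega>) * \<delta>)" using z by (intro mult_left_mono)
      then show "Z f s \<omega> ^ n * f (B s \<omega>) * H f (t - s) (B s \<omega>) \<le> \<delta> * (Z f s \<omega> ^ n * g (B s \<omega>))" by (simp add: mult_ac)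
    qed
    also have "\<dots> = \<delta> * expectation (\<lambda>\<omega>. Z f s \<omega> ^ n * g (B s \<omega>))" by simp
    also have "\<dots> \<le> \<delta> * (2 ^ n * (expectation (\<lambda>\<omega>. Z f t \<omega> ^ n * g (B s \<omega>)) + \<delta> ^ n * expectation (\<lambda>\<omega>. g (B s \<omega>))))"
      by (intro mult_left_mono conditional_moment_comparison[OF f fF g(1) g0 g(2) \<delta>(1) \<delta>(2)]) (use s t n \<delta> in auto)
    finally show "?c * expectation (\<lambda>\<omega>. Z f s \<omega> ^ n * f (B s \<omega>) * H f (t - s) (B s \<omega>)) \<le>
        ?c * (\<delta> * (2 ^ n * (expectation (\<lambda>\<omega>. Z f t \<omega> ^ n * g (B s \<omega>)) + \<delta> ^ n * expectation (\<lambda>\<omega>. g (B s \<omega>)))))"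
      by (intro mult_left_mono) auto
  qed
  also have "\<dots> = ?c * (\<delta> * (2 ^ n * ((LBINT s:{0..t}. expectation (\<lambda>\<omega>. Z f t \<omega> ^ n * g (B s \<omega>))) + \<delta> ^ n * (LBINT s:{0..t}. expectation (\<lambda>\<omega>. g (B s \<omega>))))))"
    using set_integral_add(2)[OF sg(2) set_integrable_mult_right[where a="\<delta> ^ n", OF sg(3)]] by simp
  also have "(LBINT s:{0..t}. expectation (\<lambda>\<omega>. Z f t \<omega> ^ n * g (B s \<omega>))) = expectation (\<lambda>\<omega>. Z f t \<omega> ^ n * Z g t \<omega>)"
    by (subst expectation_LBINT_swap(1)[symmetric, where C="(F * t) ^ n * F"]) (use pg[OF tt] in \<open>auto simp: Z_def[of g]\<close>)
  also have "(LBINT s:{0..t}. expectation (\<lambda>\<omega>. g (B s \<omega>))) = expectation (\<lambda>\<omega>. Z g t \<omega>)"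
    by (subst expectation_LBINT_swap(1)[symmetric, where C=F]) (use gF in \<open>auto simp: Z_def[of g, abs_def]\<close>)
  finally have main: "expectation (\<lambda>\<omega>. Z f t \<omega> ^ (n + 2)) \<le> K * \<delta> * expectation (\<lambda>\<omega>. Z f t \<omega> ^ n * Z g t \<omega>) + K * \<delta> * (\<delta> ^ n * expectation (\<lambda>\<omega>. Z g t \<omega>))"
    by (simp add: K_def n_def algebra_simps)
  have Zg: "0 \<le> Z g t \<omega>" "\<bar>Z g t \<omega>\<bar> \<le> F * t" for \<omega>
    using Z_nonneg[OF g0] Z_bound[OF g(1) gF t(1)] by auto
  have iZ: "integrable M (\<lambda>\<omega>. Z f t \<omega> ^ j)" for j
    by (rule integrable_bounded[where C="(F * t) ^ j"]) (use Z_power_bound[OF f fF tt] in auto)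
  have iA: "integrable M (\<lambda>\<omega>. Z g t \<omega> ^ j)" for j
    by (rule integrable_bounded[where C="(F * t) ^ j"]) (use Z_power_bound[OF g(1) gF tt] in auto)
  have iZA: "integrable M (\<lambda>\<omega>. Z f t \<omega> ^ n * Z g t \<omega>)"
    by (rule integrable_bounded[where C="(F * t) ^ n * (F * t)"])
       (use Z_power_bound[OF f fF tt] Zg Fn t in \<open>auto simp: abs_mult intro!: mult_mono\<close>)
  have "K * \<delta> * expectation (\<lambda>\<omega>. Z f t \<omega> ^ n * Z g t \<omega>) = expectation (\<lambda>\<omega>. K * \<delta> * (Z f t \<omega> ^ n * Z g t \<omega>))" by simp
  also have "\<dots> \<le> expectation (\<lambda>\<omega>. 1/2 * Z f t \<omega> ^ (n + 2) + (2 * K * \<delta>) ^ Suc k * Z g t \<omega> ^ Suc k)"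
  proof (rule integral_mono)
    fix \<omega>
    show "K * \<delta> * (Z f t \<omega> ^ n * Z g t \<omega>) \<le> 1/2 * Z f t \<omega> ^ (n + 2) + (2 * K * \<delta>) ^ Suc k * Z g t \<omega> ^ Suc k"
    proof -
      have "(2 * (K * \<delta>) * Z g t \<omega>) ^ Suc k = (2 * K * \<delta>) ^ Suc k * Z g t \<omega> ^ Suc k"
        by (simp only: power_mult_distrib[symmetric] mult.assoc)
      then show ?thesis
        using young_even_power[of "Z g t \<omega>" "K * \<delta>" "Z f t \<omega>" k] Zg K0 \<delta>
        unfolding n_def by (metis mult_nonneg_nonneg)
    qed
  qed (intro Bochner_Integration.integrable_add integrable_mult_right impI iZ iA iZA)+
  also have "\<dots> = 1/2 * expectation (\<lambda>\<omega>. Z f t \<omega> ^ (n + 2)) + (2 * K * \<delta>) ^ Suc k * expectation (\<lambda>\<omega>. Z g t \<omega> ^ Suc k)"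
    by (subst Bochner_Integration.integral_add, (intro integrable_mult_right impI iZ iA)+, simp only: integral_mult_right_zero)
  also have "\<dots> \<le> 1/2 * expectation (\<lambda>\<omega>. Z f t \<omega> ^ (n + 2)) + (2 * K * \<delta>) ^ Suc k * (fact (Suc k) * A ^ Suc k)"
    using positive_moment_bound[OF g(1) g0 g(2) A0 A(2) t, of "Suc k"] K0 \<delta>
    by (intro add_left_mono mult_left_mono) auto
  finally have 1: "K * \<delta> * expectation (\<lambda>\<omega>. Z f t \<omega> ^ n * Z g t \<omega>) \<le> 1/2 * expectation (\<lambda>\<omega>. Z f t \<omega> ^ (n + 2)) + (2 * K * \<delta>) ^ Suc k * (fact (Suc k) * A ^ Suc k)" .
  \<comment> \<open>The comparison error carries \<delta>^(2k+1); as \<delta> <= A, k of these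
    factors are traded for A.\<close>
  have 2: "K * \<delta> * (\<delta> ^ n * expectation (\<lambda>\<omega>. Z g t \<omega>)) \<le> K * (\<delta> * A) ^ Suc k"
  proof -
    have "\<delta> ^ n * expectation (\<lambda>\<omega>. Z g t \<omega>) \<le> \<delta> ^ n * A"
      using positive_moment_bound[OF g(1) g0 g(2) A0 A(2) t, of 1] \<delta> by (intro mult_left_mono) auto
    also have "\<dots> = \<delta> ^ k * \<delta> ^ k * A" by (simp add: n_def mult_2 power_add)
    also have "\<dots> \<le> \<delta> ^ k * A ^ k * A" using \<delta> A A0 by (intro mult_right_mono mult_left_mono power_mono) auto
    finally have "K * \<delta> * (\<delta> ^ n * expectation (\<lambda>\<omega>. Z g t \<omega>)) \<le> K * \<delta> * (\<delta> ^ k * A ^ k * A)"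
      using K0 \<delta> by (intro mult_left_mono) auto
    then show ?thesis by (simp add: power_mult_distrib mult_ac)
  qed
  have "expectation (\<lambda>\<omega>. Z f t \<omega> ^ (n + 2)) \<le> 2 * ((2 * K * \<delta>) ^ Suc k * (fact (Suc k) * A ^ Suc k) + K * (\<delta> * A) ^ Suc k)"
  proof -
    have "x \<le> 2 * (p + q)" if "x \<le> u + v" "u \<le> 1/2 * x + p" "v \<le> q" for x u v p q :: real
      using that by (simp add: field_simps)
    from this[OF main 1 2] show ?thesis .
  qed
  also have "\<dots> = 2 * ((2 * K) ^ Suc k * fact (Suc k) + K) * (\<delta> * A) ^ Suc k"
    by (simp add: power_mult_distrib distrib_left distrib_right mult_ac)
  finally show ?thesis by (simp add: n_def)
qed

end

section \<open>Uniform increments of the smoothed local times\<close>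

text \<open>With D = 1 + v^m, every power v^j with j <= m is at most D. Hence the numerator of the
  derivative is at most (m + 2 m) D^3, while the denominator is D^4.\<close>

lemma circ_profile_lipschitz:
  fixes v w :: real
  assumes m: "2 \<le> m" and v: "0 \<le> v" "0 \<le> w"
  shows "\<bar>v ^ (m - 1) / (1 + v ^ m)\<^sup>2 - w ^ (m - 1) / (1 + w ^ m)\<^sup>2\<bar> \<le> 3 * real m * \<bar>v - w\<bar>"
proof -
  define D where "D = (\<lambda>v::real. 1 + v ^ m)"
  have Dp: "1 \<le> D v" if "0 \<le> v" for v using that by (simp add: D_def)
  have pb: "v ^ j \<le> D v" if "0 \<le> v" "j \<le> m" for v j
  proof (cases "v \<le> 1")
    case True
    then have "v ^ j \<le> 1" using that by (simp add: power_le_one)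
    then show ?thesis using Dp[OF that(1)] by linarith
  next
    case False
    then have "v ^ j \<le> v ^ m" using that by (intro power_increasing) auto
    then show ?thesis by (simp add: D_def)
  qed
  have dpow: "((\<lambda>R::real. R ^ n) has_real_derivative real n * R ^ (n - 1)) (at R within S)" for n R S
    using DERIV_pow[of n R] by (simp add: has_field_derivative_at_within)
  define Q' where "Q' v = (real (m - 1) * v ^ (m - 2) * (D v)\<^sup>2 - v ^ (m - 1) * (2 * D v * (real m * v ^ (m - 1)))) / ((D v)\<^sup>2 * (D v)\<^sup>2)" for v
  have der: "((\<lambda>v. v ^ (m - 1) / (1 + v ^ m)\<^sup>2) has_real_derivative Q' v) (at v within {0..})" if "v \<in> {0..}" for v
  proof -
    have "0 < 1 + v ^ m" using that by (intro add_pos_nonneg) auto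
    then have n: "(1 + v ^ m)\<^sup>2 \<noteq> 0" by simp
    have "((\<lambda>v. 1 + v ^ m) has_real_derivative real m * v ^ (m - 1)) (at v within {0..})"
      using DERIV_add[OF DERIV_const dpow] by simp
    from DERIV_divide[OF dpow DERIV_power[OF this, of 2] n] show ?thesis
      by (rule DERIV_cong) (simp add: Q'_def D_def diff_diff_left numeral_2_eq_2)
  qed
  have bd: "norm (Q' v) \<le> 3 * real m" if "v \<in> {0..}" for v
  proof -
    have v0: "0 \<le> v" using that by simp
    let ?D = "D v"
    have D1: "1 \<le> ?D" by (rule Dp[OF v0])
    have "norm (real (m - 1) * v ^ (m - 2) * ?D\<^sup>2 - v ^ (m - 1) * (2 * ?D * (real m * v ^ (m - 1))))
       \<le> real (m - 1) * v ^ (m - 2) * ?D\<^sup>2 + v ^ (m - 1) * (2 * ?D * (real m * v ^ (m - 1)))"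
      using v0 D1 by (intro order_trans[OF norm_triangle_ineq4]) simp
    also have "\<dots> \<le> real m * ?D * ?D\<^sup>2 + ?D * (2 * ?D * (real m * ?D))"
      using v0 D1 pb[OF v0] by (intro add_mono mult_mono) (auto intro!: mult_nonneg_nonneg)
    also have "\<dots> = 3 * real m * (?D * ?D\<^sup>2)" by (simp add: power2_eq_square algebra_simps)
    also have "\<dots> \<le> 3 * real m * (?D\<^sup>2 * ?D\<^sup>2)"
      using D1 by (intro mult_left_mono mult_right_mono) (auto simp: power2_eq_square)
    finally have "norm (real (m - 1) * v ^ (m - 2) * ?D\<^sup>2 - v ^ (m - 1) * (2 * ?D * (real m * v ^ (m - 1)))) \<le> 3 * real m * (?D\<^sup>2 * ?D\<^sup>2)" .
    moreover have "0 < ?D\<^sup>2 * ?D\<^sup>2" using D1 by simp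
    ultimately show ?thesis unfolding Q'_def norm_divide by (simp add: pos_divide_le_eq)
  qed
  have "norm (v ^ (m - 1) / (1 + v ^ m)\<^sup>2 - w ^ (m - 1) / (1 + w ^ m)\<^sup>2) \<le> 3 * real m * norm (v - w)"
    by (rule field_differentiable_bound[of "{0..}", OF _ der bd]) (use v in auto)
  then show ?thesis by simp
qed

text \<open>With e = 2^n and 1 / a <= e the losses multiply: e^2 from the prefactor 2 e / a, e from
  the slope of the profile and e^4 from v = |z - x|^2 / a^2, hence 2^(7n). Any power would do,
  provided that the nets are finer; their mesh is 2^(-8n).\<close>

lemma circ_lipschitz:
  fixes x x' z :: "real^2"
  assumes n: "1 \<le> n" and a: "1 / 2 ^ n \<le> a" "a \<le> K" "1 / 2 ^ n \<le> a'" "a' \<le> K"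
    and x: "norm x \<le> K" "norm x' \<le> K" and z: "norm z \<le> L"
  shows "\<bar>circ (2 ^ n) x a z - circ (2 ^ n) x' a' z\<bar> \<le> (2 + 6 * (2 * (L + K) + 2 * K * (L + K)\<^sup>2)) * 2 ^ (7 * n) * dist (x, a) (x', a')"
proof -
  define e :: real where "e = 2 ^ n"
  have e1: "1 \<le> e" by (simp add: e_def)
  have e0: "0 < e" using e1 by simp
  have a0: "0 < a" "0 < a'" using a by (auto intro: less_le_trans[rotated])
  have ia: "1 / a \<le> e" "1 / a' \<le> e" using a a0 by (auto simp: e_def field_simps)
  define d where "d = dist (x, a) (x', a')"
  have da: "\<bar>a - a'\<bar> \<le> d" using dist_snd_le[of "(x,a)" "(x',a')"] by (simp add: d_def dist_real_def)
  have dx: "norm (x - x') \<le> d" using dist_fst_le[of "(x,a)" "(x',a')"] by (simp add: d_def dist_norm)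
  have d0: "0 \<le> d" by (simp add: d_def)
  define W where "W = 2 * (L + K) + 2 * K * (L + K)\<^sup>2"
  have K0: "0 \<le> K" "0 \<le> L" using norm_ge_zero[of x] x norm_ge_zero[of z] z by linarith+
  have W0: "0 \<le> W" using K0 by (simp add: W_def)
  define \<rho> where "\<rho> = norm (z - x)"
  define \<rho>' where "\<rho>' = norm (z - x')"
  have \<rho>b: "0 \<le> \<rho>" "0 \<le> \<rho>'" "\<rho> \<le> L + K" "\<rho>' \<le> L + K"
    using norm_triangle_ineq4[of z x] norm_triangle_ineq4[of z x'] x z by (auto simp: \<rho>_def \<rho>'_def)
  have \<rho>d: "\<bar>\<rho> - \<rho>'\<bar> \<le> d"
    using norm_triangle_ineq3[of "z - x" "z - x'"] dx by (simp add: \<rho>_def \<rho>'_def norm_minus_commute)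
  define v where "v = \<rho>\<^sup>2 / a\<^sup>2"
  define v' where "v' = \<rho>'\<^sup>2 / a'\<^sup>2"
  define q where "q v = v ^ (2 ^ n - 1) / (1 + v ^ (2 ^ n))\<^sup>2" for v :: real
  have m2: "2 \<le> (2::nat) ^ n" using n by (metis one_le_numeral power_increasing power_one_right)
  have c: "circ (2 ^ n) x a z = 2 * e / a * q v" "circ (2 ^ n) x' a' z = 2 * e / a' * q v'"
    unfolding q_def v_def v'_def \<rho>_def \<rho>'_def e_def using circ_scaled[OF a0(1) m2] circ_scaled[OF a0(2) m2] by simp_all
  have vv: "0 \<le> v" "0 \<le> v'" by (simp_all add: v_def v'_def)
  have q1: "\<bar>q v\<bar> \<le> 1" 
  proof -
    have "2 * e / a * \<bar>q v\<bar> \<le> 2 * e / a * 1"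
      using circ_abs_bound[OF less_imp_le[OF a0(1)] m2, of x z] a0 e0 unfolding c by (simp add: abs_mult e_def)
    then show ?thesis using a0 e0 by (simp add: field_simps)
  qed
  have inv2: "\<bar>1 / a\<^sup>2 - 1 / a'\<^sup>2\<bar> \<le> 2 * K * e ^ 4 * d"
  proof -
    have "1 / a\<^sup>2 - 1 / a'\<^sup>2 = (a' - a) * (a' + a) * (1 / a * (1 / a)) * (1 / a' * (1 / a'))"
      using a0 by (simp add: field_simps power2_eq_square)
    also have "\<bar>\<dots>\<bar> = \<bar>a' - a\<bar> * (a' + a) * (1 / a * (1 / a)) * (1 / a' * (1 / a'))"
      using a0 by (simp add: abs_mult)
    also have "\<dots> \<le> d * (2 * K) * (e * e) * (e * e)"
      using da a a0 ia e0 K0 d0 by (intro mult_mono) (auto simp: abs_minus_commute)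
    finally show ?thesis by (simp add: power4_eq_xxxx mult_ac)
  qed
  have vd: "\<bar>v - v'\<bar> \<le> W * e ^ 4 * d"
  proof -
    have "v - v' = (\<rho> - \<rho>') * (\<rho> + \<rho>') * (1 / a * (1 / a)) + \<rho>'\<^sup>2 * (1 / a\<^sup>2 - 1 / a'\<^sup>2)"
      by (simp add: v_def v'_def power2_eq_square algebra_simps add_divide_distrib diff_divide_distrib)
    then have "\<bar>v - v'\<bar> \<le> \<bar>(\<rho> - \<rho>') * (\<rho> + \<rho>') * (1 / a * (1 / a))\<bar> + \<bar>\<rho>'\<^sup>2 * (1 / a\<^sup>2 - 1 / a'\<^sup>2)\<bar>"
      by (simp only: abs_triangle_ineq)
    also have "\<bar>(\<rho> - \<rho>') * (\<rho> + \<rho>') * (1 / a * (1 / a))\<bar> = \<bar>\<rho> - \<rho>'\<bar> * (\<rho> + \<rho>') * (1 / a * (1 / a))"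
      using a0 \<rho>b by (simp add: abs_mult)
    also have "\<dots> \<le> d * (2 * (L + K)) * (e * e)"
      using \<rho>d \<rho>b ia a0 e0 d0 K0 by (intro mult_mono) auto
    also have "\<dots> \<le> d * (2 * (L + K)) * e ^ 4"
      using d0 K0 e1 by (intro mult_left_mono) (auto simp: power4_eq_xxxx intro: order_trans[OF _ mult_right_mono[of 1 "e * e"]] simp: mult_ge1_I)
    also have "\<bar>\<rho>'\<^sup>2 * (1 / a\<^sup>2 - 1 / a'\<^sup>2)\<bar> \<le> (L + K)\<^sup>2 * (2 * K * e ^ 4 * d)"
      unfolding abs_mult using \<rho>b inv2 K0 by (intro mult_mono) (auto intro: power_mono)
    finally show ?thesis by (simp add: W_def algebra_simps)
  qed
  have qd: "\<bar>q v - q v'\<bar> \<le> 3 * e * (W * e ^ 4 * d)"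
  proof -
    have "\<bar>q v - q v'\<bar> \<le> 3 * e * \<bar>v - v'\<bar>"
      using circ_profile_lipschitz[OF m2 vv] by (simp add: q_def e_def)
    also have "\<dots> \<le> 3 * e * (W * e ^ 4 * d)" using vd e0 by (intro mult_left_mono) auto
    finally show ?thesis .
  qed
  have "circ (2 ^ n) x a z - circ (2 ^ n) x' a' z = 2 * e * (a' - a) * (1 / a) * (1 / a') * q v + 2 * e * (1 / a') * (q v - q v')"
    unfolding c using a0 by (simp add: field_simps)
  also have "\<bar>\<dots>\<bar> \<le> \<bar>2 * e * (a' - a) * (1 / a) * (1 / a') * q v\<bar> + \<bar>2 * e * (1 / a') * (q v - q v')\<bar>" by (rule abs_triangle_ineq)
  also have "\<dots> = 2 * e * \<bar>a' - a\<bar> * (1 / a) * (1 / a') * \<bar>q v\<bar> + 2 * e * (1 / a') * \<bar>q v - q v'\<bar>"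
    using a0 e0 by (simp add: abs_mult)
  also have "\<dots> \<le> 2 * e * d * e * e * 1 + 2 * e * e * (3 * e * (W * e ^ 4 * d))"
    using da ia q1 qd a0 e0 d0 by (intro add_mono mult_mono) (auto simp: abs_minus_commute)
  also have "\<dots> = 2 * e ^ 3 * d + 6 * W * e ^ 7 * d" by (simp add: eval_nat_numeral)
  also have "\<dots> \<le> 2 * e ^ 7 * d + 6 * W * e ^ 7 * d"
    using e1 d0 by (intro add_right_mono mult_right_mono mult_left_mono power_increasing) auto
  also have "\<dots> = (2 + 6 * W) * e ^ 7 * d" by (simp add: algebra_simps)
  also have "e ^ 7 = 2 ^ (7 * n)" by (simp add: e_def power_mult[symmetric] mult.commute)
  finally show ?thesis by (simp add: W_def d_def)
qed

text \<open>Space is cut into cubes of side \<eta> divided by the dimension, and one point of S is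
  picked from each cube that meets S. The points come from S itself because the moment bounds are
  applied at net points.\<close>

lemma finite_net:
  fixes S :: "'a::euclidean_space set"
  assumes S: "S \<subseteq> cball 0 R" and R: "0 \<le> R" and \<eta>: "0 < \<eta>" "\<eta> \<le> 1"
  obtains N where "finite N" "N \<subseteq> S" "\<And>p. p \<in> S \<Longrightarrow> \<exists>u\<in>N. dist p u \<le> \<eta>"
    "real (card N) \<le> ((2 * R * DIM('a) + 5) / \<eta>) ^ DIM('a)"
proof -
  define d where "d = real DIM('a)"
  have d1: "1 \<le> d" by (simp add: d_def Suc_leI)
  define h where "h = \<eta> / d"
  have h: "0 < h" using \<eta> d1 by (simp add: h_def)
  define c where "c p = restrict (\<lambda>b. \<lfloor>(p \<bullet> b) / h\<rfloor>) Basis" for p :: 'a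
  define L where "L = \<lfloor>R / h\<rfloor> + 1"
  have L: "0 \<le> L" using R h by (simp add: L_def)
  have cS: "c ` S \<subseteq> Basis \<rightarrow>\<^sub>E {-L..L}"
  proof (clarsimp simp: c_def)
    fix p b :: 'a assume p: "p \<in> S" and b: "b \<in> Basis"
    have "\<bar>p \<bullet> b\<bar> \<le> R" using Basis_le_norm[OF b, of p] p S by auto
    then have "\<bar>p \<bullet> b / h\<bar> \<le> R / h" using h by (simp add: divide_right_mono)
    then have "- (R / h) \<le> p \<bullet> b / h" "p \<bullet> b / h \<le> R / h" by linarith+
    then show "- L \<le> \<lfloor>p \<bullet> b / h\<rfloor> \<and> \<lfloor>p \<bullet> b / h\<rfloor> \<le> L" unfolding L_def by linarith
  qed
  have fin: "finite (Basis \<rightarrow>\<^sub>E {-L..L})" by (intro finite_PiE) auto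
  define r where "r k = (SOME p. p \<in> S \<and> c p = k)" for k
  have r: "r (c p) \<in> S \<and> c (r (c p)) = c p" if "p \<in> S" for p
    unfolding r_def by (rule someI[of _ p]) (use that in simp)
  define N where "N = r ` (c ` S)"
  have fcS: "finite (c ` S)" by (rule finite_subset[OF cS fin])
  have "finite N" using fcS by (simp add: N_def)
  moreover have "N \<subseteq> S" using r by (auto simp: N_def)
  moreover have "\<exists>u\<in>N. dist p u \<le> \<eta>" if p: "p \<in> S" for p
  proof (intro bexI)
    let ?u = "r (c p)"
    have co: "\<bar>(p - ?u) \<bullet> b\<bar> \<le> h" if b: "b \<in> Basis" for b
    proof -
      have "\<lfloor>(p \<bullet> b) / h\<rfloor> = \<lfloor>(?u \<bullet> b) / h\<rfloor>" using r[OF p] b by (metis c_def restrict_apply')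
      then have "\<bar>(p \<bullet> b) / h - (?u \<bullet> b) / h\<bar> \<le> 1" by linarith
      then show ?thesis using h by (simp add: inner_diff_left diff_divide_distrib[symmetric] abs_divide pos_divide_le_eq)
    qed
    have "dist p ?u \<le> (\<Sum>b\<in>Basis. \<bar>(p - ?u) \<bullet> b\<bar>)" unfolding dist_norm by (rule norm_le_l1)
    also have "\<dots> \<le> (\<Sum>b\<in>(Basis::'a set). h)" by (intro sum_mono co)
    also have "\<dots> = \<eta>" using d1 by (simp add: h_def d_def)
    finally show "dist p ?u \<le> \<eta>" .
    show "?u \<in> N" using p by (auto simp: N_def)
  qed
  moreover have "real (card N) \<le> ((2 * R * DIM('a) + 5) / \<eta>) ^ DIM('a)"
  proof -
    have "card N \<le> card (c ` S)" unfolding N_def by (rule card_image_le[OF fcS])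
    also have "\<dots> \<le> card (Basis \<rightarrow>\<^sub>E {-L..L} :: ('a \<Rightarrow> int) set)" by (rule card_mono[OF fin cS])
    also have "\<dots> = nat (2 * L + 1) ^ DIM('a)" by (subst card_PiE) (auto simp: algebra_simps)
    finally have "real (card N) \<le> real (nat (2 * L + 1)) ^ DIM('a)"
      by (metis of_nat_le_iff of_nat_power)
    also have "\<dots> \<le> ((2 * R * DIM('a) + 5) / \<eta>) ^ DIM('a)"
    proof (intro power_mono)
      have "real (nat (2 * L + 1)) = 2 * real_of_int L + 1" using L by simp
      also have "\<dots> \<le> 2 * (R / h) + 3"
      proof -
        have "2 * real_of_int (\<lfloor>y\<rfloor> + 1) + 1 \<le> 2 * y + 3" for y :: real using of_int_floor_le[of y] by simp
        then show ?thesis unfolding L_def .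
      qed
      also have "R / h = R * d / \<eta>" by (simp add: h_def)
      also have "2 * (R * d / \<eta>) + 3 \<le> (2 * R * d + 5) / \<eta>"
        using \<eta> by (simp add: field_simps)
      finally show "real (nat (2 * L + 1)) \<le> (2 * R * DIM('a) + 5) / \<eta>" by (simp add: d_def)
    qed simp
    finally show ?thesis .
  qed
  ultimately show ?thesis using that by blast
qed

text \<open>Summable means make the series of the \<open>Y n\<close> almost surely finite, and its
  sum bounds every term. This yields a random constant valid from the first index on, rather than
  eventual bounds.\<close>

lemma (in prob_space) AE_bounded_of_summable:
  fixes Y :: "nat \<Rightarrow> 'a \<Rightarrow> real"
  assumes int: "\<And>n. integrable M (Y n)" and nn: "\<And>n \<omega>. 0 \<le> Y n \<omega>"
    and le: "\<And>n. expectation (Y n) \<le> c n" and sm: "summable c"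
  shows "AE \<omega> in M. \<exists>C. \<forall>n. Y n \<omega> \<le> C"
proof -
  have [measurable]: "Y n \<in> borel_measurable M" for n using int by auto
  have c0: "0 \<le> c n" for n using order_trans[OF integral_nonneg_AE le[of n]] nn by auto
  have "(\<integral>\<^sup>+\<omega>. (\<Sum>n. ennreal (Y n \<omega>)) \<partial>M) = (\<Sum>n. \<integral>\<^sup>+\<omega>. ennreal (Y n \<omega>) \<partial>M)"
    by (rule nn_integral_suminf) auto
  also have "\<dots> = (\<Sum>n. ennreal (expectation (Y n)))"
    using int nn by (simp add: nn_integral_eq_integral)
  also have "\<dots> \<le> (\<Sum>n. ennreal (c n))" using le by (intro suminf_le) (auto intro: ennreal_leI)
  also have "\<dots> < \<infinity>" using suminf_ennreal2[OF c0 sm] by (simp add: less_top)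
  finally have "AE \<omega> in M. (\<Sum>n. ennreal (Y n \<omega>)) \<noteq> \<infinity>"
    by (intro nn_integral_PInf_AE) auto
  then show ?thesis
  proof eventually_elim
    case (elim \<omega>)
    then obtain C where C: "0 \<le> C" "(\<Sum>n. ennreal (Y n \<omega>)) = ennreal C" by (metis ennreal_cases infinity_ennreal_def)
    have "Y n \<omega> \<le> C" for n
    proof -
      have "ennreal (Y n \<omega>) \<le> (\<Sum>n. ennreal (Y n \<omega>))" using sum_le_suminf[of "\<lambda>n. ennreal (Y n \<omega>)" "{n}"] by simp
      then show ?thesis using C by (simp add: ennreal_le_iff)
    qed
    then show ?case by blast
  qed
qed

section \<open>Moments of profile differences and almost sure bounds over nets\<close>

context continuous_bm
begin

text \<open>Here \<open>even_moment_bound\<close> is applied with the difference of two profiles as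
  \<open>f\<close> and their sum as \<open>g\<close>: the potential of the difference is small, that
  of the sum merely bounded.\<close>

lemma circ_moment_bound:
  assumes K: "1 \<le> K" and T: "0 \<le> T"
  obtains C where "C \<ge> 0" "\<And>(x::real^2) x' a a' m m' t. norm x \<le> K \<Longrightarrow> norm x' \<le> K \<Longrightarrow> 0 \<le> a \<Longrightarrow> a \<le> K \<Longrightarrow> 0 \<le> a' \<Longrightarrow> a' \<le> K \<Longrightarrow>
      2 \<le> m \<Longrightarrow> even m \<Longrightarrow> 2 \<le> m' \<Longrightarrow> even m' \<Longrightarrow> 0 \<le> t \<Longrightarrow> t \<le> T \<Longrightarrow>
      expectation (\<lambda>\<omega>. (Z (circ m x a) t \<omega> - Z (circ m' x' a') t \<omega>) ^ (2 * k + 2))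
        \<le> C * (dist (x, a) (x', a') powr (3/4) + 1 / real m + 1 / real m') ^ Suc k"
proof -
  obtain C0 where C0: "C0 \<ge> 0"
    "\<And>(x::real^2) x' a a' m m' y u. norm x \<le> K \<Longrightarrow> norm x' \<le> K \<Longrightarrow> 0 \<le> a \<Longrightarrow> a \<le> K \<Longrightarrow> 0 \<le> a' \<Longrightarrow> a' \<le> K \<Longrightarrow>
      2 \<le> m \<Longrightarrow> even m \<Longrightarrow> 2 \<le> m' \<Longrightarrow> even m' \<Longrightarrow> 0 \<le> u \<Longrightarrow> u \<le> T \<Longrightarrow>
      \<bar>LBINT w:{0..u}. heat w (\<lambda>z. circ m x a z - circ m' x' a' z) y\<bar>
        \<le> C0 * (dist (x, a) (x', a') powr (3/4) + 1 / real m + 1 / real m')"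
    using circ_potential_bound[OF K T] by blast
  define J where "J = real ((2 * k + 2) * (2 * k + 1)) * 2 ^ (2 * k)"
  define A where "A = 2 * C0 * ((4 * K) powr (3/4) + 1)"
  define C where "C = 2 * ((2 * J) ^ Suc k * fact (Suc k) + J) * (C0 * A) ^ Suc k"
  have J: "0 \<le> J" by (simp add: J_def)
  have A: "0 \<le> A" using C0 by (simp add: A_def add_nonneg_nonneg)
  have "expectation (\<lambda>\<omega>. (Z (circ m x a) t \<omega> - Z (circ m' x' a') t \<omega>) ^ (2 * k + 2))
        \<le> C * (dist (x, a) (x', a') powr (3/4) + 1 / real m + 1 / real m') ^ Suc k"
    if x: "norm x \<le> K" "norm x' \<le> K" and a: "0 \<le> a" "a \<le> K" "0 \<le> a'" "a' \<le> K"
      and m: "2 \<le> m" "even m" "2 \<le> m'" "even m'" and t: "0 \<le> t" "t \<le> T" for x x' a a' m m' t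
  proof -
    define D where "D = dist (x, a) (x', a') powr (3/4) + 1 / real m + 1 / real m'"
    define f where "f z = circ m x a z - circ m' x' a' z" for z
    define g where "g z = circ m x a z + circ m' x' a' z" for z
    have c: "continuous_on UNIV (circ m x a)" "continuous_on UNIV (circ m' x' a')"
      using a by (auto intro: circ_continuous)
    have fc: "continuous_on UNIV f" "continuous_on UNIV g"
      unfolding f_def g_def using c by (auto intro!: continuous_intros)
    have im: "1 / real m \<le> 1/2" "1 / real m' \<le> 1/2" using m by (auto simp: field_simps)
    \<comment> \<open>A single profile is compared with the zero profile of radius 0, taken with
      exponent 2, so that the smoothing errors add up to at most 1.\<close>
    have single: "H (circ m x a) u y \<le> C0 * ((4 * K) powr (3/4) + 1)"
      if "norm x \<le> K" "0 \<le> a" "a \<le> K" "2 \<le> m" "even m" "0 \<le> u" "u \<le> T" for m x a u y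
    proof -
      have "H (circ m x a) u y \<le> C0 * (dist (x, a) (x, 0) powr (3/4) + 1 / real m + 1 / real 2)"
        using C0(2)[of x x a 0 m 2 u y] that K unfolding H_def by simp
      also have "\<dots> \<le> C0 * ((4 * K) powr (3/4) + 1)"
      proof (rule mult_left_mono[OF _ C0(1)])
        have "dist (x, a) (x, 0) powr (3/4) \<le> (4 * K) powr (3/4)"
          using that K by (intro powr_mono2) (auto simp: dist_Pair_Pair dist_real_def)
        moreover have "1 / real m \<le> 1 / 2" using that by (simp add: field_simps)
        ultimately show "dist (x, a) (x, 0) powr (3/4) + 1 / real m + 1 / real 2 \<le> (4 * K) powr (3/4) + 1" by simp
      qed
      finally show ?thesis .
    qed
    have Hg: "H g u y \<le> A" if u: "0 \<le> u" "u \<le> T" for u y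
    proof -
      have split: "heat w g y = heat w (circ m x a) y + heat w (circ m' x' a') y" for w
        unfolding heat_def g_def
        by (intro Bochner_Integration.integral_add heat_bound(2)[OF circ_measurable circ_abs_bound]) (use a m in auto)
      have "H g u y = H (circ m x a) u y + H (circ m' x' a') u y"
        unfolding H_def split
        by (intro set_integral_add(2) heat_set_integrable[OF circ_measurable circ_abs_bound]) (use a m in auto)
      also have "\<dots> \<le> A" using single[of x a m u y] single[of x' a' m' u y] x a m u by (simp add: A_def)
      finally show ?thesis .
    qed
    have D0: "0 \<le> D" by (simp add: D_def)
    have DA: "C0 * D \<le> A"
    proof -
      have "dist (x, a) (x', a') \<le> dist x x' + dist a a'" by (simp add: dist_Pair_Pair sqrt_sum_squares_le_sum)
      then have dK: "dist (x, a) (x', a') \<le> 4 * K" using norm_triangle_ineq4[of x x'] x a K by (simp add: dist_norm dist_real_def)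
      then have "dist (x, a) (x', a') powr (3/4) \<le> (4 * K) powr (3/4)" by (intro powr_mono2) auto
      then have "D \<le> (4 * K) powr (3/4) + 1" using im by (simp add: D_def)
      also have "\<dots> \<le> 2 * ((4 * K) powr (3/4) + 1)" by simp
      finally have "C0 * D \<le> C0 * (2 * ((4 * K) powr (3/4) + 1))" using C0 by (intro mult_left_mono)
      then show ?thesis by (simp add: A_def mult_ac)
    qed
    have Zf: "Z (circ m x a) t \<omega> - Z (circ m' x' a') t \<omega> = Z f t \<omega>" for \<omega>
      unfolding Z_def f_def using c
      by (subst set_integral_diff(2)) (auto intro!: borel_integrable_atLeastAtMost' f_B_continuous)
    have "expectation (\<lambda>\<omega>. Z f t \<omega> ^ (2 * k + 2)) \<le> 2 * ((2 * J) ^ Suc k * fact (Suc k) + J) * ((C0 * D) * A) ^ Suc k"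
      unfolding J_def
    proof (rule even_moment_bound[OF fc(1) _ fc(2) _ _ _ DA Hg t])
      show "\<bar>f z\<bar> \<le> g z" for z
        using circ_nonneg[OF a(1), of m x z] circ_nonneg[OF a(3), of m' x' z] by (simp add: f_def g_def)
      show "g z \<le> 2 * real m / a + 2 * real m' / a'" for z
        using circ_abs_bound[OF a(1) m(1), of x z] circ_abs_bound[OF a(3) m(3), of x' z] by (simp add: g_def)
      show "\<bar>H f u y\<bar> \<le> C0 * D" if "0 \<le> u" "u \<le> T" for u y
        unfolding H_def f_def D_def by (rule C0(2)) (use x a m that in auto)
    qed (use C0 D0 in auto)
    also have "\<dots> = C * D ^ Suc k" unfolding C_def by (simp add: power_mult_distrib mult_ac)
    finally show ?thesis unfolding Zf D_def .
  qed
  moreover have "0 \<le> C" using J A C0 by (simp add: C_def)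
  ultimately show ?thesis using that by blast
qed

text \<open>With the exponent 2^n the smoothing error of the potentials is of order 2^(-n), the same
  as the spatial scale at level n.\<close>

definition X :: "nat \<Rightarrow> (real^2) \<times> real \<Rightarrow> real \<Rightarrow> 'w \<Rightarrow> real" where
  "X n p t \<omega> = Z (circ (2 ^ n) (fst p) (snd p)) t \<omega>"

end

text \<open>The lower bound on the radius keeps the profiles of level n below 2 * 4^n and their
  Lipschitz constants of order 2^(7n). Smaller radii are brought in through
  \<open>shift\<close>.\<close>

definition Box :: "real \<Rightarrow> nat \<Rightarrow> ((real^2) \<times> real) set" where
  "Box K n = {p. norm (fst p) \<le> K \<and> 1 / 2 ^ n \<le> snd p \<and> snd p \<le> K}"

text \<open>The mesh 8^(-n) is small against the Lipschitz constant 2 * 4^n of \<open>X n\<close> in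
  time, leaving an error of order 2^(-n).\<close>

definition time_grid :: "real \<Rightarrow> nat \<Rightarrow> real set" where
  "time_grid T n = (\<lambda>i. real i / 8 ^ n) ` {..nat \<lfloor>T * 8 ^ n\<rfloor>}"

lemma Box_pos: "p \<in> Box K n \<Longrightarrow> 0 < snd p"
  by (auto simp: Box_def intro: less_le_trans[rotated])

lemma time_grid_props:
  assumes T: "0 \<le> T"
  shows "finite (time_grid T n)" "real (card (time_grid T n)) \<le> (T + 1) * 8 ^ n"
    "time_grid T n \<subseteq> {0..T}" "t \<in> {0..T} \<Longrightarrow> \<exists>s\<in>time_grid T n. s \<le> t \<and> t - s \<le> 1 / 8 ^ n"
proof -
  show "finite (time_grid T n)" by (simp add: time_grid_def)
  have "card (time_grid T n) \<le> nat \<lfloor>T * 8 ^ n\<rfloor> + 1"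
    unfolding time_grid_def using card_image_le[of "{..nat \<lfloor>T * 8 ^ n\<rfloor>}" "\<lambda>i. real i / 8 ^ n"] by simp
  then have "real (card (time_grid T n)) \<le> real (nat \<lfloor>T * 8 ^ n\<rfloor>) + 1" by linarith
  also have "\<dots> \<le> T * 8 ^ n + 1" using T by simp
  also have "\<dots> \<le> (T + 1) * 8 ^ n" by (simp add: algebra_simps)
  finally show "real (card (time_grid T n)) \<le> (T + 1) * 8 ^ n" .
  show "time_grid T n \<subseteq> {0..T}"
  proof
    fix s assume "s \<in> time_grid T n"
    then obtain i where i: "i \<le> nat \<lfloor>T * 8 ^ n\<rfloor>" "s = real i / 8 ^ n" by (auto simp: time_grid_def)
    have "real i \<le> real (nat \<lfloor>T * 8 ^ n\<rfloor>)" using i by simp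
    also have "\<dots> \<le> T * 8 ^ n" using T by simp
    finally show "s \<in> {0..T}" unfolding i(2) by (simp add: pos_divide_le_eq)
  qed
  assume t: "t \<in> {0..T}"
  have t8: "0 \<le> t * 8 ^ n" using t by simp
  show "\<exists>s\<in>time_grid T n. s \<le> t \<and> t - s \<le> 1 / 8 ^ n"
  proof (intro bexI conjI)
    let ?s = "real (nat \<lfloor>t * 8 ^ n\<rfloor>) / 8 ^ n"
    have r: "real (nat \<lfloor>t * 8 ^ n\<rfloor>) \<le> t * 8 ^ n" "t * 8 ^ n \<le> real (nat \<lfloor>t * 8 ^ n\<rfloor>) + 1"
      using t8 by linarith+
    show "?s \<le> t" using r(1) by (simp add: pos_divide_le_eq)
    have "t - ?s = (t * 8 ^ n - real (nat \<lfloor>t * 8 ^ n\<rfloor>)) / 8 ^ n" by (simp add: diff_divide_distrib)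
    also have "\<dots> \<le> 1 / 8 ^ n" by (intro divide_right_mono) (use r in linarith, simp)
    finally show "t - ?s \<le> 1 / 8 ^ n" .
    have "nat \<lfloor>t * 8 ^ n\<rfloor> \<le> nat \<lfloor>T * 8 ^ n\<rfloor>" using t by (intro nat_mono floor_mono mult_right_mono) auto
    then show "?s \<in> time_grid T n" by (auto simp: time_grid_def)
  qed
qed

text \<open>\<open>Box K n\<close> lies in the ball of radius 2 K of a space of dimension 3, whence
  the constant 2 * 2 K * 3 + 5.\<close>

lemma Box_net:
  assumes K: "1 \<le> K"
  shows "\<exists>N. finite N \<and> N \<subseteq> Box K n \<and> (\<forall>p\<in>Box K n. \<exists>u\<in>N. dist p u \<le> 1 / 2 ^ (8 * n))
     \<and> real (card N) \<le> ((12 * K + 5) * 2 ^ (8 * n)) ^ 3"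
proof -
  have "Box K n \<subseteq> cball 0 (2 * K)"
  proof
    fix p assume p: "p \<in> Box K n"
    have "norm p \<le> norm (fst p) + norm (snd p)" by (metis norm_Pair_le prod.collapse)
    then show "p \<in> cball 0 (2 * K)" using p Box_pos[OF p] by (simp add: Box_def)
  qed
  then obtain N where "finite N" "N \<subseteq> Box K n" "\<And>p. p \<in> Box K n \<Longrightarrow> \<exists>u\<in>N. dist p u \<le> 1 / 2 ^ (8 * n)"
    "real (card N) \<le> ((2 * (2 * K) * DIM((real^2) \<times> real) + 5) / (1 / 2 ^ (8 * n))) ^ DIM((real^2) \<times> real)"
    using finite_net[of "Box K n" "2 * K" "1 / 2 ^ (8 * n)"] K by auto
  then show ?thesis by (intro exI[of _ N]) auto
qed

context continuous_bm
begin

lemma X_measurable [measurable (raw)]: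
  assumes "0 \<le> snd p" and [measurable]: "g \<in> borel_measurable N" "h \<in> N \<rightarrow>\<^sub>M M"
  shows "(\<lambda>z. X n p (g z) (h z)) \<in> borel_measurable N"
  unfolding X_def using circ_measurable[OF assms(1)] by measurable

text \<open>Increments between neighbouring levels suffice: they control the convergence in n, and
  two of them with a common endpoint control the dependence on the parameter at one level. The
  distance 3 / 2^n allows for 1 / 2^n plus two errors of approximation by the nets.\<close>

lemma AE_net_bound:
  fixes P :: "nat \<Rightarrow> ((real^2) \<times> real) set"
  assumes K: "1 \<le> K" and T: "0 \<le> T"
    and P: "\<And>n. finite (P n)" "\<And>n. P n \<subseteq> Box K n" "\<And>n. real (card (P n)) \<le> ((12 * K + 5) * 2 ^ (8 * n)) ^ 3"
  shows "AE \<omega> in M. \<exists>C\<ge>0. \<forall>n\<ge>1. \<forall>u\<in>P n. \<forall>v\<in>P (Suc n). \<forall>s\<in>time_grid T n. dist u v \<le> 3 / 2 ^ n \<longrightarrow>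
     \<bar>X n u s \<omega> - X (Suc n) v s \<omega>\<bar> \<le> C * 2 powr (- real n / 3)"
proof -
  \<comment> \<open>The moment of order 1248 decays like \<open>2\<^bsup>-468n\<^esup>\<close>, which beats the normalisation \<open>2\<^bsup>416n\<^esup>\<close> and the \<open>2\<^bsup>51n\<^esup>\<close> pairs of net points.\<close>
  define k :: nat where "k = 623"
  have k: "2 * k + 2 = 1248" "Suc k = 624" by (simp_all add: k_def)
  obtain C0 where C0: "C0 \<ge> 0" "\<And>(x::real^2) x' a a' m m' t. norm x \<le> K \<Longrightarrow> norm x' \<le> K \<Longrightarrow> 0 \<le> a \<Longrightarrow> a \<le> K \<Longrightarrow> 0 \<le> a' \<Longrightarrow> a' \<le> K \<Longrightarrow>
      2 \<le> m \<Longrightarrow> even m \<Longrightarrow> 2 \<le> m' \<Longrightarrow> even m' \<Longrightarrow> 0 \<le> t \<Longrightarrow> t \<le> T \<Longrightarrow>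
      expectation (\<lambda>\<omega>. (Z (circ m x a) t \<omega> - Z (circ m' x' a') t \<omega>) ^ (2 * k + 2))
        \<le> C0 * (dist (x, a) (x', a') powr (3/4) + 1 / real m + 1 / real m') ^ Suc k"
    using circ_moment_bound[OF K T, of k] by blast
  define I where "I n = {(u, v, s). u \<in> P n \<and> v \<in> P (Suc n) \<and> s \<in> time_grid T n \<and> dist u v \<le> 3 / 2 ^ n}" for n
  have Isub: "I n \<subseteq> P n \<times> P (Suc n) \<times> time_grid T n" for n by (auto simp: I_def)
  have finI: "finite (I n)" for n
    by (rule finite_subset[OF Isub]) (use P(1) time_grid_props(1)[OF T] in auto)
  define C1 where "C1 = 12 * K + 5"
  have C1: "0 \<le> C1" using K by (simp add: C1_def)
  define C2 where "C2 = C1 ^ 3 * (C1 * 256) ^ 3 * (T + 1)"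
  have C2: "0 \<le> C2" using C1 T by (simp add: C2_def)
  \<comment> \<open>51 = 24 + 24 + 3: two nets of mesh 2^(-8n) or finer by a constant factor in
    dimension 3, and about 8^n times.\<close>
  have cardI: "real (card (I n)) \<le> C2 * (2 ^ n) ^ 51" for n
  proof -
    have "card (I n) \<le> card (P n \<times> P (Suc n) \<times> time_grid T n)"
      by (rule card_mono[OF _ Isub]) (use P(1) time_grid_props(1)[OF T] in auto)
    then have "real (card (I n)) \<le> real (card (P n)) * (real (card (P (Suc n))) * real (card (time_grid T n)))"
      by (simp add: card_cartesian_product flip: of_nat_mult)
    also have "\<dots> \<le> (C1 * 2 ^ (8 * n)) ^ 3 * ((C1 * 2 ^ (8 * Suc n)) ^ 3 * ((T + 1) * 8 ^ n))"
      unfolding C1_def using P(3)[of n] P(3)[of "Suc n"] time_grid_props(2)[OF T, of n] K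
      by (intro mult_mono) auto
    also have "\<dots> = C2 * (2 ^ n) ^ 51"
    proof -
      define e :: real where "e = 2 ^ n"
      have e1: "2 ^ (8 * n) = e ^ 8" by (simp add: e_def mult.commute flip: power_mult)
      have e2: "2 ^ (8 * Suc n) = 256 * e ^ 8" by (simp add: e1[symmetric] power_add)
      have "(8::real) ^ n = (2 ^ 3) ^ n" by simp
      also have "\<dots> = e ^ 3" unfolding e_def by (simp only: power_mult[symmetric] mult.commute)
      finally have e3: "(8::real) ^ n = e ^ 3" .
      have e4: "e ^ 51 = (e ^ 8) ^ 3 * ((e ^ 8) ^ 3 * e ^ 3)" by (simp flip: power_mult power_add)
      show ?thesis unfolding e1 e2 e3 unfolding e_def[symmetric] C2_def e4
        by (simp only: power_mult_distrib mult_ac)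
    qed
    finally show ?thesis .
  qed
  \<comment> \<open>5 = 3 + 1 + 1 collects the distance term and the two smoothing errors in units
    of 2^(-3n/4), and 624 is half the order of the moment.\<close>
  define c5 :: real where "c5 = 5 ^ 624"
  have c5: "0 \<le> c5" by (simp add: c5_def)
  have Ebd: "expectation (\<lambda>\<omega>. (X n u s \<omega> - X (Suc n) v s \<omega>) ^ 1248) \<le> C0 * (c5 * (1 / 2 ^ n) ^ 468)"
    if n: "1 \<le> n" and i: "(u, v, s) \<in> I n" for n u v s
  proof -
    have uv: "u \<in> Box K n" "v \<in> Box K (Suc n)" "dist u v \<le> 3 / 2 ^ n" "0 \<le> s" "s \<le> T"
      using i P(2) time_grid_props(3)[OF T, of n] by (auto simp: I_def)
    define b where "b = (1 / 2 ^ n :: real) powr (3/4)"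
    have b0: "0 \<le> b" by (simp add: b_def)
    have nb: "1 / 2 ^ n \<le> b"
    proof -
      have "(1 / 2 ^ n :: real) powr 1 \<le> (1 / 2 ^ n) powr (3/4)" by (intro powr_mono') auto
      then show ?thesis by (simp add: b_def)
    qed
    have m: "2 \<le> (2::nat) ^ n" "even ((2::nat) ^ n)" "2 \<le> (2::nat) ^ Suc n" "even ((2::nat) ^ Suc n)"
      using n by (auto intro: order_trans[OF _ power_increasing[of 1 n "2::nat"]])
    have "expectation (\<lambda>\<omega>. (X n u s \<omega> - X (Suc n) v s \<omega>) ^ 1248)
       \<le> C0 * (dist u v powr (3/4) + 1 / real (2 ^ n) + 1 / real (2 ^ Suc n)) ^ 624"
      using C0(2)[of "fst u" "fst v" "snd u" "snd v" "2 ^ n" "2 ^ Suc n" s] uv m Box_pos[OF uv(1)] Box_pos[OF uv(2)]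
      unfolding X_def k by (simp add: Box_def)
    also have "\<dots> \<le> C0 * (5 * b) ^ 624"
    proof (intro mult_left_mono power_mono)
      have "dist u v powr (3/4) \<le> (3 / 2 ^ n) powr (3/4)" using uv by (intro powr_mono2) auto
      also have "\<dots> = 3 powr (3/4) * b" unfolding b_def by (simp add: powr_mult[symmetric])
      also have "\<dots> \<le> 3 * b"
        using powr_mono[of "3/4" 1 "3::real"] b0 by (intro mult_right_mono) auto
      finally have "dist u v powr (3/4) \<le> 3 * b" .
      moreover have "1 / real (2 ^ Suc n) \<le> 1 / 2 ^ n" by (simp add: field_simps)
      ultimately show "dist u v powr (3/4) + 1 / real (2 ^ n) + 1 / real (2 ^ Suc n) \<le> 5 * b" using nb by simp
    qed (use C0 in auto)
    also have "(5 * b) ^ 624 = c5 * (1 / 2 ^ n) ^ 468"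
    proof -
      have "b ^ 624 = (1 / 2 ^ n) powr 468" unfolding b_def by (subst powr_power) auto
      also have "\<dots> = (1 / 2 ^ n) ^ 468" by (subst powr_numeral) auto
      finally show ?thesis by (simp only: power_mult_distrib c5_def)
    qed
    finally show ?thesis .
  qed
  \<comment> \<open>The index is shifted because levels start at 1. The exponent 416 = 1248 / 3
    normalises increments to the size 2^(-n/3).\<close>
  define Y where "Y n \<omega> = (2 ^ Suc n) ^ 416 * (\<Sum>(u, v, s)\<in>I (Suc n). (X (Suc n) u s \<omega> - X (Suc (Suc n)) v s \<omega>) ^ 1248)" for n \<omega>
  have pint: "integrable M (\<lambda>\<omega>. (X n u s \<omega> - X (Suc n) v s \<omega>) ^ 1248)" if n: "1 \<le> n" and i: "(u, v, s) \<in> I n" for n u v s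
  proof -
    have uv: "u \<in> Box K n" "v \<in> Box K (Suc n)" "0 \<le> s" "s \<le> T"
      using i P(2) time_grid_props(3)[OF T, of n] by (auto simp: I_def)
    have pos: "0 \<le> snd u" "0 \<le> snd v" using Box_pos uv by (auto simp: less_imp_le)
    have m: "2 \<le> (2::nat) ^ n" "2 \<le> (2::nat) ^ Suc n"
      using n by (auto intro: order_trans[OF _ power_increasing[of 1 n "2::nat"]])
    have b1: "\<bar>X n u s \<omega>\<bar> \<le> 2 * real (2 ^ n) / snd u * s" for \<omega>
      unfolding X_def by (rule Z_bound[OF circ_continuous circ_abs_bound]) (use pos m uv in auto)
    have b2: "\<bar>X (Suc n) v s \<omega>\<bar> \<le> 2 * real (2 ^ Suc n) / snd v * s" for \<omega>
      unfolding X_def by (rule Z_bound[OF circ_continuous circ_abs_bound]) (use pos m uv in auto)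
    define W where "W = 2 * real (2 ^ n) / snd u * s + 2 * real (2 ^ Suc n) / snd v * s"
    have "\<bar>X n u s \<omega> - X (Suc n) v s \<omega>\<bar> \<le> W" for \<omega> unfolding W_def using b1[of \<omega>] b2[of \<omega>] by linarith
    then have "\<bar>(X n u s \<omega> - X (Suc n) v s \<omega>) ^ 1248\<bar> \<le> W ^ 1248" for \<omega>
      unfolding power_abs by (intro power_mono) auto
    moreover have "(\<lambda>\<omega>. (X n u s \<omega> - X (Suc n) v s \<omega>) ^ 1248) \<in> borel_measurable M"
      using X_measurable[OF pos(1), of "\<lambda>_. s" M "\<lambda>\<omega>. \<omega>"] X_measurable[OF pos(2), of "\<lambda>_. s" M "\<lambda>\<omega>. \<omega>"] by measurable
    ultimately show ?thesis by (intro integrable_bounded[where C="W ^ 1248"]) auto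
  qed
  have "AE \<omega> in M. \<exists>C. \<forall>n. Y n \<omega> \<le> C"
  proof (rule AE_bounded_of_summable[where c="\<lambda>n. C2 * C0 * c5 * (1/2) ^ Suc n"])
    show "integrable M (Y n)" for n
      unfolding Y_def by (intro integrable_mult_right impI Bochner_Integration.integrable_sum) (auto intro: pint)
    show "0 \<le> Y n \<omega>" for n \<omega>
      unfolding Y_def by (intro mult_nonneg_nonneg sum_nonneg) (auto simp: zero_le_even_power)
    show "expectation (Y n) \<le> C2 * C0 * c5 * (1/2) ^ Suc n" for n
    proof -
      define e :: real where "e = 2 ^ Suc n"
      have e: "0 < e" by (simp add: e_def)
      have "expectation (Y n) = e ^ 416 * (\<Sum>i\<in>I (Suc n). expectation (\<lambda>\<omega>. case i of (u, v, s) \<Rightarrow> (X (Suc n) u s \<omega> - X (Suc (Suc n)) v s \<omega>) ^ 1248))"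
        unfolding Y_def e_def by (subst integral_mult_right_zero, subst Bochner_Integration.integral_sum) (auto intro: pint)
      also have "\<dots> \<le> e ^ 416 * (\<Sum>i\<in>I (Suc n). C0 * (c5 * (1 / e) ^ 468))"
        using Ebd[of "Suc n"] e by (intro mult_left_mono sum_mono) (auto simp: e_def)
      also have "\<dots> = e ^ 416 * (real (card (I (Suc n))) * (C0 * (c5 * (1 / e) ^ 468)))" by simp
      also have "\<dots> \<le> e ^ 416 * ((C2 * e ^ 51) * (C0 * (c5 * (1 / e) ^ 468)))"
        using cardI[of "Suc n"] e C0 c5 by (intro mult_left_mono mult_right_mono) (auto simp: e_def)
      also have "\<dots> = C2 * C0 * c5 * (e ^ 467 * (1 / e) ^ 468)" by (simp flip: power_add)
      also have "e ^ 467 * (1 / e) ^ 468 = 1 / e"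
      proof -
        have "(1 / e) ^ 468 = (1 / e) ^ 467 * (1 / e)" by (subst power_Suc2[symmetric]) simp
        moreover have "e ^ 467 * (1 / e) ^ 467 = 1" using e by (subst power_mult_distrib[symmetric]) simp
        ultimately show ?thesis by (simp add: mult.assoc[symmetric])
      qed
      finally show ?thesis by (simp add: e_def power_one_over)
    qed
    show "summable (\<lambda>n. C2 * C0 * c5 * (1/2) ^ Suc n)"
      by (intro summable_mult summable_Suc_iff[THEN iffD2] summable_geometric) auto
  qed
  then show ?thesis
  proof eventually_elim
    case (elim \<omega>)
    then obtain C where C: "\<And>n. Y n \<omega> \<le> C" by blast
    show ?case
    proof (intro exI[of _ "max 1 C"] conjI allI impI ballI)
      fix n u v s
      assume n: "1 \<le> n" and uvs: "u \<in> P n" "v \<in> P (Suc n)" "s \<in> time_grid T n" "dist u v \<le> 3 / 2 ^ n"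
      obtain j where j: "n = Suc j" using n by (cases n) auto
      have i: "(u, v, s) \<in> I (Suc j)" using uvs by (auto simp: I_def j)
      define D where "D = \<bar>X n u s \<omega> - X (Suc n) v s \<omega>\<bar>"
      define y where "y = D * 2 powr (real n / 3)"
      have "(X (Suc j) u s \<omega> - X (Suc (Suc j)) v s \<omega>) ^ 1248 \<le> (\<Sum>(u, v, s)\<in>I (Suc j). (X (Suc j) u s \<omega> - X (Suc (Suc j)) v s \<omega>) ^ 1248)"
        using member_le_sum[OF i, of "\<lambda>(u, v, s). (X (Suc j) u s \<omega> - X (Suc (Suc j)) v s \<omega>) ^ 1248"] finI
        by (auto simp: zero_le_even_power)
      then have "(2 ^ Suc j) ^ 416 * (X (Suc j) u s \<omega> - X (Suc (Suc j)) v s \<omega>) ^ 1248 \<le> Y j \<omega>"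
        unfolding Y_def by (intro mult_left_mono) auto
      then have "(2 ^ n) ^ 416 * D ^ 1248 \<le> C" using C[of j] by (simp add: j D_def power_even_abs)
      moreover have "y ^ 1248 = (2 ^ n) ^ 416 * D ^ 1248"
      proof -
        have "(2 powr (real n / 3)) ^ 1248 = 2 powr (real n * 416)" by (subst powr_power) (auto simp: mult.commute)
        also have "\<dots> = (2 powr real n) powr 416" by (simp add: powr_powr)
        also have "\<dots> = (2 ^ n) ^ 416" by (subst powr_numeral) (auto simp: powr_realpow)
        finally show ?thesis by (simp only: y_def power_mult_distrib mult.commute)
      qed
      ultimately have yC: "y ^ 1248 \<le> C" by simp
      have y0: "0 \<le> y" by (simp add: y_def D_def)
      \<comment> \<open>For y > 1 the power of order 1248 dominates y, so no root of C has to be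
        taken.\<close>
      have "y \<le> max 1 C"
      proof (cases "y \<le> 1")
        case False
        then have "y ^ 1 \<le> y ^ 1248" by (intro power_increasing) auto
        then show ?thesis using yC by simp
      qed simp
      moreover have "D = y * 2 powr (- real n / 3)"
        by (simp add: y_def mult.assoc powr_add[symmetric])
      ultimately show "\<bar>X n u s \<omega> - X (Suc n) v s \<omega>\<bar> \<le> max 1 C * 2 powr (- real n / 3)"
        unfolding D_def[symmetric] by (auto intro: mult_right_mono)
    qed simp
  qed
qed

lemma Z_diff_bound:
  assumes f: "continuous_on UNIV f" "continuous_on UNIV g" and t: "0 \<le> t"
    and b: "\<And>s. s \<in> {0..t} \<Longrightarrow> \<bar>f (B s \<omega>) - g (B s \<omega>)\<bar> \<le> e"
  shows "\<bar>Z f t \<omega> - Z g t \<omega>\<bar> \<le> e * t"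
proof -
  have "Z f t \<omega> - Z g t \<omega> = (LBINT s:{0..t}. f (B s \<omega>) - g (B s \<omega>))"
    unfolding Z_def using f
    by (subst set_integral_diff(2)) (auto intro!: borel_integrable_atLeastAtMost' f_B_continuous)
  also have "\<dots> = integral {0..t} (\<lambda>s. f (B s \<omega>) - g (B s \<omega>))"
    by (rule set_borel_integral_eq_integral(2), rule borel_integrable_atLeastAtMost')
       (intro continuous_intros f_B_continuous f)
  also have "norm \<dots> \<le> e * (t - 0)"
    by (rule integral_bound) (use t b in \<open>auto intro!: continuous_intros f_B_continuous f\<close>)
  finally show ?thesis by simp
qed

lemma X_time_lipschitz:
  assumes p: "p \<in> Box K n" and n: "1 \<le> n" and s: "0 \<le> s" "s \<le> t"
  shows "\<bar>X n p t \<omega> - X n p s \<omega>\<bar> \<le> 2 * 4 ^ n * (t - s)"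
proof -
  have pos: "0 < snd p" by (rule Box_pos[OF p])
  have m: "2 \<le> (2::nat) ^ n" using n by (auto intro: order_trans[OF _ power_increasing[of 1 n "2::nat"]])
  let ?f = "circ (2 ^ n) (fst p) (snd p)"
  have c: "continuous_on UNIV ?f" using pos by (intro circ_continuous) auto
  have "X n p t \<omega> - X n p s \<omega> = (LBINT v:{s..t}. ?f (B v \<omega>))" unfolding X_def by (rule Z_diff[OF c s])
  also have "\<dots> = integral {s..t} (\<lambda>v. ?f (B v \<omega>))"
    by (rule set_borel_integral_eq_integral(2), rule borel_integrable_atLeastAtMost', rule f_B_continuous[OF c])
  also have "norm \<dots> \<le> 2 * 4 ^ n * (t - s)"
  proof (rule integral_bound)
    fix v
    have "norm (?f (B v \<omega>)) \<le> 2 * real (2 ^ n) / snd p" using circ_abs_bound[of "snd p" "2 ^ n"] pos m by auto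
    also have "\<dots> \<le> 2 * 2 ^ n * 2 ^ n" using p pos by (simp add: Box_def field_simps)
    also have "\<dots> = 2 * 4 ^ n" by (simp flip: power_mult_distrib)
    finally show "norm (?f (B v \<omega>)) \<le> 2 * 4 ^ n" .
  qed (use s c in \<open>auto intro: f_B_continuous\<close>)
  finally show ?thesis by simp
qed

text \<open>Leaving the net is deterministic: on [0, T] the path stays in a ball of random radius L,
  where profiles are Lipschitz in the parameter with constant c 2^(7n), so the mesh 2^(-8n) costs c
  2^(-n) per unit of time. The time grid costs a multiple of 4^n / 8^n. Both are of smaller order
  than 2^(-n/3).\<close>

lemma AE_uniform_increment:
  assumes K: "1 \<le> K" and T: "0 \<le> T"
  shows "AE \<omega> in M. \<exists>C\<ge>0. \<forall>n\<ge>1. \<forall>p\<in>Box K n. \<forall>q\<in>Box K (Suc n). dist p q \<le> 1 / 2 ^ n \<longrightarrow>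
     (\<forall>t\<in>{0..T}. \<bar>X n p t \<omega> - X (Suc n) q t \<omega>\<bar> \<le> C * 2 powr (- real n / 3))"
proof -
  obtain P where P: "\<And>n. finite (P n)" "\<And>n. P n \<subseteq> Box K n"
    "\<And>n p. p \<in> Box K n \<Longrightarrow> \<exists>u\<in>P n. dist p u \<le> 1 / 2 ^ (8 * n)"
    "\<And>n. real (card (P n)) \<le> ((12 * K + 5) * 2 ^ (8 * n)) ^ 3"
    using Box_net[OF K] by metis
  from AE_net_bound[OF K T P(1,2,4)] show ?thesis
  proof eventually_elim
    case (elim \<omega>)
    then obtain C where C: "0 \<le> C" "\<And>n u v s. 1 \<le> n \<Longrightarrow> u \<in> P n \<Longrightarrow> v \<in> P (Suc n) \<Longrightarrow> s \<in> time_grid T n \<Longrightarrow> dist u v \<le> 3 / 2 ^ n \<Longrightarrow>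
       \<bar>X n u s \<omega> - X (Suc n) v s \<omega>\<bar> \<le> C * 2 powr (- real n / 3)" by blast
    have "compact ((\<lambda>t. B t \<omega>) ` {0..T})"
      by (intro compact_continuous_image continuous_on_subset[OF B_cont]) auto
    then obtain L where L: "\<And>s. s \<in> {0..T} \<Longrightarrow> norm (B s \<omega>) \<le> L"
      using compact_imp_bounded bounded_iff by (metis imageI)
    have L0: "0 \<le> L" using L[of 0] T norm_ge_zero[of "B 0 \<omega>"] by (meson atLeastAtMost_iff order_refl order_trans)
    define c where "c = 2 + 6 * (2 * (L + K) + 2 * K * (L + K)\<^sup>2)"
    have c: "0 \<le> c" using L0 K by (simp add: c_def)
    have lip: "\<bar>X n p s \<omega> - X n u s \<omega>\<bar> \<le> c * T / 2 ^ n"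
      if n: "1 \<le> n" and p: "p \<in> Box K n" "u \<in> Box K n" "dist p u \<le> 1 / 2 ^ (8 * n)" and s: "s \<in> {0..T}" for n p u s
    proof -
      have e: "c * 2 ^ (7 * n) * dist p u \<le> c / 2 ^ n"
      proof -
        have "c * 2 ^ (7 * n) * dist p u \<le> c * 2 ^ (7 * n) * (1 / 2 ^ (8 * n))" using c p by (intro mult_left_mono) auto
        also have "(2::real) ^ (8 * n) = 2 ^ (7 * n) * 2 ^ n" by (simp flip: power_add)
        finally show ?thesis by simp
      qed
      have "\<bar>X n p s \<omega> - X n u s \<omega>\<bar> \<le> (c / 2 ^ n) * s"
        unfolding X_def
      proof (rule Z_diff_bound)
        fix r assume r: "r \<in> {0..s}"
        have "norm (B r \<omega>) \<le> L" using r s by (intro L) auto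
        then have "\<bar>circ (2 ^ n) (fst p) (snd p) (B r \<omega>) - circ (2 ^ n) (fst u) (snd u) (B r \<omega>)\<bar> \<le> c * 2 ^ (7 * n) * dist p u"
          using circ_lipschitz[OF n, of "snd p" K "snd u" "fst p" "fst u" "B r \<omega>" L] p by (simp add: Box_def c_def)
        then show "\<bar>circ (2 ^ n) (fst p) (snd p) (B r \<omega>) - circ (2 ^ n) (fst u) (snd u) (B r \<omega>)\<bar> \<le> c / 2 ^ n" using e by linarith
      qed (use Box_pos[OF p(1)] Box_pos[OF p(2)] s in \<open>auto intro!: circ_continuous\<close>)
      also have "\<dots> \<le> (c / 2 ^ n) * T" using c s by (intro mult_left_mono) auto
      finally show ?thesis by simp
    qed
    show ?case
    \<comment> \<open>10 = 2 + 8 are the time errors at levels n and n + 1, and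
      \<open>2 * c * T\<close> accounts for the two net errors.\<close>
    proof (intro exI[of _ "10 + 2 * c * T + C"] conjI allI impI ballI)
      fix n p q t
      assume n: "1 \<le> n" and p: "p \<in> Box K n" and q: "q \<in> Box K (Suc n)" and pq: "dist p q \<le> 1 / 2 ^ n" and t: "t \<in> {0..T}"
      obtain u where u: "u \<in> P n" "dist p u \<le> 1 / 2 ^ (8 * n)" using P(3)[OF p] by blast
      obtain v where v: "v \<in> P (Suc n)" "dist q v \<le> 1 / 2 ^ (8 * Suc n)" using P(3)[OF q] by blast
      obtain s where s: "s \<in> time_grid T n" "s \<le> t" "t - s \<le> 1 / 8 ^ n" using time_grid_props(4)[OF T t] by blast
      have sT: "s \<in> {0..T}" using s time_grid_props(3)[OF T] by blast
      have uB: "u \<in> Box K n" "v \<in> Box K (Suc n)" using u v P(2) by auto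
      have small: "1 / (2::real) ^ (8 * n) \<le> 1 / 2 ^ n" "1 / (2::real) ^ (8 * Suc n) \<le> 1 / 2 ^ n"
        by (intro divide_left_mono power_increasing; simp)+
      have "dist u v \<le> dist p u + dist p q + dist q v"
        using dist_triangle[of u v p] dist_triangle[of p v q] by (simp add: dist_commute)
      also have "\<dots> \<le> 3 / 2 ^ n" using u(2) v(2) pq small by simp
      finally have mid: "\<bar>X n u s \<omega> - X (Suc n) v s \<omega>\<bar> \<le> C * 2 powr (- real n / 3)"
        by (intro C(2)) (use n u v s in auto)
      have l1: "\<bar>X n p s \<omega> - X n u s \<omega>\<bar> \<le> c * T / 2 ^ n" by (rule lip) (use n p uB u sT in auto)
      have "\<bar>X (Suc n) q s \<omega> - X (Suc n) v s \<omega>\<bar> \<le> c * T / 2 ^ Suc n" by (rule lip) (use n q uB v sT in auto)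
      also have "\<dots> \<le> c * T / 2 ^ n" using c T by (intro divide_left_mono) auto
      finally have l2: "\<bar>X (Suc n) q s \<omega> - X (Suc n) v s \<omega>\<bar> \<le> c * T / 2 ^ n" .
      have e8: "(4::real) ^ n * (1 / 8 ^ n) = 1 / 2 ^ n"
        by (simp add: field_simps flip: power_mult_distrib)
      have "\<bar>X n p t \<omega> - X n p s \<omega>\<bar> \<le> 2 * 4 ^ n * (t - s)" by (rule X_time_lipschitz) (use n p s sT in auto)
      also have "\<dots> \<le> 2 * 4 ^ n * (1 / 8 ^ n)" using s by (intro mult_left_mono) auto
      finally have t1: "\<bar>X n p t \<omega> - X n p s \<omega>\<bar> \<le> 2 / 2 ^ n" using e8 by simp
      have "\<bar>X (Suc n) q t \<omega> - X (Suc n) q s \<omega>\<bar> \<le> 2 * 4 ^ Suc n * (t - s)" by (rule X_time_lipschitz) (use n q s sT in auto)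
      also have "\<dots> \<le> 2 * 4 ^ Suc n * (1 / 8 ^ n)" using s by (intro mult_left_mono) auto
      finally have t2: "\<bar>X (Suc n) q t \<omega> - X (Suc n) q s \<omega>\<bar> \<le> 8 / 2 ^ n" using e8 by simp
      have "\<bar>X n p t \<omega> - X (Suc n) q t \<omega>\<bar> \<le> 2 / 2 ^ n + c * T / 2 ^ n + C * 2 powr (- real n / 3) + c * T / 2 ^ n + 8 / 2 ^ n"
      proof -
        have "\<bar>a - b\<bar> \<le> e1 + e2 + e3 + e4 + e5"
          if "\<bar>a - a'\<bar> \<le> e1" "\<bar>b - b'\<bar> \<le> e5" "\<bar>a' - a''\<bar> \<le> e2" "\<bar>b' - b''\<bar> \<le> e4" "\<bar>a'' - b''\<bar> \<le> e3"
          for a b a' b' a'' b'' e1 e2 e3 e4 e5 :: real using that by linarith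
        from this[OF t1 t2 l1 l2 mid] show ?thesis .
      qed
      also have "\<dots> = (10 + 2 * c * T) * (1 / 2 ^ n) + C * 2 powr (- real n / 3)" by (simp add: field_simps)
      also have "\<dots> \<le> (10 + 2 * c * T) * 2 powr (- real n / 3) + C * 2 powr (- real n / 3)"
      proof (intro add_right_mono mult_left_mono)
        have "1 / 2 ^ n = (2::real) powr (- real n)" by (simp add: powr_minus powr_realpow divide_inverse)
        also have "\<dots> \<le> 2 powr (- real n / 3)" by (intro powr_mono) auto
        finally show "1 / 2 ^ n \<le> (2::real) powr (- real n / 3)" .
      qed (use c T in auto)
      finally show "\<bar>X n p t \<omega> - X (Suc n) q t \<omega>\<bar> \<le> (10 + 2 * c * T + C) * 2 powr (- real n / 3)" by (simp add: algebra_simps)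
    qed (use c T C in auto)
  qed
qed

end

section \<open>The limiting local time field\<close>

lemma geometric_Cauchy_limit:
  fixes y :: "nat \<Rightarrow> real"
  assumes st: "\<And>j. 1 \<le> j \<Longrightarrow> \<bar>y j - y (Suc j)\<bar> \<le> C * \<rho> ^ j" and C: "0 \<le> C" and \<rho>: "0 < \<rho>" "\<rho> < 1"
  shows "y \<longlonglongrightarrow> lim y" "\<And>n. 1 \<le> n \<Longrightarrow> \<bar>lim y - y n\<bar> \<le> C / (1 - \<rho>) * \<rho> ^ n"
proof -
  have tail: "\<bar>y (n + k) - y n\<bar> \<le> C / (1 - \<rho>) * \<rho> ^ n" if n: "1 \<le> n" for n k
  proof -
    have "\<bar>y (n + k) - y n\<bar> \<le> C / (1 - \<rho>) * (\<rho> ^ n - \<rho> ^ (n + k))"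
    proof (induction k)
      case (Suc k)
      have "\<bar>y (n + k) - y (Suc (n + k))\<bar> \<le> C * \<rho> ^ (n + k)" by (rule st) (use n in simp)
      moreover have "C * \<rho> ^ (n + k) = C / (1 - \<rho>) * (\<rho> ^ (n + k) - \<rho> ^ (n + Suc k))"
        using \<rho> by (simp add: field_simps)
      moreover have "C / (1 - \<rho>) * (\<rho> ^ n - \<rho> ^ (n + k)) + C / (1 - \<rho>) * (\<rho> ^ (n + k) - \<rho> ^ (n + Suc k)) = C / (1 - \<rho>) * (\<rho> ^ n - \<rho> ^ (n + Suc k))"
        by (simp only: distrib_left[symmetric]) simp
      ultimately show ?case using Suc.IH by (simp only: add_Suc_right)
    qed simp
    also have "\<dots> \<le> C / (1 - \<rho>) * \<rho> ^ n" using C \<rho> by (intro mult_left_mono) auto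
    finally show ?thesis .
  qed
  have "Cauchy y"
  proof (rule metric_CauchyI)
    fix e :: real assume e: "0 < e"
    have "(\<lambda>n. 2 * (C / (1 - \<rho>)) * \<rho> ^ n) \<longlonglongrightarrow> 2 * (C / (1 - \<rho>)) * 0"
      by (intro tendsto_intros LIMSEQ_realpow_zero) (use \<rho> in auto)
    then have "\<forall>\<^sub>F n in sequentially. 2 * (C / (1 - \<rho>)) * \<rho> ^ n < e" using e by (intro order_tendstoD(2)) auto
    then obtain n where n: "1 \<le> n" "2 * (C / (1 - \<rho>)) * \<rho> ^ n < e"
      using eventually_conj[OF eventually_ge_at_top[of 1]] by (metis (no_types, lifting) eventually_sequentially order_refl)
    show "\<exists>M. \<forall>m\<ge>M. \<forall>k\<ge>M. dist (y m) (y k) < e"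
    proof (intro exI allI impI)
      fix m k assume mk: "n \<le> m" "n \<le> k"
      have "\<bar>y m - y n\<bar> \<le> C / (1 - \<rho>) * \<rho> ^ n" "\<bar>y k - y n\<bar> \<le> C / (1 - \<rho>) * \<rho> ^ n"
        using tail[OF n(1), of "m - n"] tail[OF n(1), of "k - n"] mk by simp_all
      then have "\<bar>y m - y k\<bar> \<le> 2 * (C / (1 - \<rho>)) * \<rho> ^ n" by (simp add: mult.assoc)
      then show "dist (y m) (y k) < e" using n(2) by (simp add: dist_real_def)
    qed
  qed
  then show lim: "y \<longlonglongrightarrow> lim y" by (simp add: Cauchy_convergent_iff convergent_LIMSEQ_iff)
  show "\<bar>lim y - y n\<bar> \<le> C / (1 - \<rho>) * \<rho> ^ n" if "1 \<le> n" for n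
  proof (rule tendsto_upperbound)
    show "(\<lambda>k. \<bar>y (n + k) - y n\<bar>) \<longlonglongrightarrow> \<bar>lim y - y n\<bar>"
      using LIMSEQ_ignore_initial_segment[OF lim, of n] by (intro tendsto_intros) (simp add: add.commute)
  qed (use tail[OF that] in auto)
qed

text \<open>Truncating the radius makes every disc admissible at level j. The truncated point moves
  by at most 2^(-j) from one level to the next, which the uniform increment bound tolerates, so the
  limit exists down to radius 0 with the same constant.\<close>

definition shift :: "nat \<Rightarrow> (real^2) \<times> real \<Rightarrow> (real^2) \<times> real" where
  "shift j p = (fst p, max (snd p) (1 / 2 ^ j))"

definition discs :: "real \<Rightarrow> ((real^2) \<times> real) set" where
  "discs K = {p. norm (fst p) \<le> K \<and> 0 < snd p \<and> snd p \<le> K}"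

lemma shift_Box: "p \<in> discs K \<Longrightarrow> 1 \<le> K \<Longrightarrow> shift j p \<in> Box K j"
proof -
  assume *: "p \<in> discs K" "1 \<le> K"
  have "1 / 2 ^ j \<le> (1::real)" by simp
  then have "1 / 2 ^ j \<le> K" using *(2) by linarith
  then show ?thesis using * by (auto simp: shift_def discs_def Box_def)
qed

lemma Box_Suc: "p \<in> Box K n \<Longrightarrow> p \<in> Box K (Suc n)"
proof -
  have "1 / 2 ^ Suc n \<le> (1 / 2 ^ n :: real)" by (simp add: field_simps)
  then show "p \<in> Box K n \<Longrightarrow> p \<in> Box K (Suc n)" by (auto simp: Box_def)
qed

lemma dist_shift_Suc: "dist (shift j p) (shift (Suc j) p) \<le> 1 / 2 ^ j"
proof -
  have "1 / 2 ^ Suc j \<le> (1 / 2 ^ j :: real)" "0 \<le> (1 / 2 ^ Suc j :: real)" by (simp_all add: field_simps)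
  then show ?thesis by (auto simp: shift_def dist_Pair_Pair dist_real_def)
qed

lemma dist_shift_le: "dist (shift j p) (shift j q) \<le> dist p q"
proof -
  have "dist (max (snd p) (1 / 2 ^ j)) (max (snd q) (1 / 2 ^ j)) \<le> dist (snd p) (snd q)"
    by (auto simp: dist_real_def)
  then show ?thesis unfolding shift_def dist_prod_def
    by (intro real_sqrt_le_mono add_mono power_mono) auto
qed

context continuous_bm
begin

definition limit_time :: "(real^2) \<times> real \<Rightarrow> real \<Rightarrow> 'w \<Rightarrow> real" where
  "limit_time p t \<omega> = lim (\<lambda>j. X j (shift j p) t \<omega>)"

text \<open>Isolates the only random input of the pathwise arguments, with its constant as a
  parameter: what follows for a regular path is deterministic.\<close>

definition regular :: "real \<Rightarrow> real \<Rightarrow> real \<Rightarrow> 'w \<Rightarrow> bool" where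
  "regular K T C \<omega> \<longleftrightarrow> (0 \<le> C \<and> (\<forall>n\<ge>1. \<forall>p\<in>Box K n. \<forall>q\<in>Box K (Suc n). dist p q \<le> 1 / 2 ^ n \<longrightarrow>
     (\<forall>t\<in>{0..T}. \<bar>X n p t \<omega> - X (Suc n) q t \<omega>\<bar> \<le> C * 2 powr (- real n / 3))))"

lemma limit_time_limit:
  assumes K: "1 \<le> K" and r: "regular K T C \<omega>" and p: "p \<in> discs K" and t: "t \<in> {0..T}"
  shows "(\<lambda>j. X j (shift j p) t \<omega>) \<longlonglongrightarrow> limit_time p t \<omega>"
    and "1 \<le> n \<Longrightarrow> \<bar>limit_time p t \<omega> - X n (shift n p) t \<omega>\<bar> \<le> C / (1 - 2 powr (-1/3)) * 2 powr (- real n / 3)"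
proof -
  define \<rho> :: real where "\<rho> = 2 powr (-1/3)"
  have \<rho>: "0 < \<rho>" "\<rho> < 1" by (auto simp: \<rho>_def powr_less_one)
  have \<rho>n: "2 powr (- real n / 3) = \<rho> ^ n" for n by (simp add: \<rho>_def powr_power)
  have C: "0 \<le> C" using r by (simp add: regular_def)
  have st: "\<bar>X j (shift j p) t \<omega> - X (Suc j) (shift (Suc j) p) t \<omega>\<bar> \<le> C * \<rho> ^ j" if "1 \<le> j" for j
    using r that shift_Box[OF p K] dist_shift_Suc t unfolding regular_def \<rho>n by blast
  note g = geometric_Cauchy_limit[of "\<lambda>j. X j (shift j p) t \<omega>", OF st C \<rho>]
  show "(\<lambda>j. X j (shift j p) t \<omega>) \<longlonglongrightarrow> limit_time p t \<omega>" unfolding limit_time_def by (rule g(1)) auto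
  show "\<bar>limit_time p t \<omega> - X n (shift n p) t \<omega>\<bar> \<le> C / (1 - 2 powr (-1/3)) * 2 powr (- real n / 3)" if "1 \<le> n"
    using g(2)[OF _ that] unfolding \<rho>n \<rho>_def[symmetric] limit_time_def by simp
qed

text \<open>For points at distance about 2^(-n) the fields of level n are compared by going from
  each point to the same point of level n + 1; passing to the limit costs a geometric tail of the
  same order. For distant points a uniform bound, taken from level 1, is enough.\<close>

lemma limit_time_holder:
  assumes K: "1 \<le> K" and r: "regular K T C \<omega>" and T: "0 \<le> T"
  obtains C' where "0 \<le> C'" "\<And>p q t. p \<in> discs K \<Longrightarrow> q \<in> discs K \<Longrightarrow> t \<in> {0..T} \<Longrightarrow> \<bar>limit_time p t \<omega> - limit_time q t \<omega>\<bar> \<le> C' * dist p q powr (1/3)"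
proof -
  define C1 where "C1 = C / (1 - 2 powr (-1/3))"
  have C: "0 \<le> C" using r by (simp add: regular_def)
  have q1: "2 powr (-1/3) < (1::real)" by (auto simp: powr_less_one)
  have C1: "0 \<le> C1" using C q1 by (simp add: C1_def)
  define C2 where "C2 = 2 * C1 + 2 * C"
  define C3 where "C3 = 2 * C1 + 16 * T"
  have C23: "0 \<le> C2" "0 \<le> C3" using C C1 T by (auto simp: C2_def C3_def)
  have near: "\<bar>limit_time p t \<omega> - limit_time q t \<omega>\<bar> \<le> C2 * 2 powr (- real n / 3)"
    if p: "p \<in> discs K" "q \<in> discs K" and t: "t \<in> {0..T}" and n: "1 \<le> n" "dist p q \<le> 1 / 2 ^ n" for p q t n
  proof -
    let ?p = "shift n p" and ?q = "shift n q"
    have B: "?p \<in> Box K n" "?q \<in> Box K n" "?q \<in> Box K (Suc n)" using shift_Box K p Box_Suc by auto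
    have d: "dist ?p ?q \<le> 1 / 2 ^ n" using dist_shift_le[of n p q] n by linarith
    have "\<bar>X n ?p t \<omega> - X (Suc n) ?q t \<omega>\<bar> \<le> C * 2 powr (- real n / 3)"
      using r n B d t unfolding regular_def by blast
    moreover have "\<bar>X n ?q t \<omega> - X (Suc n) ?q t \<omega>\<bar> \<le> C * 2 powr (- real n / 3)"
    proof -
      have "dist ?q ?q \<le> 1 / 2 ^ n" by simp
      then show ?thesis using r n B t unfolding regular_def by blast
    qed
    moreover have "\<bar>limit_time p t \<omega> - X n ?p t \<omega>\<bar> \<le> C1 * 2 powr (- real n / 3)" "\<bar>limit_time q t \<omega> - X n ?q t \<omega>\<bar> \<le> C1 * 2 powr (- real n / 3)"
      unfolding C1_def using limit_time_limit(2)[OF K r _ t n(1)] p by auto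
    ultimately have "\<bar>limit_time p t \<omega> - limit_time q t \<omega>\<bar> \<le> 2 * (C1 * 2 powr (- real n / 3)) + 2 * (C * 2 powr (- real n / 3))" by linarith
    then show ?thesis by (simp add: C2_def algebra_simps)
  qed
  have far: "\<bar>limit_time p t \<omega> - limit_time q t \<omega>\<bar> \<le> C3" if p: "p \<in> discs K" "q \<in> discs K" and t: "t \<in> {0..T}" for p q t
  proof -
    have b: "\<bar>limit_time p t \<omega>\<bar> \<le> C1 + 8 * T" if p: "p \<in> discs K" for p
    proof -
      let ?p = "shift 1 p"
      have B: "?p \<in> Box K 1" using shift_Box K p by auto
      have "\<bar>X 1 ?p t \<omega>\<bar> \<le> 2 * real (2 ^ 1) / snd ?p * t"
        unfolding X_def using Box_pos[OF B] t by (intro Z_bound circ_continuous circ_abs_bound) auto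
      \<comment> \<open>At level 1 the radius is at least 1/2, so the profile is at most 4 / (1/2) =
        8.\<close>
      also have "\<dots> \<le> 8 * T"
      proof (rule mult_mono)
        show "2 * real (2 ^ 1) / snd ?p \<le> 8" using B Box_pos[OF B] by (simp add: Box_def pos_divide_le_eq)
      qed (use t in auto)
      finally have "\<bar>X 1 ?p t \<omega>\<bar> \<le> 8 * T" .
      moreover have "\<bar>limit_time p t \<omega> - X 1 ?p t \<omega>\<bar> \<le> C1 * 2 powr (- real 1 / 3)"
        unfolding C1_def using limit_time_limit(2)[OF K r p t, of 1] by simp
      moreover have "C1 * 2 powr (- real 1 / 3) \<le> C1 * 1" using C1 q1 by (intro mult_left_mono) auto
      ultimately show ?thesis by linarith
    qed
    show ?thesis using b[OF p(1)] b[OF p(2)] by (simp add: C3_def)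
  qed
  show ?thesis
  proof (rule that[of "2 * (C2 + C3)"])
    fix p q t assume p: "p \<in> discs K" "q \<in> discs K" and t: "t \<in> {0..T}"
    define d where "d = dist p q"
    show "\<bar>limit_time p t \<omega> - limit_time q t \<omega>\<bar> \<le> 2 * (C2 + C3) * dist p q powr (1/3)"
    proof (cases "p = q")
      case False
      then have d0: "0 < d" by (simp add: d_def)
      have two: "(2 * d) powr (1/3) \<le> 2 * d powr (1/3)"
        using powr_mono[of "1/3" 1 "2::real"] d0 by (simp add: powr_mult mult_right_mono)
      show ?thesis
      proof (cases "d \<le> 1/2")
        case True
        \<comment> \<open>The level with 2^(-n-1) <= d <= 2^(-n); it is at least 1 because d <=
          1/2.\<close>
        define n where "n = nat \<lfloor>log 2 (1 / d)\<rfloor>"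
        have l1: "1 \<le> log 2 (1 / d)"
          using True d0 by (subst le_log_iff) (auto simp: field_simps)
        have n1: "1 \<le> n" using l1 by (simp add: n_def le_nat_iff le_floor_iff)
        have nl: "real n \<le> log 2 (1 / d)" "log 2 (1 / d) \<le> real n + 1" using l1 unfolding n_def by linarith+
        have "2 powr real n \<le> 1 / d" using nl(1) d0 by (subst (asm) le_log_iff) auto
        then have "2 ^ n \<le> 1 / d" by (simp add: powr_realpow)
        then have dn: "dist p q \<le> 1 / 2 ^ n" using d0 by (simp add: d_def field_simps)
        have "1 / d \<le> 2 powr (real n + 1)" using nl(2) d0 by (subst (asm) log_le_iff) auto
        then have "2 powr (- real n) \<le> 2 * d" using d0 by (simp add: powr_add powr_minus field_simps)
        then have "(2 powr (- real n)) powr (1/3) \<le> (2 * d) powr (1/3)" by (intro powr_mono2) auto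
        then have "2 powr (- real n / 3) \<le> 2 * d powr (1/3)" using two by (simp add: powr_powr)
        then have "C2 * 2 powr (- real n / 3) \<le> (C2 + C3) * (2 * d powr (1/3))" using C23 by (intro mult_mono) auto
        then show ?thesis using near[OF p t n1 dn] unfolding d_def by (simp only: mult_ac)
      next
        case False
        have "1 = (1::real) powr (1/3)" by simp
        also have "\<dots> \<le> (2 * d) powr (1/3)" using False by (intro powr_mono2) auto
        finally have "1 \<le> 2 * d powr (1/3)" using two by linarith
        then have "C3 * 1 \<le> (C2 + C3) * (2 * d powr (1/3))" using C23 by (intro mult_mono) auto
        then show ?thesis using far[OF p t] unfolding d_def by (simp only: mult_ac)
      qed
    qed simp
  qed (use C23 in simp)
qed

end

section \<open>The limit field as an occupation density\<close>

lemma LBINT_rectangle_swap: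
  fixes q :: "real \<Rightarrow> real \<Rightarrow> real"
  assumes q: "(\<lambda>p. q (fst p) (snd p)) \<in> borel_measurable borel"
    and bd: "\<And>x y. x \<in> {a..b} \<Longrightarrow> y \<in> {c..d} \<Longrightarrow> \<bar>q x y\<bar> \<le> C"
  shows "(LBINT x:{a..b}. LBINT y:{c..d}. q x y) = (LBINT y:{c..d}. LBINT x:{a..b}. q x y)"
proof -
  have [measurable]: "(\<lambda>p. q (fst p) (snd p)) \<in> borel_measurable (lborel \<Otimes>\<^sub>M lborel)"
    using q by (simp add: lborel_prod)
  have "integrable (lborel \<Otimes>\<^sub>M lborel) (\<lambda>p. C * indicator ({a..b} \<times> {c..d}) p)"
    by (intro integrable_mult_right impI integrable_real_indicator)
       (auto simp: lborel.emeasure_pair_measure_Times emeasure_lborel_Icc_eq ennreal_mult_less_top)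
  then have int: "integrable (lborel \<Otimes>\<^sub>M lborel) (\<lambda>(x, y). indicator {a..b} x * (indicator {c..d} y * q x y))"
    by (rule Bochner_Integration.integrable_bound)
       (use bd in \<open>auto simp: case_prod_unfold indicator_def abs_mult intro!: AE_I2 intro: order_trans[OF _ abs_ge_self]\<close>)
  have "(LBINT x:{a..b}. LBINT y:{c..d}. q x y) = (LINT x|lborel. LINT y|lborel. indicator {a..b} x * (indicator {c..d} y * q x y))"
    by (simp add: set_lebesgue_integral_def)
  also have "\<dots> = (LINT y|lborel. LINT x|lborel. indicator {a..b} x * (indicator {c..d} y * q x y))"
    using lborel_pair.Fubini_integral[OF int] by simp
  also have "\<dots> = (LINT y|lborel. LINT x|lborel. indicator {c..d} y * (indicator {a..b} x * q x y))"
    by (simp add: mult.left_commute)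
  also have "\<dots> = (LBINT y:{c..d}. LBINT x:{a..b}. q x y)"
    by (simp add: set_lebesgue_integral_def)
  finally show ?thesis .
qed

text \<open>The weight 1 / a^2 turns the profile into an exact derivative in the radius a. At R = 0
  both sides are 0, the right one through division by 0.\<close>

lemma circ_radial_integral:
  fixes x z :: "real^2"
  assumes c: "0 < c" "c \<le> d" and m: "2 \<le> m"
  defines "R \<equiv> (norm (z - x))\<^sup>2"
  shows "(LBINT a:{c..d}. circ m x a z / a\<^sup>2) = (1 / (1 + (R / d\<^sup>2) ^ m) - 1 / (1 + (R / c\<^sup>2) ^ m)) / R"
proof (cases "R = 0")
  case True
  then have "circ m x a z = 0" for a using m by (simp add: circ_def R_def)
  then show ?thesis using True by (simp add: set_lebesgue_integral_def)
next
  case False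
  then have R: "0 < R" by (simp add: R_def less_le)
  define \<Theta> where "\<Theta> a = a ^ (2*m) / (R ^ m + a ^ (2*m)) / R" for a :: real
  have den: "0 < R ^ m + a ^ (2*m)" for a :: real using R by (intro add_pos_nonneg) auto
  have der: "(\<Theta> has_real_derivative circ m x a z / a\<^sup>2) (at a)" if "0 < a" for a
  proof -
    have dpow: "((\<lambda>a::real. a ^ (2*m)) has_real_derivative real (2*m) * a ^ (2*m-1)) (at a)"
      using DERIV_pow[of "2*m" a] by simp
    have "(\<Theta> has_real_derivative
       ((real (2*m) * a ^ (2*m-1)) * (R ^ m + a ^ (2*m)) - a ^ (2*m) * (0 + real (2*m) * a ^ (2*m-1))) / ((R ^ m + a ^ (2*m)) * (R ^ m + a ^ (2*m))) / R) (at a)"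
      unfolding \<Theta>_def using den[of a] by (intro DERIV_cdivide DERIV_divide dpow DERIV_add DERIV_const) auto
    moreover have "((real (2*m) * a ^ (2*m-1)) * (R ^ m + a ^ (2*m)) - a ^ (2*m) * (0 + real (2*m) * a ^ (2*m-1))) / ((R ^ m + a ^ (2*m)) * (R ^ m + a ^ (2*m))) / R
       = circ m x a z / a\<^sup>2"
    proof -
      have "(real (2*m) * a ^ (2*m-1)) * (R ^ m + a ^ (2*m)) - a ^ (2*m) * (0 + real (2*m) * a ^ (2*m-1)) = 2 * real m * a ^ (2*m-1) * R ^ m"
        by (simp add: algebra_simps)
      moreover have "a ^ (2*m+1) = a ^ (2*m-1) * a\<^sup>2" using m by (simp flip: power_add)
      moreover have "R ^ m = R ^ (m-1) * R" using m by (metis One_nat_def Suc_le_D Suc_1 diff_Suc_1 power_Suc2)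
      ultimately show ?thesis unfolding circ_def R_def[symmetric] using that R
        by (simp add: power2_eq_square)
    qed
    ultimately show ?thesis by simp
  qed
  have cont: "continuous_on {c..d} (\<lambda>a. circ m x a z / a\<^sup>2)"
    unfolding circ_def R_def[symmetric] using den c by (intro continuous_intros) (auto simp: less_le)
  have dw: "(\<Theta> has_vector_derivative circ m x a z / a\<^sup>2) (at a within {c..d})" if "c \<le> a" "a \<le> d" for a
    using der[of a] that c
    by (auto simp: has_real_derivative_iff_has_vector_derivative intro: has_vector_derivative_at_within)
  have "(LBINT a:{c..d}. circ m x a z / a\<^sup>2) = \<Theta> d - \<Theta> c"
    unfolding set_lebesgue_integral_def
    using integral_FTC_atLeastAtMost[OF c(2) dw cont] by simp
  moreover have "\<Theta> a = 1 / (1 + (R / a\<^sup>2) ^ m) / R" if "0 < a" for a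
  proof -
    have "(R / a\<^sup>2) ^ m = R ^ m / a ^ (2*m)" by (simp add: power_divide power_mult)
    then have "1 + (R / a\<^sup>2) ^ m = (R ^ m + a ^ (2*m)) / a ^ (2*m)" using that by (simp add: add_divide_distrib)
    then show ?thesis unfolding \<Theta>_def by simp
  qed
  ultimately show ?thesis using c by (simp add: diff_divide_distrib)
qed

text \<open>The value 1/2 at equality is forced: there 1 / (1 + (\<rho>^2 / a^2)^m) equals 1/2 for
  every m.\<close>

definition step :: "real \<Rightarrow> real \<Rightarrow> real" where
  "step a \<rho> = (if \<rho> < a then 1 else if \<rho> = a then 1/2 else 0)"

lemma step_limit:
  assumes a: "0 < a" and \<rho>: "0 \<le> \<rho>"
  shows "(\<lambda>n. 1 / (1 + (\<rho>\<^sup>2 / a\<^sup>2) ^ (2 ^ n))) \<longlonglongrightarrow> step a \<rho>"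
proof -
  define v where "v = \<rho>\<^sup>2 / a\<^sup>2"
  have v0: "0 \<le> v" by (simp add: v_def)
  have inf: "filterlim (\<lambda>n. (2::nat) ^ n) at_top sequentially"
    by (rule filterlim_subseq) (simp add: strict_mono_def)
  have pw: "(\<lambda>n. w ^ (2 ^ n)) \<longlonglongrightarrow> 0" if "0 \<le> w" "w < 1" for w :: real
    using filterlim_compose[OF LIMSEQ_realpow_zero[OF that] inf] .
  consider "\<rho> < a" | "\<rho> = a" | "a < \<rho>" by linarith
  then show ?thesis
  proof cases
    case 1
    then have "v < 1" using a \<rho> by (simp add: v_def power_strict_mono)
    then have "(\<lambda>n. 1 / (1 + v ^ (2 ^ n))) \<longlonglongrightarrow> 1 / (1 + 0)" by (intro tendsto_intros pw v0) auto
    then show ?thesis using 1 by (simp add: step_def v_def)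
  next
    case 2
    then have "v = 1" using a by (simp add: v_def)
    then show ?thesis using 2 a by (simp add: step_def)
  next
    case 3
    then have "1 < v" using a by (simp add: v_def power_strict_mono)
    then have "(\<lambda>n. (1 / v) ^ (2 ^ n)) \<longlonglongrightarrow> 0" by (intro pw) auto
    then have "(\<lambda>n. 1 / (1 + v ^ (2 ^ n))) \<longlonglongrightarrow> 0"
    proof (rule Lim_null_comparison[rotated], intro always_eventually allI)
      fix n
      have "0 < v ^ (2 ^ n)" using \<open>1 < v\<close> by simp
      then show "norm (1 / (1 + v ^ (2 ^ n))) \<le> (1 / v) ^ (2 ^ n)" by (simp add: power_one_over frac_le)
    qed
    then show ?thesis using 3 by (simp add: step_def v_def)
  qed
qed

text \<open>Supplies a majorant independent of m for dominated convergence, also near the centre.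
  With u = R / c^2 the difference is at most u: for u <= 1 it is at most u^m, and otherwise at most
  1.\<close>

lemma radial_weight_bound:
  fixes R :: real
  assumes R: "0 \<le> R" and c: "0 < c" "c \<le> d" and m: "1 \<le> m"
  shows "\<bar>(1 / (1 + (R / d\<^sup>2) ^ m) - 1 / (1 + (R / c\<^sup>2) ^ m)) / R\<bar> \<le> 1 / c\<^sup>2"
proof (cases "R = 0")
  case False
  with R have R: "0 < R" by simp
  have q: "R / d\<^sup>2 \<le> R / c\<^sup>2" using R c by (intro divide_left_mono power_mono mult_pos_pos) auto
  have mono: "1 / (1 + (R / c\<^sup>2) ^ m) \<le> 1 / (1 + (R / d\<^sup>2) ^ m)"
  proof -
    have "0 < 1 + (R / d\<^sup>2) ^ m" using R by (intro add_pos_nonneg) auto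
    then show ?thesis using R by (intro frac_le add_left_mono power_mono q) auto
  qed
  define u where "u = R / c\<^sup>2"
  have u: "0 < u" using R c by (simp add: u_def)
  have "0 \<le> (R / d\<^sup>2) ^ m" using R by simp
  then have top: "1 / (1 + (R / d\<^sup>2) ^ m) \<le> 1" by (simp add: divide_le_eq)
  have "1 / (1 + (R / d\<^sup>2) ^ m) - 1 / (1 + u ^ m) \<le> u"
  proof (cases "u \<le> 1")
    case True
    have "u ^ m \<le> u ^ 1" using True u m by (intro power_decreasing) auto
    moreover have "1 - 1 / (1 + u ^ m) \<le> u ^ m"
    proof -
      have p: "0 < u ^ m" using u by simp
      then have "1 - 1 / (1 + u ^ m) = u ^ m / (1 + u ^ m)" by (simp add: field_simps)
      also have "\<dots> \<le> u ^ m / 1" using p by (intro divide_left_mono) auto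
      finally show ?thesis by simp
    qed
    ultimately show ?thesis using top by simp
  next
    case False
    have "0 \<le> 1 / (1 + u ^ m)" using u by simp
    then show ?thesis using top False by linarith
  qed
  then have "(1 / (1 + (R / d\<^sup>2) ^ m) - 1 / (1 + u ^ m)) / R \<le> u / R" using R by (intro divide_right_mono) auto
  moreover have "u / R = 1 / c\<^sup>2" using R by (simp add: u_def)
  ultimately show ?thesis using mono R by (simp add: u_def)
qed simp

context continuous_bm
begin

text \<open>For 0 < c < d this is 1 / |z - x|^2 between the two radii and half of that on the two
  circles. The weight is inherited from the factor 1 / a^2 in the radial integral.\<close>

definition shell :: "real \<Rightarrow> real \<Rightarrow> real^2 \<Rightarrow> real^2 \<Rightarrow> real" where
  "shell c d x z = (step d (norm (z - x)) - step c (norm (z - x))) / (norm (z - x))\<^sup>2"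

lemma X_integral_formula:
  assumes c: "0 < c" "c \<le> d" and n: "1 \<le> n" and t: "0 \<le> t"
  shows "(LBINT a:{c..d}. X n (x, a) t \<omega> / a\<^sup>2)
    = (LBINT s:{0..t}. (1 / (1 + ((norm (B s \<omega> - x))\<^sup>2 / d\<^sup>2) ^ (2^n)) - 1 / (1 + ((norm (B s \<omega> - x))\<^sup>2 / c\<^sup>2) ^ (2^n))) / (norm (B s \<omega> - x))\<^sup>2)"
proof -
  have m: "2 \<le> (2::nat) ^ n" using n by (auto intro: order_trans[OF _ power_increasing[of 1 n "2::nat"]])
  define q where "q a s = circ (2^n) x a (B s \<omega>) / a\<^sup>2" for a s
  have Bm: "(\<lambda>s. B s \<omega>) \<in> borel_measurable borel" by (intro borel_measurable_continuous_onI B_cont)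
  have [measurable]: "fst \<in> borel_measurable (borel :: (real \<times> real) measure)" "snd \<in> borel_measurable (borel :: (real \<times> real) measure)"
    by (auto intro!: borel_measurable_continuous_onI continuous_intros)
  have [measurable]: "(\<lambda>p. B (snd p) \<omega>) \<in> borel_measurable (borel :: (real \<times> real) measure)"
    by (rule measurable_compose[OF _ Bm]) measurable
  have qm: "(\<lambda>p. q (fst p) (snd p)) \<in> borel_measurable borel"
    unfolding q_def circ_def by measurable
  have "X n (x, a) t \<omega> / a\<^sup>2 = (LBINT s:{0..t}. q a s)" for a
    by (simp add: X_def Z_def q_def)
  then have "(LBINT a:{c..d}. X n (x, a) t \<omega> / a\<^sup>2) = (LBINT a:{c..d}. LBINT s:{0..t}. q a s)" by simp
  also have "\<dots> = (LBINT s:{0..t}. LBINT a:{c..d}. q a s)"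
  proof (rule LBINT_rectangle_swap[OF qm])
    fix a s assume a: "a \<in> {c..d}"
    have "\<bar>q a s\<bar> = \<bar>circ (2^n) x a (B s \<omega>)\<bar> / a\<^sup>2" by (simp add: q_def)
    also have "\<dots> \<le> (2 * real (2^n) / c) / c\<^sup>2"
    proof (rule frac_le)
      have "\<bar>circ (2^n) x a (B s \<omega>)\<bar> \<le> 2 * real (2^n) / a" using a c m by (intro circ_abs_bound) auto
      also have "\<dots> \<le> 2 * real (2^n) / c" using a c by (intro divide_left_mono) auto
      finally show "\<bar>circ (2^n) x a (B s \<omega>)\<bar> \<le> 2 * real (2^n) / c" .
      show "c\<^sup>2 \<le> a\<^sup>2" using a c by (intro power_mono) auto
    qed (use c in auto)
    finally show "\<bar>q a s\<bar> \<le> (2 * real (2^n) / c) / c\<^sup>2" .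
  qed
  also have "\<dots> = (LBINT s:{0..t}. (1 / (1 + ((norm (B s \<omega> - x))\<^sup>2 / d\<^sup>2) ^ (2^n)) - 1 / (1 + ((norm (B s \<omega> - x))\<^sup>2 / c\<^sup>2) ^ (2^n))) / (norm (B s \<omega> - x))\<^sup>2)"
    unfolding q_def circ_radial_integral[OF c m] ..
  finally show ?thesis .
qed

text \<open>Both sides of \<open>X_integral_formula\<close> converge by dominated convergence, the
  integral over radii through the bounds on the field and the integral over time through
  \<open>radial_weight_bound\<close>. The identity exhibits \<open>limit_time\<close> as the density
  of the occupation measure of the distance to x.\<close>

lemma occupation_formula:
  assumes K: "1 \<le> K" and r: "regular K T C \<omega>" and T: "0 \<le> T" and x: "norm x \<le> K"
    and c: "0 < c" "c \<le> d" "d \<le> K" and t: "t \<in> {0..T}"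
  shows "(LBINT a:{c..d}. limit_time (x, a) t \<omega> / a\<^sup>2) = (LBINT s:{0..t}. shell c d x (B s \<omega>))"
proof -
  have Bm: "(\<lambda>s. B s \<omega>) \<in> borel_measurable borel" by (intro borel_measurable_continuous_onI B_cont)
  note [measurable] = Bm
  \<comment> \<open>From level N on the truncation in \<open>shift\<close> leaves all radii in
    [c, d] unchanged.\<close>
  obtain N where N: "1 \<le> N" "1 / 2 ^ N \<le> c"
  proof -
    obtain k where "(1/2) ^ k < c" using real_arch_pow_inv[of c "1/2"] c by auto
    then have "1 / 2 ^ Suc k \<le> c" by (simp add: power_one_over field_simps)
    then show ?thesis using that[of "Suc k"] by simp
  qed
  have sh: "shift n (x, a) = (x, a)" if "N \<le> n" "c \<le> a" for n a
  proof -
    have "1 / 2 ^ n \<le> (1 / 2 ^ N :: real)" using that by (intro divide_left_mono power_increasing) auto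
    then show ?thesis using that N by (simp add: shift_def max_def)
  qed
  have disc: "(x, a) \<in> discs K" if "a \<in> {c..d}" for a using that c x by (auto simp: discs_def)
  have Xm: "(\<lambda>a. X n (x, a) t \<omega>) \<in> borel_measurable borel" for n
  proof -
    have [measurable]: "(\<lambda>p. B (snd p) \<omega>) \<in> borel_measurable (borel \<Otimes>\<^sub>M lborel)"
      by (rule measurable_compose[OF _ Bm]) measurable
    have "(\<lambda>a. X n (x, a) t \<omega>) = (\<lambda>a. LINT s|lborel. indicator {0..t} s * circ (2^n) x a (B s \<omega>))"
      by (simp add: X_def Z_def set_lebesgue_integral_def fun_eq_iff)
    also have "\<dots> \<in> borel_measurable borel" unfolding circ_def by measurable
    finally show ?thesis .
  qed
  have conv: "(\<lambda>n. X (N + n) (x, a) t \<omega>) \<longlonglongrightarrow> limit_time (x, a) t \<omega>" if a: "a \<in> {c..d}" for a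
  proof -
    have "(\<lambda>n. X (n + N) (shift (n + N) (x, a)) t \<omega>) \<longlonglongrightarrow> limit_time (x, a) t \<omega>"
      by (rule LIMSEQ_ignore_initial_segment[OF limit_time_limit(1)[OF K r disc[OF a] t]])
    then show ?thesis using sh a by (simp add: add.commute)
  qed
  define C1 where "C1 = C / (1 - 2 powr (-1/3))"
  have C: "0 \<le> C" using r by (simp add: regular_def)
  have q1: "2 powr (-1/3) < (1::real)" by (auto simp: powr_less_one)
  have C1: "0 \<le> C1" using C q1 by (simp add: C1_def)
  have L: "(\<lambda>n. LBINT a:{c..d}. X (N + n) (x, a) t \<omega> / a\<^sup>2) \<longlonglongrightarrow> (LBINT a:{c..d}. limit_time (x, a) t \<omega> / a\<^sup>2)"
  proof -
    obtain C' where C': "0 \<le> C'" "\<And>p q t. p \<in> discs K \<Longrightarrow> q \<in> discs K \<Longrightarrow> t \<in> {0..T} \<Longrightarrow> \<bar>limit_time p t \<omega> - limit_time q t \<omega>\<bar> \<le> C' * dist p q powr (1/3)"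
      using limit_time_holder[OF K r T] by blast
    \<comment> \<open>A bound uniform in level and radius: the value at c, the oscillation of the
      limit over [c, d], and the distance to the limit.\<close>
    define W where "W = \<bar>limit_time (x, c) t \<omega>\<bar> + C' * (d - c) powr (1/3) + C1"
    have cc: "c \<in> {c..d}" using c by simp
    have LW: "\<bar>X (N + n) (x, a) t \<omega>\<bar> \<le> W" if a: "a \<in> {c..d}" for a n
    proof -
      have "\<bar>limit_time (x, a) t \<omega> - limit_time (x, c) t \<omega>\<bar> \<le> C' * dist (x, a) (x, c) powr (1/3)"
        by (rule C'(2)[OF disc[OF a] disc[OF cc] t])
      also have "\<dots> \<le> C' * (d - c) powr (1/3)"
        using C' a by (intro mult_left_mono powr_mono2) (auto simp: dist_Pair_Pair dist_real_def)
      finally have 1: "\<bar>limit_time (x, a) t \<omega> - limit_time (x, c) t \<omega>\<bar> \<le> C' * (d - c) powr (1/3)" .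
      have "\<bar>limit_time (x, a) t \<omega> - X (N + n) (shift (N + n) (x, a)) t \<omega>\<bar> \<le> C1 * 2 powr (- real (N + n) / 3)"
        unfolding C1_def by (rule limit_time_limit(2)[OF K r disc[OF a] t]) (use N in simp)
      also have "shift (N + n) (x, a) = (x, a)" using sh a by simp
      also have "C1 * 2 powr (- real (N + n) / 3) \<le> C1 * 1"
        using C1 powr_mono[of "- real (N + n) / 3" 0 "2::real"] by (intro mult_left_mono) auto
      finally show ?thesis using 1 unfolding W_def by linarith
    qed
    show ?thesis unfolding set_lebesgue_integral_def
    proof (rule integral_dominated_convergence[where w="\<lambda>a. W / c\<^sup>2 * indicator {c..d} a"])
      have "(\<lambda>a. indicator {c..d} a *\<^sub>R (limit_time (x, a) t \<omega> / a\<^sup>2)) \<in> borel_measurable borel"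
      proof (rule borel_measurable_LIMSEQ_real)
        show "(\<lambda>n. indicator {c..d} a *\<^sub>R (X (N + n) (x, a) t \<omega> / a\<^sup>2)) \<longlonglongrightarrow> indicator {c..d} a *\<^sub>R (limit_time (x, a) t \<omega> / a\<^sup>2)" for a
          using conv[of a] c by (cases "a \<in> {c..d}") (auto intro!: tendsto_intros)
        show "(\<lambda>a. indicator {c..d} a *\<^sub>R (X (N + n) (x, a) t \<omega> / a\<^sup>2)) \<in> borel_measurable borel" for n
          using Xm[of "N + n"] by measurable
      qed
      then show "(\<lambda>a. indicator {c..d} a *\<^sub>R (limit_time (x, a) t \<omega> / a\<^sup>2)) \<in> borel_measurable lborel" by simp
      show "(\<lambda>a. indicator {c..d} a *\<^sub>R (X (N + n) (x, a) t \<omega> / a\<^sup>2)) \<in> borel_measurable lborel" for n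
        using Xm[of "N + n"] by measurable
      show "integrable lborel (\<lambda>a. W / c\<^sup>2 * indicator {c..d} a)"
        using integrable_indicator_Icc[of c d] by simp
      show "AE a in lborel. (\<lambda>n. indicator {c..d} a *\<^sub>R (X (N + n) (x, a) t \<omega> / a\<^sup>2)) \<longlonglongrightarrow> indicator {c..d} a *\<^sub>R (limit_time (x, a) t \<omega> / a\<^sup>2)"
      proof (intro AE_I2)
        fix a show "(\<lambda>n. indicator {c..d} a *\<^sub>R (X (N + n) (x, a) t \<omega> / a\<^sup>2)) \<longlonglongrightarrow> indicator {c..d} a *\<^sub>R (limit_time (x, a) t \<omega> / a\<^sup>2)"
          using conv[of a] c by (cases "a \<in> {c..d}") (auto intro!: tendsto_intros)
      qed
      show "AE a in lborel. norm (indicator {c..d} a *\<^sub>R (X (N + n) (x, a) t \<omega> / a\<^sup>2)) \<le> W / c\<^sup>2 * indicator {c..d} a" for n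
      proof (intro AE_I2)
        fix a show "norm (indicator {c..d} a *\<^sub>R (X (N + n) (x, a) t \<omega> / a\<^sup>2)) \<le> W / c\<^sup>2 * indicator {c..d} a"
        proof (cases "a \<in> {c..d}")
          case True
          have "\<bar>X (N + n) (x, a) t \<omega>\<bar> / a\<^sup>2 \<le> W / c\<^sup>2"
            using LW[OF True, of n] True c by (intro frac_le power_mono) auto
          then show ?thesis using True by simp
        qed simp
      qed
    qed
  qed
  have step_m[measurable]: "step a \<in> borel_measurable borel" for a
    unfolding step_def by measurable
  have shm[measurable]: "shell c d x \<in> borel_measurable borel" for c d unfolding shell_def by measurable
  have Rt: "(\<lambda>n. LBINT s:{0..t}. (1 / (1 + ((norm (B s \<omega> - x))\<^sup>2 / d\<^sup>2) ^ (2^(N+n))) - 1 / (1 + ((norm (B s \<omega> - x))\<^sup>2 / c\<^sup>2) ^ (2^(N+n)))) / (norm (B s \<omega> - x))\<^sup>2)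
    \<longlonglongrightarrow> (LBINT s:{0..t}. shell c d x (B s \<omega>))"
    unfolding set_lebesgue_integral_def
  proof (rule integral_dominated_convergence[where w="\<lambda>s. 1 / c\<^sup>2 * indicator {0..t} s"])
    have sl: "(\<lambda>n. 1 / (1 + (\<rho>\<^sup>2 / a\<^sup>2) ^ (2 ^ (N + n)))) \<longlonglongrightarrow> step a \<rho>" if "0 < a" "0 \<le> \<rho>" for a \<rho>
      using LIMSEQ_ignore_initial_segment[OF step_limit[OF that], of N] by (simp add: add.commute)
    have pt: "(\<lambda>n. (1 / (1 + ((norm (z - x))\<^sup>2 / d\<^sup>2) ^ (2^(N+n))) - 1 / (1 + ((norm (z - x))\<^sup>2 / c\<^sup>2) ^ (2^(N+n)))) / (norm (z - x))\<^sup>2) \<longlonglongrightarrow> shell c d x z" for z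
    proof (cases "z = x")
      case False
      then show ?thesis unfolding shell_def using c by (intro tendsto_intros sl) auto
    qed (simp add: shell_def)
    show "AE s in lborel. (\<lambda>n. indicator {0..t} s *\<^sub>R ((1 / (1 + ((norm (B s \<omega> - x))\<^sup>2 / d\<^sup>2) ^ (2^(N+n))) - 1 / (1 + ((norm (B s \<omega> - x))\<^sup>2 / c\<^sup>2) ^ (2^(N+n)))) / (norm (B s \<omega> - x))\<^sup>2))
      \<longlonglongrightarrow> indicator {0..t} s *\<^sub>R shell c d x (B s \<omega>)"
      by (intro AE_I2 tendsto_scaleR tendsto_const pt)
    show "AE s in lborel. norm (indicator {0..t} s *\<^sub>R ((1 / (1 + ((norm (B s \<omega> - x))\<^sup>2 / d\<^sup>2) ^ (2^(N+n))) - 1 / (1 + ((norm (B s \<omega> - x))\<^sup>2 / c\<^sup>2) ^ (2^(N+n)))) / (norm (B s \<omega> - x))\<^sup>2))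
       \<le> 1 / c\<^sup>2 * indicator {0..t} s" for n
    proof (intro AE_I2)
      fix s
      show "norm (indicator {0..t} s *\<^sub>R ((1 / (1 + ((norm (B s \<omega> - x))\<^sup>2 / d\<^sup>2) ^ (2^(N+n))) - 1 / (1 + ((norm (B s \<omega> - x))\<^sup>2 / c\<^sup>2) ^ (2^(N+n)))) / (norm (B s \<omega> - x))\<^sup>2))
       \<le> 1 / c\<^sup>2 * indicator {0..t} s"
        using radial_weight_bound[OF zero_le_power2 c(1,2), of "2^(N+n)" "norm (B s \<omega> - x)"]
        by (cases "s \<in> {0..t}") (simp_all only: indicator_simps norm_scaleR, simp_all)
    qed
    show "integrable lborel (\<lambda>s. 1 / c\<^sup>2 * indicator {0..t} s)"
      using integrable_indicator_Icc[of 0 t] by simp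
    show "(\<lambda>s. indicator {0..t} s *\<^sub>R shell c d x (B s \<omega>)) \<in> borel_measurable lborel" by measurable
    show "(\<lambda>s. indicator {0..t} s *\<^sub>R ((1 / (1 + ((norm (B s \<omega> - x))\<^sup>2 / d\<^sup>2) ^ (2^(N+n))) - 1 / (1 + ((norm (B s \<omega> - x))\<^sup>2 / c\<^sup>2) ^ (2^(N+n)))) / (norm (B s \<omega> - x))\<^sup>2)) \<in> borel_measurable lborel" for n
      by measurable
  qed
  have "(LBINT a:{c..d}. X (N + n) (x, a) t \<omega> / a\<^sup>2) = (LBINT s:{0..t}. (1 / (1 + ((norm (B s \<omega> - x))\<^sup>2 / d\<^sup>2) ^ (2^(N+n))) - 1 / (1 + ((norm (B s \<omega> - x))\<^sup>2 / c\<^sup>2) ^ (2^(N+n)))) / (norm (B s \<omega> - x))\<^sup>2)" for n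
    by (rule X_integral_formula) (use c N t in auto)
  with L have "(\<lambda>n. LBINT s:{0..t}. (1 / (1 + ((norm (B s \<omega> - x))\<^sup>2 / d\<^sup>2) ^ (2^(N+n))) - 1 / (1 + ((norm (B s \<omega> - x))\<^sup>2 / c\<^sup>2) ^ (2^(N+n)))) / (norm (B s \<omega> - x))\<^sup>2) \<longlonglongrightarrow> (LBINT a:{c..d}. limit_time (x, a) t \<omega> / a\<^sup>2)"
    by simp
  then show ?thesis using LIMSEQ_unique Rt by blast
qed

end

section \<open>Identification of the field with the local time\<close>

lemma step_bounds: "0 \<le> step a \<rho>" "step a \<rho> \<le> 1" "c \<le> d \<Longrightarrow> step c \<rho> \<le> step d \<rho>"
  by (auto simp: step_def)

context continuous_bm
begin

lemma shell_bounds: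
  assumes c: "0 < c" "c \<le> d"
  shows "0 \<le> shell c d x z" "c\<^sup>2 * shell c d x z \<le> indicat_real {y. c \<le> norm (y - x) \<and> norm (y - x) \<le> d} z"
proof -
  define \<rho> where "\<rho> = norm (z - x)"
  have \<rho>: "0 \<le> \<rho>" by (simp add: \<rho>_def)
  show "0 \<le> shell c d x z" unfolding shell_def using step_bounds(3)[OF c(2)] by simp
  show "c\<^sup>2 * shell c d x z \<le> indicat_real {y. c \<le> norm (y - x) \<and> norm (y - x) \<le> d} z"
  proof (cases "c \<le> \<rho> \<and> \<rho> \<le> d")
    case True
    have "shell c d x z \<le> 1 / \<rho>\<^sup>2"
      unfolding shell_def \<rho>_def[symmetric] using step_bounds(1)[of c \<rho>] step_bounds(2)[of d \<rho>] by (intro divide_right_mono) auto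
    also have "\<dots> \<le> 1 / c\<^sup>2" using True c by (intro divide_left_mono power_mono mult_pos_pos) auto
    finally have "c\<^sup>2 * shell c d x z \<le> 1" using c by (simp add: field_simps)
    then show ?thesis using True by (simp add: \<rho>_def)
  next
    case False
    then have "shell c d x z = 0" unfolding shell_def \<rho>_def[symmetric] using c by (auto simp: step_def)
    then show ?thesis by simp
  qed
qed

text \<open>The radii are widened strictly, because \<open>shell\<close> has only half its weight on
  its boundary circles while the annulus is closed.\<close>

lemma shell_ge:
  assumes c: "0 < c'" "c' < c" "c \<le> d" "d < d'"
  shows "indicat_real {y. c \<le> norm (y - x) \<and> norm (y - x) \<le> d} z \<le> d\<^sup>2 * shell c' d' x z"
proof (cases "c \<le> norm (z - x) \<and> norm (z - x) \<le> d")
  case True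
  then have "shell c' d' x z = 1 / (norm (z - x))\<^sup>2" unfolding shell_def using c by (auto simp: step_def)
  moreover have "(norm (z - x))\<^sup>2 \<le> d\<^sup>2" "0 < (norm (z - x))\<^sup>2" using True c by (auto intro: power_mono)
  moreover from this have "1 \<le> d\<^sup>2 / (norm (z - x))\<^sup>2" by (simp add: pos_le_divide_eq)
  ultimately show ?thesis using True by simp
next
  case False
  then show ?thesis using shell_bounds(1)[of c' d' x z] c by auto
qed

text \<open>The occupation of the annulus lies between multiples of integrals of shells of
  half-widths r and r + r^2. By the occupation formula these are increments of an antiderivative
  \<open>I\<close> of the field over a^2. The extra r^2 is negligible against r, so both bounds tend
  to \<epsilon>^2 times the derivative of \<open>I\<close> at \<epsilon>.\<close>

lemma annulus_limit:
  assumes K: "1 \<le> K" and r: "regular K T C \<omega>" and T: "0 \<le> T" and x: "norm x \<le> K"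
    and \<epsilon>: "0 < \<epsilon>" "\<epsilon> < K" and t: "t \<in> {0..T}"
  shows "(annulus_occupation B x \<epsilon> t \<omega> \<longlongrightarrow> limit_time (x, \<epsilon>) t \<omega>) (at_right 0)"
proof -
  have Bm[measurable]: "(\<lambda>s. B s \<omega>) \<in> borel_measurable borel" by (intro borel_measurable_continuous_onI B_cont)
  have step_m[measurable]: "step a \<in> borel_measurable borel" for a
    unfolding step_def by measurable
  have shm[measurable]: "shell c d x \<in> borel_measurable borel" for c d unfolding shell_def by measurable
  define c0 where "c0 = \<epsilon> / 2"
  have c0: "0 < c0" "c0 < \<epsilon>" using \<epsilon> by (auto simp: c0_def)
  define g where "g a = limit_time (x, a) t \<omega> / a\<^sup>2" for a
  obtain C' where C': "0 \<le> C'" "\<And>p q t. p \<in> discs K \<Longrightarrow> q \<in> discs K \<Longrightarrow> t \<in> {0..T} \<Longrightarrow> \<bar>limit_time p t \<omega> - limit_time q t \<omega>\<bar> \<le> C' * dist p q powr (1/3)"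
    using limit_time_holder[OF K r T] by blast
  have Lc: "continuous_on {c0..K} (\<lambda>a. limit_time (x, a) t \<omega>)"
    unfolding continuous_on_def
  proof
    fix a assume a: "a \<in> {c0..K}"
    have "((\<lambda>b. C' * \<bar>b - a\<bar> powr (1/3)) \<longlongrightarrow> C' * \<bar>a - a\<bar> powr (1/3)) (at a within {c0..K})"
      by (intro tendsto_intros) auto
    then have z: "((\<lambda>b. C' * \<bar>b - a\<bar> powr (1/3)) \<longlongrightarrow> 0) (at a within {c0..K})" by simp
    have "((\<lambda>b. limit_time (x, b) t \<omega> - limit_time (x, a) t \<omega>) \<longlongrightarrow> 0) (at a within {c0..K})"
    proof (rule Lim_null_comparison[OF _ z])
      show "\<forall>\<^sub>F b in at a within {c0..K}. norm (limit_time (x, b) t \<omega> - limit_time (x, a) t \<omega>) \<le> C' * \<bar>b - a\<bar> powr (1/3)"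
        unfolding eventually_at_filter
      proof (intro always_eventually allI impI)
        fix b assume b: "b \<in> {c0..K}"
        have "\<bar>limit_time (x, b) t \<omega> - limit_time (x, a) t \<omega>\<bar> \<le> C' * dist (x, b) (x, a) powr (1/3)"
          using a b x c0 t by (intro C'(2)) (auto simp: discs_def)
        then show "norm (limit_time (x, b) t \<omega> - limit_time (x, a) t \<omega>) \<le> C' * \<bar>b - a\<bar> powr (1/3)"
          by (simp add: dist_Pair_Pair dist_real_def)
      qed
    qed
    then show "((\<lambda>a. limit_time (x, a) t \<omega>) \<longlongrightarrow> limit_time (x, a) t \<omega>) (at a within {c0..K})" by (simp add: LIM_zero_iff)
  qed
  have gc: "continuous_on {c0..K} g" unfolding g_def using Lc c0 by (intro continuous_intros) auto
  define I where "I u = integral {c0..u} g" for u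
  have I_diff: "(LBINT s:{0..t}. shell c d x (B s \<omega>)) = I d - I c" if "c0 \<le> c" "c \<le> d" "d \<le> K" for c d
  proof -
    have "(LBINT s:{0..t}. shell c d x (B s \<omega>)) = (LBINT a:{c..d}. g a)"
      unfolding g_def by (rule occupation_formula[OF K r T x _ _ _ t, symmetric]) (use that c0 in auto)
    also have "\<dots> = integral {c..d} g"
      by (rule set_borel_integral_eq_integral(2), rule borel_integrable_atLeastAtMost', rule continuous_on_subset[OF gc]) (use that in auto)
    also have "\<dots> = I d - I c"
    proof -
      have "integral {c0..c} g + integral {c..d} g = integral {c0..d} g"
        by (rule Henstock_Kurzweil_Integration.integral_combine)
           (use that in \<open>auto intro!: integrable_continuous_interval continuous_on_subset[OF gc]\<close>)
      then show ?thesis by (simp add: I_def)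
    qed
    finally show ?thesis .
  qed
  have "(I has_real_derivative g \<epsilon>) (at \<epsilon> within {c0..K})"
    unfolding I_def by (rule integral_has_real_derivative[OF gc]) (use c0 \<epsilon> in auto)
  then have DI: "(I has_real_derivative g \<epsilon>) (at \<epsilon>)" using c0 \<epsilon> by (simp add: at_within_Icc_at)
  define q where "q h = (I (\<epsilon> + h) - I \<epsilon>) / h" for h
  have ql: "(q \<longlongrightarrow> g \<epsilon>) (at 0)" using DI unfolding DERIV_def q_def .
  have pos: "\<forall>\<^sub>F r::real in at_right 0. 0 < r" by (simp add: eventually_at_right_less)
  have fa: "filterlim f (at 0) (at_right (0::real))" if "(f \<longlongrightarrow> 0) (at_right 0)" "\<And>r. 0 < r \<Longrightarrow> f r \<noteq> 0" for f :: "real \<Rightarrow> real"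
    using that(1) by (rule filterlim_atI) (use pos that(2) in \<open>auto elim: eventually_mono\<close>)
  have id0: "((\<lambda>r::real. r) \<longlongrightarrow> 0) (at_right 0)" by (rule tendsto_ident_at)
  have k0: "((\<lambda>r::real. r + r\<^sup>2) \<longlongrightarrow> 0) (at_right 0)" using tendsto_add[OF id0 tendsto_power[OF id0, of 2]] by simp
  have nz: "r + r\<^sup>2 \<noteq> 0" if "0 < r" for r :: real
  proof -
    have "0 < r + r\<^sup>2" using that by (intro add_pos_pos) auto
    then show ?thesis by simp
  qed
  have q1: "((\<lambda>r. q r) \<longlongrightarrow> g \<epsilon>) (at_right 0)" by (rule filterlim_compose[OF ql fa]) (use id0 in auto)
  have q2: "((\<lambda>r. q (- r)) \<longlongrightarrow> g \<epsilon>) (at_right 0)"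
    by (rule filterlim_compose[OF ql fa]) (use tendsto_minus[OF id0] in auto)
  have q3: "((\<lambda>r. q (r + r\<^sup>2)) \<longlongrightarrow> g \<epsilon>) (at_right 0)"
    by (rule filterlim_compose[OF ql fa]) (use k0 nz in auto)
  have q4: "((\<lambda>r. q (- (r + r\<^sup>2))) \<longlongrightarrow> g \<epsilon>) (at_right 0)"
  proof (rule filterlim_compose[OF ql fa])
    show "((\<lambda>r::real. - (r + r\<^sup>2)) \<longlongrightarrow> 0) (at_right 0)" using tendsto_minus[OF k0] by simp
    show "- (r + r\<^sup>2) \<noteq> 0" if "0 < r" for r :: real using nz[OF that] by simp
  qed
  define lower where "lower r = (\<epsilon> - r)\<^sup>2 * (1/2) * (q r + q (- r))" for r
  \<comment> \<open>The factor (1 + r) / 2 is (r + r^2) / (2 r): \<open>q\<close> divides by the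
    half-width of the shell, the occupation by 2 r.\<close>
  define upper where "upper r = (\<epsilon> + r)\<^sup>2 * ((1 + r) / 2) * (q (r + r\<^sup>2) + q (- (r + r\<^sup>2)))" for r
  have gl: "\<epsilon>\<^sup>2 * g \<epsilon> = limit_time (x, \<epsilon>) t \<omega>" using \<epsilon> by (simp add: g_def)
  have "(lower \<longlongrightarrow> (\<epsilon> - 0)\<^sup>2 * (1/2) * (g \<epsilon> + g \<epsilon>)) (at_right 0)"
    unfolding lower_def by (intro tendsto_intros q1 q2 id0)
  then have ll: "(lower \<longlongrightarrow> limit_time (x, \<epsilon>) t \<omega>) (at_right 0)" using gl by simp
  have "(upper \<longlongrightarrow> (\<epsilon> + 0)\<^sup>2 * ((1 + 0) / 2) * (g \<epsilon> + g \<epsilon>)) (at_right 0)"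
    unfolding upper_def by (intro tendsto_intros q3 q4 id0) auto
  then have ul: "(upper \<longlongrightarrow> limit_time (x, \<epsilon>) t \<omega>) (at_right 0)" using gl by simp
  \<comment> \<open>Keeps \<epsilon> - (r + r^2) above \<open>c0\<close> and \<epsilon> + (r + r^2)
    below K, where \<open>I\<close> is controlled.\<close>
  define e0 where "e0 = min (\<epsilon> / 2) (K - \<epsilon>)"
  have e0: "0 < e0" using \<epsilon> by (simp add: e0_def)
  have sm: "\<forall>\<^sub>F r in at_right 0. r + r\<^sup>2 < e0" using order_tendstoD(2)[OF k0 e0] .
  have sandwich: "lower r \<le> annulus_occupation B x \<epsilon> t \<omega> r \<and> annulus_occupation B x \<epsilon> t \<omega> r \<le> upper r"
    if r0: "0 < r" "r + r\<^sup>2 < e0" for r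
  proof -
    define k where "k = r + r\<^sup>2"
    have rk: "r < k" "k < e0" using r0 by (auto simp: k_def)
    have rng: "c0 \<le> \<epsilon> - r" "\<epsilon> + r \<le> K" "c0 \<le> \<epsilon> - k" "\<epsilon> + k \<le> K" "0 < \<epsilon> - k" "0 < \<epsilon> - r"
      using rk r0 \<epsilon> unfolding e0_def c0_def by auto
    define S where "S = {y. \<epsilon> - r \<le> norm (y - x) \<and> norm (y - x) \<le> \<epsilon> + r}"
    have [measurable]: "S \<in> sets borel" unfolding S_def by measurable
    define occ where "occ = (LBINT s:{0..t}. indicat_real S (B s \<omega>))"
    have iO: "set_integrable lborel {0..t} (\<lambda>s. indicat_real S (B s \<omega>))"
      by (rule set_integrable_bounded[where C=1]) (auto simp: indicator_def)
    have ish: "set_integrable lborel {0..t} (\<lambda>s. w * shell c d x (B s \<omega>))" if "0 < c" "c \<le> d" for c d w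
    proof (rule set_integrable_bounded[where C="\<bar>w\<bar> * (1 / c\<^sup>2)"])
      fix s
      have "c\<^sup>2 * shell c d x (B s \<omega>) \<le> 1" using shell_bounds(2)[OF that, of x "B s \<omega>"] by (auto simp: indicator_def split: if_splits intro: order_trans)
      then have "\<bar>shell c d x (B s \<omega>)\<bar> \<le> 1 / c\<^sup>2" using shell_bounds(1)[OF that, of x "B s \<omega>"] that by (simp add: field_simps)
      then show "\<bar>w * shell c d x (B s \<omega>)\<bar> \<le> \<bar>w\<bar> * (1 / c\<^sup>2)" unfolding abs_mult by (intro mult_left_mono) auto
    qed measurable
    have occ_eq: "annulus_occupation B x \<epsilon> t \<omega> r = 1 / (2 * r) * occ"
      unfolding annulus_occupation_def occ_def S_def ..
    have lo: "(\<epsilon> - r)\<^sup>2 * (I (\<epsilon> + r) - I (\<epsilon> - r)) \<le> occ"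
    proof -
      have "(\<epsilon> - r)\<^sup>2 * (I (\<epsilon> + r) - I (\<epsilon> - r)) = (LBINT s:{0..t}. (\<epsilon> - r)\<^sup>2 * shell (\<epsilon> - r) (\<epsilon> + r) x (B s \<omega>))"
        using I_diff[of "\<epsilon> - r" "\<epsilon> + r"] rng r0 by simp
      also have "\<dots> \<le> occ" unfolding occ_def S_def
        by (rule set_integral_mono[OF ish iO[unfolded S_def]]) (use rng r0 shell_bounds(2) in auto)
      finally show ?thesis .
    qed
    have up: "occ \<le> (\<epsilon> + r)\<^sup>2 * (I (\<epsilon> + k) - I (\<epsilon> - k))"
    proof -
      have "occ \<le> (LBINT s:{0..t}. (\<epsilon> + r)\<^sup>2 * shell (\<epsilon> - k) (\<epsilon> + k) x (B s \<omega>))" unfolding occ_def S_def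
        by (rule set_integral_mono[OF iO[unfolded S_def] ish]) (use rng r0 rk in \<open>auto intro!: shell_ge\<close>)
      also have "\<dots> = (\<epsilon> + r)\<^sup>2 * (I (\<epsilon> + k) - I (\<epsilon> - k))"
        using I_diff[of "\<epsilon> - k" "\<epsilon> + k"] rng r0 rk by simp
      finally show ?thesis .
    qed
    have "lower r = 1 / (2 * r) * ((\<epsilon> - r)\<^sup>2 * (I (\<epsilon> + r) - I (\<epsilon> - r)))"
      unfolding lower_def q_def using r0 by (simp add: field_simps)
    moreover have "upper r = 1 / (2 * r) * ((\<epsilon> + r)\<^sup>2 * (I (\<epsilon> + k) - I (\<epsilon> - k)))"
    proof -
      have k': "k = r * (1 + r)" by (simp add: k_def algebra_simps power2_eq_square)
      have kp: "0 < k" using rk r0 by linarith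
      have e1: "q k + q (- k) = (I (\<epsilon> + k) - I (\<epsilon> - k)) / k"
        unfolding q_def using kp by (simp add: field_simps)
      have e2: "(1 + r) / 2 / k = 1 / (2 * r)"
      proof -
        have "(1 + r) / 2 / k = (1 + r) / ((2 * r) * (1 + r))" by (simp add: k' mult_ac)
        also have "\<dots> = 1 / (2 * r)" using r0 by (intro nonzero_divide_mult_cancel_right) auto
        finally show ?thesis .
      qed
      have "upper r = ((1 + r) / 2 / k) * ((\<epsilon> + r)\<^sup>2 * (I (\<epsilon> + k) - I (\<epsilon> - k)))"
        unfolding upper_def k_def[symmetric] e1 by simp
      then show ?thesis unfolding e2 .
    qed
    ultimately show ?thesis unfolding occ_eq using lo up r0 by (auto intro: divide_right_mono)
  qed
  show ?thesis
  proof (rule tendsto_sandwich[OF _ _ ll ul])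
    show "\<forall>\<^sub>F r in at_right 0. lower r \<le> annulus_occupation B x \<epsilon> t \<omega> r"
      using pos sm by eventually_elim (use sandwich in auto)
    show "\<forall>\<^sub>F r in at_right 0. annulus_occupation B x \<epsilon> t \<omega> r \<le> upper r"
      using pos sm by eventually_elim (use sandwich in auto)
  qed
qed

end

section \<open>Exit time and the modification\<close>

text \<open>Independence says that the joint law is the product of the marginals, and these laws do
  not see null sets. The characterisation by laws is for nonempty index sets, hence the case
  split.\<close>

lemma (in prob_space) indep_vars_cong_AE:
  assumes ind: "indep_vars (\<lambda>_. borel :: 'b::topological_space measure) X I"
    and meas: "\<And>i. i \<in> I \<Longrightarrow> Y i \<in> borel_measurable M"
    and fin: "finite I" and eq: "\<And>i. i \<in> I \<Longrightarrow> AE \<omega> in M. X i \<omega> = Y i \<omega>"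
  shows "indep_vars (\<lambda>_. borel) Y I"
proof (cases "I = {}")
  case True
  then show ?thesis by (simp add: indep_vars_def indep_sets_def)
next
  case False
  have Xm: "X i \<in> borel_measurable M" if "i \<in> I" for i using ind that by (auto simp: indep_vars_def)
  have "AE \<omega> in M. \<forall>i\<in>I. X i \<omega> = Y i \<omega>" using fin eq by (simp add: AE_finite_all)
  then have ae: "AE \<omega> in M. (\<lambda>i\<in>I. X i \<omega>) = (\<lambda>i\<in>I. Y i \<omega>)"
    by eventually_elim (auto simp: restrict_def fun_eq_iff)
  have "distr M (Pi\<^sub>M I (\<lambda>_. borel)) (\<lambda>\<omega>. \<lambda>i\<in>I. Y i \<omega>) = distr M (Pi\<^sub>M I (\<lambda>_. borel)) (\<lambda>\<omega>. \<lambda>i\<in>I. X i \<omega>)"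
    by (rule distr_cong_AE) (use ae meas Xm in \<open>auto intro!: measurable_restrict elim: eventually_mono\<close>)
  also have "\<dots> = Pi\<^sub>M I (\<lambda>i. distr M borel (X i))"
    using ind indep_vars_iff_distr_eq_PiM'[where M'="\<lambda>_. borel" and X=X, OF False Xm] by simp
  also have "\<dots> = Pi\<^sub>M I (\<lambda>i. distr M borel (Y i))"
    by (intro PiM_cong refl distr_cong_AE) (use eq meas Xm in auto)
  finally show ?thesis
    using indep_vars_iff_distr_eq_PiM'[where M'="\<lambda>_. borel" and X=Y, OF False meas] by simp
qed

lemma holder_on_imp_continuous_on:
  assumes h: "holder_on \<alpha> S f" and \<alpha>: "0 < \<alpha>"
  shows "continuous_on S f"
proof -
  obtain C where C: "\<And>p q. p \<in> S \<Longrightarrow> q \<in> S \<Longrightarrow> \<bar>f p - f q\<bar> \<le> C * dist p q powr \<alpha>"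
    using h unfolding holder_on_def by blast
  show ?thesis unfolding continuous_on_def
  proof
    fix p assume p: "p \<in> S"
    have "((\<lambda>q. C * dist q p powr \<alpha>) \<longlongrightarrow> C * dist p p powr \<alpha>) (at p within S)"
      using \<alpha> by (intro tendsto_intros) auto
    then have z: "((\<lambda>q. C * dist q p powr \<alpha>) \<longlongrightarrow> 0) (at p within S)" by simp
    have "((\<lambda>q. f q - f p) \<longlongrightarrow> 0) (at p within S)"
      by (rule Lim_null_comparison[OF _ z]) (use C p in \<open>auto simp: eventually_at_filter intro!: always_eventually\<close>)
    then show "(f \<longlongrightarrow> f p) (at p within S)" by (simp add: LIM_zero_iff)
  qed
qed

text \<open>On a bounded set the surplus exponent \<beta> - \<alpha> is absorbed into the
  constant.\<close>

lemma holder_on_mono: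
  assumes b: "\<And>p q. p \<in> S \<Longrightarrow> q \<in> S \<Longrightarrow> dist p q \<le> R" and R: "0 \<le> R"
    and h: "\<And>p q. p \<in> S \<Longrightarrow> q \<in> S \<Longrightarrow> \<bar>f p - f q\<bar> \<le> C * dist p q powr \<beta>" and C: "0 \<le> C" and \<alpha>: "0 < \<alpha>" "\<alpha> \<le> \<beta>"
  shows "holder_on \<alpha> S f"
  unfolding holder_on_def
proof (intro exI ballI)
  fix p q assume p: "p \<in> S" "q \<in> S"
  have "dist p q powr \<beta> = dist p q powr (\<beta> - \<alpha>) * dist p q powr \<alpha>"
    by (simp add: powr_add[symmetric])
  also have "\<dots> \<le> R powr (\<beta> - \<alpha>) * dist p q powr \<alpha>"
    using b[OF p] \<alpha> by (intro mult_right_mono powr_mono2) auto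
  finally have "C * dist p q powr \<beta> \<le> C * (R powr (\<beta> - \<alpha>) * dist p q powr \<alpha>)" using C by (intro mult_left_mono) auto
  then show "\<bar>f p - f q\<bar> \<le> (C * R powr (\<beta> - \<alpha>)) * dist p q powr \<alpha>" using h[OF p] by (simp add: mult.assoc)
qed

text \<open>Outcomes outside the almost sure event get the constant path x0, and negative times get
  the value at 0. Laws and independence at nonnegative times are unaffected by a change on a null
  set.\<close>

lemma (in planar_brownian_motion) continuous_version:
  obtains N where "N \<in> null_sets M"
    "continuous_bm M (\<lambda>t \<omega>. if \<omega> \<in> space M - N then B (max 0 t) \<omega> else x0) x0"
proof -
  have "AE \<omega> in M. B 0 \<omega> = x0 \<and> continuous_on {0..} (\<lambda>t. B t \<omega>)"
    using start continuous_paths by eventually_elim simp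
  then obtain N where N: "{\<omega> \<in> space M. \<not> (B 0 \<omega> = x0 \<and> continuous_on {0..} (\<lambda>t. B t \<omega>))} \<subseteq> N" "N \<in> null_sets M"
    unfolding eventually_ae_filter by auto
  have [measurable]: "N \<in> sets M" using N by auto
  define B' where "B' t \<omega> = (if \<omega> \<in> space M - N then B (max 0 t) \<omega> else x0)" for t \<omega>
  have good: "B 0 \<omega> = x0" "continuous_on {0..} (\<lambda>t. B t \<omega>)" if "\<omega> \<in> space M - N" for \<omega> using N that by auto
  have B'm: "B' t \<in> borel_measurable M" for t
    unfolding B'_def by (rule measurable_If_set) (use measurable_B[of "max 0 t"] in auto)
  have ae: "AE \<omega> in M. B' t \<omega> = B t \<omega>" if "0 \<le> t" for t
  proof -
    have "AE \<omega> in M. \<omega> \<notin> N" using N(2) by (rule AE_not_in)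
    then show ?thesis by (rule AE_mp) (use that in \<open>auto simp: B'_def intro!: AE_I2\<close>)
  qed
  have ae2: "AE \<omega> in M. B t \<omega> - B s \<omega> = B' t \<omega> - B' s \<omega>" if "0 \<le> s" "0 \<le> t" for s t
    using ae[OF that(1)] ae[OF that(2)] by eventually_elim simp
  have "continuous_bm M B' x0"
  proof
    show "continuous_on UNIV (\<lambda>t. B' t \<omega>)" for \<omega>
    proof (cases "\<omega> \<in> space M - N")
      case True
      have "continuous_on UNIV (\<lambda>t. B (max 0 t) \<omega>)"
        by (rule continuous_on_compose2[OF good(2)[OF True]]) (auto intro!: continuous_intros)
      then show ?thesis using True by (simp add: B'_def)
    qed (simp only: B'_def if_False continuous_on_const)
    show "B' 0 \<omega> = x0" for \<omega> using good by (auto simp: B'_def)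
    show "indep_vars (\<lambda>_. borel) (\<lambda>i \<omega>. B' (t (Suc i)) \<omega> - B' (t i) \<omega>) {..<n}"
      if t: "0 \<le> t 0" "\<And>i. i < n \<Longrightarrow> t i \<le> t (Suc i)" for t :: "nat \<Rightarrow> real" and n
    proof (rule indep_vars_cong_AE[OF indep_increments[OF t]])
      have nn: "0 \<le> t i" if "i \<le> n" for i
        using that
      proof (induction i)
        case (Suc i)
        then show ?case using t(2)[of i] by auto
      qed (use t in auto)
      show "AE \<omega> in M. B (t (Suc i)) \<omega> - B (t i) \<omega> = B' (t (Suc i)) \<omega> - B' (t i) \<omega>" if "i \<in> {..<n}" for i
        using that by (intro ae2 nn) auto
      show "(\<lambda>\<omega>. B' (t (Suc i)) \<omega> - B' (t i) \<omega>) \<in> borel_measurable M" for i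
        using B'm by measurable
    qed auto
    show "distr M borel (\<lambda>\<omega>. B' t \<omega> - B' s \<omega>) = distr gauss2 borel (\<lambda>\<xi>. sqrt (t - s) *\<^sub>R vec2 \<xi>)" if st: "0 \<le> s" "s < t" for s t
    proof -
      have m: "(\<lambda>\<omega>. B t \<omega> - B s \<omega>) \<in> borel_measurable M" using measurable_B st by (intro borel_measurable_diff) auto
      have "distr M borel (\<lambda>\<omega>. B' t \<omega> - B' s \<omega>) = distr M borel (\<lambda>\<omega>. B t \<omega> - B s \<omega>)"
        using ae2[of s t] st B'm m by (intro distr_cong_AE) (auto elim: eventually_mono)
      also have "\<dots> = distr M lborel (\<lambda>\<omega>. B t \<omega> - B s \<omega>)" by (rule distr_cong) auto
      also have "\<dots> = density lborel (\<lambda>z. ennreal (normal_density 0 (sqrt (t - s)) (z $ 1) * normal_density 0 (sqrt (t - s)) (z $ 2)))"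
        using gaussian_increments[OF st] by (simp add: distributed_def)
      also have "\<dots> = distr gauss2 borel (\<lambda>\<xi>. sqrt (t - s) *\<^sub>R vec2 \<xi>)"
        using st by (intro gaussian_law_real2) auto
      finally show ?thesis .
    qed
  qed (rule B'm)
  moreover have "B' = (\<lambda>t \<omega>. if \<omega> \<in> space M - N then B (max 0 t) \<omega> else x0)"
    by (intro ext) (simp add: B'_def)
  ultimately show ?thesis using that[OF N(2)] by simp
qed

section \<open>Measurability of the exit time and of the field at a random time\<close>

context continuous_bm
begin

text \<open>The distance to the complement attains its minimum along the path on [0, u], so the
  complement is hit exactly if this distance becomes arbitrarily small on the grids u k / (m + 1).
  That leaves only countably many events.\<close>

lemma exit_by_measurable:
  assumes D: "open D" "D \<noteq> UNIV"
  shows "{\<omega> \<in> space M. \<exists>t\<in>{0..u}. B t \<omega> \<notin> D} \<in> sets M"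
proof (cases "0 \<le> u")
  case u: True
  have cl: "closed (- D)" "- D \<noteq> {}" using D by auto
  define \<delta> where "\<delta> z = infdist z (- D)" for z
  have \<delta>0: "\<delta> z = 0 \<longleftrightarrow> z \<notin> D" for z unfolding \<delta>_def using cl in_closed_iff_infdist_zero[of "- D" z] by auto
  have \<delta>n: "0 \<le> \<delta> z" for z by (simp add: \<delta>_def infdist_nonneg)
  have \<delta>c: "continuous_on A \<delta>" for A unfolding \<delta>_def by (intro continuous_intros)
  have [measurable]: "\<delta> \<in> borel_measurable borel" by (intro borel_measurable_continuous_onI \<delta>c)
  have \<delta>B: "continuous_on A (\<lambda>s. \<delta> (B s \<omega>))" for A \<omega>
    by (rule continuous_on_compose2[OF \<delta>c[of UNIV] continuous_on_subset[OF B_cont]]) auto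
  have "{\<omega> \<in> space M. \<exists>t\<in>{0..u}. B t \<omega> \<notin> D} =
    (\<Inter>n. \<Union>m. \<Union>k\<in>{..Suc m}. {\<omega> \<in> space M. \<delta> (B (u * (real k / real (Suc m))) \<omega>) < 1 / real (Suc n)})" (is "?L = ?R")
  proof (intro set_eqI iffI)
    fix \<omega> assume "\<omega> \<in> ?L"
    then obtain t where \<omega>: "\<omega> \<in> space M" and t: "0 \<le> t" "t \<le> u" "B t \<omega> \<notin> D" by auto
    \<comment> \<open>For u = 0 the quotient is 0, and u v = t still holds because t = 0 as
      well.\<close>
    define v where "v = t / u"
    have v: "0 \<le> v" "v \<le> 1" "u * v = t" using t u by (auto simp: v_def divide_le_eq_1)
    have "\<exists>m. \<exists>k\<in>{..Suc m}. \<delta> (B (u * (real k / real (Suc m))) \<omega>) < 1 / real (Suc n)" for n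
    proof -
      define k where "k m = nat \<lfloor>v * real (Suc m)\<rfloor>" for m
      have kb: "real (k m) \<le> v * real (Suc m)" "v * real (Suc m) \<le> real (k m) + 1" for m
        using v unfolding k_def by (simp_all del: of_nat_Suc)
      have km: "k m \<le> Suc m" for m
      proof -
        have "v * real (Suc m) \<le> 1 * real (Suc m)" using v by (intro mult_right_mono) auto
        from order_trans[OF kb(1) this] have "real (k m) \<le> real (Suc m)" by (simp only: mult_1_left)
        then show ?thesis by (simp only: of_nat_le_iff)
      qed
      have "(\<lambda>m. real (k m) / real (Suc m)) \<longlonglongrightarrow> v"
      proof (rule tendsto_sandwich)
        show "\<forall>\<^sub>F m in sequentially. v - 1 / real (Suc m) \<le> real (k m) / real (Suc m)"
        proof (intro always_eventually allI)
          fix m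
          have "(v * real (Suc m) - 1) / real (Suc m) \<le> real (k m) / real (Suc m)" using kb(2)[of m] by (intro divide_right_mono) auto
          then show "v - 1 / real (Suc m) \<le> real (k m) / real (Suc m)" by (simp add: diff_divide_distrib del: of_nat_Suc)
        qed
        show "\<forall>\<^sub>F m in sequentially. real (k m) / real (Suc m) \<le> v"
          using kb(1) by (intro always_eventually allI) (simp add: pos_divide_le_eq del: of_nat_Suc)
        show "(\<lambda>m. v - 1 / real (Suc m)) \<longlonglongrightarrow> v"
          using tendsto_diff[OF tendsto_const LIMSEQ_inverse_real_of_nat, of v] by (simp add: inverse_eq_divide)
      qed simp
      then have "(\<lambda>m. u * (real (k m) / real (Suc m))) \<longlonglongrightarrow> t" using tendsto_mult_left[of _ v _ u] v by fastforce
      moreover have "isCont (\<lambda>s. \<delta> (B s \<omega>)) t" using \<delta>B[of UNIV \<omega>] by (simp add: continuous_on_eq_continuous_at)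
      ultimately have "(\<lambda>m. \<delta> (B (u * (real (k m) / real (Suc m))) \<omega>)) \<longlonglongrightarrow> \<delta> (B t \<omega>)" by (rule isCont_tendsto_compose[rotated])
      moreover have "\<delta> (B t \<omega>) < 1 / real (Suc n)" using \<delta>0[of "B t \<omega>"] t by simp
      ultimately have "\<forall>\<^sub>F m in sequentially. \<delta> (B (u * (real (k m) / real (Suc m))) \<omega>) < 1 / real (Suc n)" by (rule order_tendstoD(2))
      then obtain m where "\<delta> (B (u * (real (k m) / real (Suc m))) \<omega>) < 1 / real (Suc n)" by (auto simp: eventually_sequentially)
      then show ?thesis using km[of m] by (intro exI[of _ m] bexI[of _ "k m"]) auto
    qed
    then show "\<omega> \<in> ?R" using \<omega> by blast
  next
    fix \<omega> assume R: "\<omega> \<in> ?R"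
    then have \<omega>: "\<omega> \<in> space M" by blast
    obtain s where s: "s \<in> {0..u}" "\<And>r. r \<in> {0..u} \<Longrightarrow> \<delta> (B s \<omega>) \<le> \<delta> (B r \<omega>)"
      using continuous_attains_inf[OF compact_Icc _ \<delta>B, of 0 u \<omega>] u by auto
    have "\<delta> (B s \<omega>) < 1 / real (Suc n)" for n
    proof -
      obtain m k where mk: "k \<le> Suc m" "\<delta> (B (u * (real k / real (Suc m))) \<omega>) < 1 / real (Suc n)" using R by blast
      have "u * (real k / real (Suc m)) \<le> u * 1" using u mk by (intro mult_left_mono) auto
      then have "u * (real k / real (Suc m)) \<in> {0..u}" using u by auto
      then show ?thesis using s(2) mk(2) by (meson order_le_less_trans)
    qed
    then have "\<delta> (B s \<omega>) = 0" using \<delta>n[of "B s \<omega>"]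
      by (metis inverse_eq_divide less_eq_real_def not_less reals_Archimedean less_asym)
    then show "\<omega> \<in> ?L" using \<delta>0 s \<omega> by auto
  qed
  also have "\<dots> \<in> sets M"
  proof -
    have m: "{\<omega> \<in> space M. \<delta> (B r \<omega>) < c} \<in> sets M" for r c by measurable
    have "(\<Union>m. \<Union>k\<in>{..Suc m}. {\<omega> \<in> space M. \<delta> (B (u * (real k / real (Suc m))) \<omega>) < 1 / real (Suc n)}) \<in> sets M" for n
      by (intro sets.countable_UN'' sets.finite_UN m) auto
    then show ?thesis by (intro sets.countable_INT') auto
  qed
  finally show ?thesis .
qed auto

text \<open>If the path leaves D, the infimum is attained because the set of times outside D is
  closed, and exit before u is the event of \<open>exit_by_measurable\<close>. If it never leaves,
  the value is the constant \<open>Inf {}\<close>, taken on the measurable set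
  \<open>E\<close>.\<close>

lemma exit_time_measurable:
  assumes D: "open D" "D \<noteq> UNIV"
  shows "exit_time B D \<in> borel_measurable M"
  unfolding borel_measurable_iff_le
proof
  fix u :: real
  define A where "A u = {\<omega> \<in> space M. \<exists>t\<in>{0..u}. B t \<omega> \<notin> D}" for u
  have Am: "A u \<in> sets M" for u unfolding A_def by (rule exit_by_measurable[OF D])
  define E where "E = space M - (\<Union>n::nat. A (real n))"
  have Em: "E \<in> sets M" unfolding E_def using Am by auto
  have Eiff: "\<omega> \<in> E \<longleftrightarrow> {t. 0 \<le> t \<and> B t \<omega> \<notin> D} = {}" if "\<omega> \<in> space M" for \<omega>
  proof -
    have "(\<exists>n::nat. \<omega> \<in> A (real n)) \<longleftrightarrow> (\<exists>t\<ge>0. B t \<omega> \<notin> D)"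
    proof
      assume "\<exists>t\<ge>0. B t \<omega> \<notin> D"
      then obtain t where t: "0 \<le> t" "B t \<omega> \<notin> D" by blast
      obtain n :: nat where "t \<le> real n" using real_arch_simple by blast
      then have "\<omega> \<in> A (real n)" using t that by (auto simp: A_def)
      then show "\<exists>n::nat. \<omega> \<in> A (real n)" by blast
    qed (auto simp: A_def)
    then show ?thesis using that unfolding E_def by auto
  qed
  have le: "exit_time B D \<omega> \<le> u \<longleftrightarrow> \<omega> \<in> A u" if \<omega>: "\<omega> \<in> space M" "\<omega> \<notin> E" for \<omega>
  proof -
    define S where "S = {t. 0 \<le> t \<and> B t \<omega> \<notin> D}"
    have ne: "S \<noteq> {}" using Eiff \<omega> by (auto simp: S_def)
    have bb: "bdd_below S" by (auto simp: S_def bdd_below_def)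
    have "S = {0..} \<inter> (\<lambda>t. B t \<omega>) -` (- D)" by (auto simp: S_def)
    moreover have "closed ({0..} \<inter> (\<lambda>t. B t \<omega>) -` (- D))"
      using D by (intro continuous_closed_preimage continuous_on_subset[OF B_cont]) auto
    ultimately have "closed S" by simp
    then have in_S: "Inf S \<in> S" using ne bb by (rule closed_contains_Inf[rotated 2])
    have e: "exit_time B D \<omega> = Inf S" by (simp add: exit_time_def S_def)
    show ?thesis
    proof
      assume "exit_time B D \<omega> \<le> u"
      then show "\<omega> \<in> A u" using in_S \<omega> e by (auto simp: A_def S_def)
    next
      assume "\<omega> \<in> A u"
      then obtain t where "t \<in> S" "t \<le> u" by (auto simp: A_def S_def)
      then show "exit_time B D \<omega> \<le> u" using cInf_lower[OF _ bb] e by fastforce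
    qed
  qed
  have empt: "exit_time B D \<omega> = Inf {}" if "\<omega> \<in> space M" "\<omega> \<in> E" for \<omega>
  proof -
    have "{t. 0 \<le> t \<and> B t \<omega> \<notin> D} = {}" using Eiff that by blast
    then show ?thesis by (simp only: exit_time_def)
  qed
  have "{\<omega> \<in> space M. exit_time B D \<omega> \<le> u} = (A u - E) \<union> (if Inf {} \<le> u then E else {})"
  proof (rule set_eqI)
    fix \<omega>
    have "A u \<subseteq> space M" "E \<subseteq> space M" by (auto simp: A_def E_def)
    then show "\<omega> \<in> {\<omega> \<in> space M. exit_time B D \<omega> \<le> u} \<longleftrightarrow> \<omega> \<in> (A u - E) \<union> (if Inf {} \<le> u then E else {})"
      using le[of \<omega>] empt[of \<omega>] by (cases "\<omega> \<in> space M"; cases "\<omega> \<in> E") auto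
  qed
  then show "{\<omega> \<in> space M. exit_time B D \<omega> \<le> u} \<in> sets M" using Am Em by auto
qed

text \<open>Integer K and T need only countably many null sets, so T can be chosen after the
  outcome, above its exit time.\<close>

lemma AE_regular: "AE \<omega> in M. \<forall>(K::nat) (T::nat). \<exists>C. 1 \<le> K \<longrightarrow> regular (real K) (real T) C \<omega>"
proof (intro AE_all_countable[THEN iffD2] allI)
  fix K T :: nat
  show "AE \<omega> in M. \<exists>C. 1 \<le> K \<longrightarrow> regular (real K) (real T) C \<omega>"
  proof (cases "1 \<le> K")
    case True
    then have "AE \<omega> in M. \<exists>C\<ge>0. \<forall>n\<ge>1. \<forall>p\<in>Box (real K) n. \<forall>q\<in>Box (real K) (Suc n). dist p q \<le> 1 / 2 ^ n \<longrightarrow>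
     (\<forall>t\<in>{0..real T}. \<bar>X n p t \<omega> - X (Suc n) q t \<omega>\<bar> \<le> C * 2 powr (- real n / 3))"
      by (intro AE_uniform_increment) auto
    then show ?thesis by eventually_elim (auto simp: regular_def)
  qed simp
qed

text \<open>On paths that never leave D the exit time is an unspecified real, possibly negative; the
  field then vanishes, in accordance with the empty time integral.\<close>

lemma limit_time_neg_time: "t < 0 \<Longrightarrow> limit_time p t \<omega> = 0"
  by (simp add: limit_time_def X_def Z_def set_lebesgue_integral_def lim_const)

text \<open>The field is the \<open>lim\<close> of a sequence, and this is measurable whether or not
  the sequence converges.\<close>

lemma limit_time_measurable:
  assumes "\<tau> \<in> borel_measurable M" "0 < snd p"
  shows "(\<lambda>\<omega>. limit_time p (\<tau> \<omega>) \<omega>) \<in> borel_measurable M"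
  unfolding limit_time_def
  by (intro borel_measurable_lim_metric X_measurable) (use assms in \<open>auto simp: shift_def\<close>)

end

text \<open>The distance to the empty set is 0, so an admissible radius forces the frontier to be
  nonempty, and a frontier point lies within 2 R of x. The strict bound on the radius leaves the
  room around it that \<open>annulus_limit\<close> requires.\<close>

lemma disc_index_subset:
  assumes "bounded D"
  obtains K :: nat where "1 \<le> K" "disc_index D \<subseteq> {p \<in> discs (real K). snd p < real K}"
proof -
  obtain R where R: "0 < R" "\<And>z. z \<in> D \<Longrightarrow> norm z \<le> R" using assms by (auto simp: bounded_pos)
  obtain K :: nat where K: "2 * R + 1 \<le> real K" using real_arch_simple by blast
  show ?thesis
  proof (rule that[of K])
    show "1 \<le> K" using K R by linarith
    show "disc_index D \<subseteq> {p \<in> discs (real K). snd p < real K}"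
    proof
      fix p assume "p \<in> disc_index D"
      then obtain x \<epsilon> where p: "p = (x, \<epsilon>)" "x \<in> D" "0 < \<epsilon>" "\<epsilon> < infdist x (frontier D)" by (auto simp: disc_index_def)
      have "frontier D \<noteq> {}" using p by (auto simp: infdist_def)
      then obtain y where y: "y \<in> frontier D" by blast
      have "closure D \<subseteq> cball 0 R" using R by (intro closure_minimal) auto
      then have "norm y \<le> R" using y by (auto simp: frontier_def)
      moreover have "norm x \<le> R" using R p by auto
      ultimately have "dist x y \<le> 2 * R" using norm_triangle_ineq4[of x y] by (simp add: dist_norm)
      then have "\<epsilon> < 2 * R" using p infdist_le[OF y, of x] by linarith
      moreover have "norm x \<le> real K" using \<open>norm x \<le> R\<close> K R by linarith
      ultimately show "p \<in> {p \<in> discs (real K). snd p < real K}" using p K R by (auto simp: discs_def)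
    qed
  qed
qed

theorem proposition1p1:
  fixes M :: "'w measure"
    and B :: "real \<Rightarrow> 'w \<Rightarrow> real^2"
    and x0 :: "real^2"
    and D :: "(real^2) set"
  assumes "open D" and "bounded D" and "simply_connected D"
    and "x0 \<in> D"
    and "planar_brownian_motion M B x0"
  shows "(\<forall>(x, \<epsilon>) \<in> disc_index D. AE \<omega> in M.
            \<exists>l. (annulus_occupation B x \<epsilon> (exit_time B D \<omega>) \<omega> \<longlongrightarrow> l) (at_right 0)) \<and>
         (\<exists>Lt :: (real^2) \<times> real \<Rightarrow> 'w \<Rightarrow> real.
            is_modification M (disc_index D)
              (\<lambda>(x, \<epsilon>) \<omega>. local_time B x \<epsilon> (exit_time B D \<omega>) \<omega>) Lt \<and>
            (\<forall>\<omega>\<in>space M. continuous_on (disc_index D) (\<lambda>p. Lt p \<omega>)) \<and>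
            (\<forall>\<omega>\<in>space M. \<forall>\<alpha>. 0 < \<alpha> \<and> \<alpha> < 1/3 \<longrightarrow>
               holder_on \<alpha> (disc_index D) (\<lambda>p. Lt p \<omega>)))"
proof -
  interpret pbm: planar_brownian_motion M B x0 by (rule assms(5))
  obtain N where N: "N \<in> null_sets M" "continuous_bm M (\<lambda>t \<omega>. if \<omega> \<in> space M - N then B (max 0 t) \<omega> else x0) x0"
    using pbm.continuous_version by blast
  define B' where "B' = (\<lambda>t \<omega>. if \<omega> \<in> space M - N then B (max 0 t) \<omega> else x0)"
  interpret continuous_bm M B' x0 using N(2) by (simp add: B'_def)
  obtain K :: nat where K: "1 \<le> K" "disc_index D \<subseteq> {p \<in> discs (real K). snd p < real K}"
    using disc_index_subset[OF assms(2)] by blast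
  have "D \<noteq> UNIV" using assms(2) not_bounded_UNIV by metis
  define \<tau> where "\<tau> = exit_time B' D"
  have \<tau>m: "\<tau> \<in> borel_measurable M"
    unfolding \<tau>_def by (rule exit_time_measurable[OF assms(1) \<open>D \<noteq> UNIV\<close>])
  have "AE \<omega> in M. \<omega> \<notin> N \<and> (\<forall>(K::nat) (T::nat). \<exists>C. 1 \<le> K \<longrightarrow> regular (real K) (real T) C \<omega>)"
    using AE_not_in[OF N(1)] AE_regular by eventually_elim simp
  then obtain N' where N': "{\<omega> \<in> space M. \<not> (\<omega> \<notin> N \<and> (\<forall>(K::nat) (T::nat). \<exists>C. 1 \<le> K \<longrightarrow> regular (real K) (real T) C \<omega>))} \<subseteq> N'" "N' \<in> null_sets M"
    unfolding eventually_ae_filter by auto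
  \<comment> \<open>A measurable set of full measure on which \<open>B\<close> agrees with a
    continuous regular path at nonnegative times; outside it \<open>Lt\<close> can be cut off
    without losing measurability.\<close>
  define G where "G = space M - N'"
  have Gm[measurable]: "G \<in> sets M" unfolding G_def using N'(2) by auto
  have GAE: "AE \<omega> in M. \<omega> \<in> G"
    using AE_not_in[OF N'(2)] AE_space by eventually_elim (simp add: G_def)
  have Gr: "\<omega> \<in> space M - N" "\<exists>C. regular (real K) (real T) C \<omega>" if "\<omega> \<in> G" for \<omega> T
    using that N'(1) K(1) unfolding G_def by blast+
  have path: "B' t \<omega> = B t \<omega>" if "\<omega> \<in> G" "0 \<le> t" for t \<omega>
    using Gr(1)[OF that(1)] that(2) by (simp add: B'_def)
  have \<tau>_eq: "exit_time B D \<omega> = \<tau> \<omega>" if "\<omega> \<in> G" for \<omega>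
  proof -
    have "{t. 0 \<le> t \<and> B t \<omega> \<notin> D} = {t. 0 \<le> t \<and> B' t \<omega> \<notin> D}" using path[OF that] by auto
    then show ?thesis by (simp add: \<tau>_def exit_time_def)
  qed
  have occ_eq: "annulus_occupation B x \<epsilon> t \<omega> = annulus_occupation B' x \<epsilon> t \<omega>" if "\<omega> \<in> G" for x \<epsilon> t \<omega>
    unfolding annulus_occupation_def fun_eq_iff
    using path[OF that] by (auto intro!: set_lebesgue_integral_cong)
  have lim: "(annulus_occupation B x \<epsilon> (exit_time B D \<omega>) \<omega> \<longlongrightarrow> limit_time (x, \<epsilon>) (\<tau> \<omega>) \<omega>) (at_right 0)"
    if xD: "(x, \<epsilon>) \<in> disc_index D" and wG: "\<omega> \<in> G" for x \<epsilon> \<omega>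
  proof -
    have x\<epsilon>: "norm x \<le> real K" "0 < \<epsilon>" "\<epsilon> < real K" using xD K(2) by (auto simp: discs_def)
    show ?thesis
    \<comment> \<open>A negative value can only be \<open>Inf {}\<close>, on a path that never
      leaves D; occupation and field are then both 0.\<close>
    proof (cases "0 \<le> \<tau> \<omega>")
      case True
      obtain T :: nat where T: "\<tau> \<omega> \<le> real T" using real_arch_simple by blast
      obtain C where C: "regular (real K) (real T) C \<omega>" using Gr(2)[OF wG] by blast
      show ?thesis unfolding occ_eq[OF wG] \<tau>_eq[OF wG]
        by (rule annulus_limit[OF _ C]) (use K x\<epsilon> True T in auto)
    next
      case False
      then have "annulus_occupation B' x \<epsilon> (\<tau> \<omega>) \<omega> = (\<lambda>r. 0)"
        by (auto simp: annulus_occupation_def fun_eq_iff set_lebesgue_integral_def)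
      then show ?thesis unfolding occ_eq[OF wG] \<tau>_eq[OF wG] using False by (simp add: limit_time_neg_time)
    qed
  qed
  \<comment> \<open>Zero outside \<open>G\<close>, so that continuity and the Hoelder bounds hold
    for every outcome and not only almost surely.\<close>
  define Lt where "Lt p \<omega> = (if \<omega> \<in> G then limit_time p (\<tau> \<omega>) \<omega> else 0)" for p \<omega>
  have holder: "holder_on \<alpha> (disc_index D) (\<lambda>p. Lt p \<omega>)" if \<alpha>: "0 < \<alpha>" "\<alpha> < 1/3" for \<alpha> \<omega>
  proof -
    \<comment> \<open>The endpoint exponent 1/3 is attained; smaller exponents follow since the
      index set is bounded.\<close>
    have "\<exists>C\<ge>0. \<forall>p\<in>disc_index D. \<forall>q\<in>disc_index D. \<bar>Lt p \<omega> - Lt q \<omega>\<bar> \<le> C * dist p q powr (1/3)"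
    proof (cases "\<omega> \<in> G \<and> 0 \<le> \<tau> \<omega>")
      case True
      obtain T :: nat where T: "\<tau> \<omega> \<le> real T" using real_arch_simple by blast
      obtain C where C: "regular (real K) (real T) C \<omega>" using Gr(2) True by blast
      obtain C' where C': "0 \<le> C'" "\<And>p q t. p \<in> discs (real K) \<Longrightarrow> q \<in> discs (real K) \<Longrightarrow> t \<in> {0..real T} \<Longrightarrow> \<bar>limit_time p t \<omega> - limit_time q t \<omega>\<bar> \<le> C' * dist p q powr (1/3)"
        using limit_time_holder[OF _ C] K by auto
      show ?thesis
      proof (intro exI[of _ C'] conjI ballI C'(1))
        fix p q assume "p \<in> disc_index D" "q \<in> disc_index D"
        then have "p \<in> discs (real K)" "q \<in> discs (real K)" using K(2) by blast+
        from C'(2)[OF this, of "\<tau> \<omega>"] show "\<bar>Lt p \<omega> - Lt q \<omega>\<bar> \<le> C' * dist p q powr (1/3)"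
          using T True by (simp add: Lt_def)
      qed
    next
      case False
      then have "Lt p \<omega> = 0" for p by (auto simp: Lt_def limit_time_neg_time)
      then show ?thesis by (intro exI[of _ 0]) auto
    qed
    then obtain C where C: "0 \<le> C" "\<And>p q. p \<in> disc_index D \<Longrightarrow> q \<in> disc_index D \<Longrightarrow> \<bar>Lt p \<omega> - Lt q \<omega>\<bar> \<le> C * dist p q powr (1/3)" by blast
    show ?thesis
    proof (rule holder_on_mono[OF _ _ C(2) C(1) \<alpha>(1)])
      fix p q assume "p \<in> disc_index D" "q \<in> disc_index D"
      then have pq: "p \<in> discs (real K)" "q \<in> discs (real K)" using K(2) by auto
      have "dist p q \<le> dist (fst p) (fst q) + dist (snd p) (snd q)"
        unfolding dist_prod_def by (simp add: sqrt_sum_squares_le_sum)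
      also have "\<dots> \<le> 2 * real K + real K"
        using pq norm_triangle_ineq4[of "fst p" "fst q"] by (intro add_mono) (auto simp: discs_def dist_norm dist_real_def)
      finally show "dist p q \<le> 3 * real K" by simp
    qed (use \<alpha> in auto)
  qed
  have cont: "continuous_on (disc_index D) (\<lambda>p. Lt p \<omega>)" for \<omega>
    by (rule holder_on_imp_continuous_on[OF holder[of "1/4"]]) auto
  have modif: "is_modification M (disc_index D) (\<lambda>(x, \<epsilon>) \<omega>. local_time B x \<epsilon> (exit_time B D \<omega>) \<omega>) Lt"
    unfolding is_modification_def
  proof (intro ballI conjI)
    fix p assume p: "p \<in> disc_index D"
    obtain x \<epsilon> where x\<epsilon>: "p = (x, \<epsilon>)" by (cases p)
    have pos: "0 < snd p" using p by (auto simp: disc_index_def)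
    have [measurable]: "(\<lambda>\<omega>. limit_time p (\<tau> \<omega>) \<omega>) \<in> borel_measurable M" by (rule limit_time_measurable[OF \<tau>m pos])
    show "Lt p \<in> borel_measurable M" unfolding Lt_def by measurable
    show "AE \<omega> in M. Lt p \<omega> = (case p of (x, \<epsilon>) \<Rightarrow> \<lambda>\<omega>. local_time B x \<epsilon> (exit_time B D \<omega>) \<omega>) \<omega>"
      using GAE
    proof eventually_elim
      case (elim \<omega>)
      \<comment> \<open>The limit of \<open>annulus_occupation\<close> exists on \<open>G\<close>,
        so \<open>Lim\<close> returns it and no unspecified value enters.\<close>
      have "local_time B x \<epsilon> (exit_time B D \<omega>) \<omega> = limit_time (x, \<epsilon>) (\<tau> \<omega>) \<omega>"
        unfolding local_time_def by (rule tendsto_Lim) (use lim[of x \<epsilon> \<omega>] p x\<epsilon> elim in auto)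
      then show ?case using elim x\<epsilon> by (simp add: Lt_def)
    qed
  qed
  have "\<forall>(x, \<epsilon>) \<in> disc_index D. AE \<omega> in M. \<exists>l. (annulus_occupation B x \<epsilon> (exit_time B D \<omega>) \<omega> \<longlongrightarrow> l) (at_right 0)"
    using lim GAE by (auto elim!: eventually_mono)
  then show ?thesis using modif cont holder by blast
qed

end
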